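(* Let $F$ be a finite-rank free group, let $R$ be a finite subset of $\{g,\ {}^Fg : g\in F\setminus\{1\}\}$, and let $X$ be any $F$-basis. Then Whitehead's cutvertex algorithm (described in the context), applied to the pair $(X,R)$, stops after finitely many steps, whatever choices are made, and if $X_*$ denotes the $F$-basis which it outputs, then $\{\langle Y\rangle : Y\in\mathcal{P}(X_*;R)\}$ is an atomic $R$-allocating $F$-factorization, and it has maximum size (number of factors) among all $R$-allocating $F$-factorizations.
   Context: Basic notation. For $f,g\in F$, ${}^fg:=fgf^{-1}$ and ${}^Fg:=\{{}^fg: f\in F\}$. An $F$-basis is a free-generating set of $F$. An $F$-element is an element of $F$, and a (nontrivial) $F$-class is the conjugacy class ${}^Fg$ of a (nontrivial) element $g$ of $F$; thus $R$ is a finite set of nontrivial $F$-elements and nontrivial $F$-classes. Factorizations. An $F$-factorization is a multiset $\mathcal{H}$ of subgroups of $F$ such that the induced map $\ast_{H\in\mathcal{H}}H\to F$ is an isomorphism; the elements of $\mathcal{H}$ are called its factors. It is $R$-allocating if each factor is nontrivial and $R\subseteq\{h,{}^Fh : h\in H,\ H\in\mathcal{H}\}$. An $R$-allocating $F$-factorization $\mathcal{H}$ is atomic if no proper free-product refinement of $\ast_{H\in\mathcal H}H$ (obtained by further decomposing factors as nontrivial free products) is $R$-allocating. Words, lengths, turns, supports. For an $F$-basis $X$ put $X^{\pm1}:=X\cup X^{-1}$ and $X^{0,\pm1}:=\{1\}\cup X^{\pm1}$. Let $r$ be a nontrivial $F$-element (resp. nontrivial $F$-class). There is a finite sequence $(x_1,\ldots,x_n)$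 in $X^{\pm1}$, unique (resp. unique up to cyclic permutation), such that $r$ equals (resp. contains) $x_1\cdots x_n$ and $x_i^{-1}\ne x_{i+1}$ for all $i\in\{0,1,\ldots,n\}$, where $x_0:=x_{n+1}:=1$ (resp. $x_0:=x_n$, $x_{n+1}:=x_1$). Define $X\text{-length}(r):=n$, the set of $X$-turns of $r$ to be $\{(x_i^{-1},x_{i+1}) : 0\le i\le n\}\subseteq X^{0,\pm1}\times X^{0,\pm1}$, and $X\text{-support}(r):=\{x_1,\ldots,x_n\}^{\pm1}\cap X$. For a set $R$ of such $r$, $X\text{-length}(R):=\sum_{r\in R}X\text{-length}(r)$, and the $X$-turns of $R$ are the $X$-turns of the elements of $R$. $\mathcal{P}(X;R)$ denotes the finest partition of $X$ such that for each $r\in R$ some element of the partition includes $X\text{-support}(r)$. For $Y\in\mathcal{P}(X;R)$, $R_{|Y,X}:=\{r\in R : X\text{-support}(r)\subseteq Y\}$, viewed as a set of $\langle Y\rangle$-elements and $\langle Y\rangle$-classes. Graphs. A graph $\Gamma$ is a vertex-set $V$ together with an edge-set $E\subseteq V\times V$; an edge $(v,w)$ meets $v$ and $w$ and meets every subset of $V$ containing $v$ or $w$. A vertex $v_\dag$ is a cutvertex of $\Gamma$ if $V\setminus\{v_\dag\}$ is the union of two disjoint nonempty subsets $V_1,V_2$ such that no edge meets both $V_1$ and $V_2$ (connectivity of $\Gamma$ is not assumed). $\mathbb{W}(X,R)$ is the graph whose edges are the $X$-turns of $R$ and whose vertices are the elements of $X^{0,\pm1}$ met by some $X$-turn of $R$.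 An $X$-cutvertex of $\mathbb{W}(X,R)$ is a cutvertex lying in $X^{\pm1}$ (i.e. different from $1$). Whitehead neighbours. An $F$-basis $X'$ is a Whitehead neighbour of $X$ if $X'\subseteq\{1,y^{-1}\}\cdot X\cdot\{1,y\}$ for some $y\in(X\cap X')^{\pm1}$. The subroutine, for a free group with basis $Y$ and a finite set $S$ of nontrivial elements and nontrivial classes of it such that $\mathcal{P}(Y;S)=\{Y\}$ and $\Gamma:=\mathbb{W}(Y,S)$ has a $Y$-cutvertex: choose $y_\dag\in Y^{\pm1}$ and disjoint subsets $Y_-,Y_+$ with union (vertex-set of $\Gamma$)$\,\setminus\{y_\dag\}$ such that $y_\dag^{-1}\in Y_-$, no $\Gamma$-edge meets both $Y_-$ and $Y_+$, and some $\Gamma$-edge meets both $Y_+$ and $y_\dag$. Let $\ell:=-1$ if $1\in Y_+$ and $\ell:=0$ otherwise, and let $\chi:Y^{0,\pm1}\to\{\ell,\ell+1\}$ take the value $0$ at $1$, $\ell$ on $Y_-\cup\{y_\dag\}$ and $\ell+1$ on $Y_+$. Output $Y':=\{y_\dag^{-\chi(x)}\,x\,y_\dag^{\chi(x^{-1})} : x\in Y\}$. Whitehead's cutvertex algorithm, with input $(X,R)$: ask whether there exists $Y\in\mathcal{P}(X;R)$ such that $\mathbb{W}(Y,R_{|Y,X})$ has a $Y$-cutvertex. If yes, apply the subroutine to such a $Y$ and $S=R_{|Y,X}$ to get $Y'$, and start anew with $X$ replaced by $(X\setminus Y)\cup Y'$. If no, output $X$ and stop. *)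

theory Defs
  imports "HOL-Algebra.Generated_Groups" "HOL-Library.Disjoint_Sets"
begin

section \<open>Free groups and free products\<close>

text \<open>Both are built as quotients of word monoids: \<open>presented A S\<close> is the monoid presented by the
  alphabet \<open>A\<close> and the relations \<open>l = r\<close> for \<open>(l, r) \<in> S\<close>.\<close>

definition rewrite_step :: "'l set \<Rightarrow> ('l list \<times> 'l list) set \<Rightarrow> ('l list \<times> 'l list) set" where
  "rewrite_step A S =
     {(p @ l @ q, p @ r @ q) | p l r q. p \<in> lists A \<and> q \<in> lists A \<and> (l, r) \<in> S}"

definition word_cong :: "'l set \<Rightarrow> ('l list \<times> 'l list) set \<Rightarrow> ('l list \<times> 'l list) set" where
  "word_cong A S = (rewrite_step A S \<union> (rewrite_step A S)\<inverse>)\<^sup>* \<inter> lists A \<times> lists A"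

definition presented :: "'l set \<Rightarrow> ('l list \<times> 'l list) set \<Rightarrow> 'l list set monoid" where
  "presented A S =
     \<lparr>carrier = lists A // word_cong A S,
      monoid.mult = (\<lambda>U V. \<Union>u\<in>U. \<Union>v\<in>V. word_cong A S `` {u @ v}),
      one = word_cong A S `` {[]}\<rparr>"

definition word_prod :: "('a, 'b) monoid_scheme \<Rightarrow> 'a list \<Rightarrow> 'a" where
  "word_prod G xs = foldr (monoid.mult G) xs \<one>\<^bsub>G\<^esub>"

definition induced_map :: "('a, 'b) monoid_scheme \<Rightarrow> ('l \<Rightarrow> 'a) \<Rightarrow> 'l list set \<Rightarrow> 'a" where
  "induced_map G \<phi> U = the_elem ((\<lambda>w. word_prod G (map \<phi> w)) ` U)"

text \<open>The letters \<open>(x, True)\<close> and \<open>(x, False)\<close> stand for \<open>x\<close> and its formal inverse.\<close>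

definition free_group :: "'a set \<Rightarrow> ('a \<times> bool) list set monoid" where
  "free_group X =
     presented (X \<times> UNIV) {([(x, b), (x, \<not> b)], []) | x b. x \<in> X}"

definition free_basis :: "('a, 'b) monoid_scheme \<Rightarrow> 'a set \<Rightarrow> bool" where
  "free_basis F X \<longleftrightarrow> X \<subseteq> carrier F \<and>
     induced_map F (\<lambda>(x, b). if b then x else inv\<^bsub>F\<^esub> x) \<in> iso (free_group X) F"

definition finite_rank_free_group :: "('a, 'b) monoid_scheme \<Rightarrow> bool" where
  "finite_rank_free_group F \<longleftrightarrow> group F \<and> (\<exists>X. finite X \<and> free_basis F X)"

definition free_product :: "'i set \<Rightarrow> ('i \<Rightarrow> ('a, 'b) monoid_scheme) \<Rightarrow> ('i \<times> 'a) list set monoid" where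
  "free_product I G =
     presented (SIGMA i:I. carrier (G i))
       ({([(i, \<one>\<^bsub>G i\<^esub>)], []) | i. i \<in> I} \<union>
        {([(i, a), (i, b)], [(i, a \<otimes>\<^bsub>G i\<^esub> b)]) | i a b.
           i \<in> I \<and> a \<in> carrier (G i) \<and> b \<in> carrier (G i)})"


section \<open>Elements and classes, factorizations\<close>

text \<open>An element \<open>g\<close> and the conjugacy class of \<open>g\<close> are different objects, even if the class is a
  singleton.\<close>

datatype 'a elt_or_class = Elt 'a | Cls "'a set"

definition conj_class :: "('a, 'b) monoid_scheme \<Rightarrow> 'a \<Rightarrow> 'a set" where
  "conj_class F g = {f \<otimes>\<^bsub>F\<^esub> g \<otimes>\<^bsub>F\<^esub> inv\<^bsub>F\<^esub> f | f. f \<in> carrier F}"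

definition elts_and_classes :: "('a, 'b) monoid_scheme \<Rightarrow> 'a set \<Rightarrow> 'a elt_or_class set" where
  "elts_and_classes F H = Elt ` H \<union> (\<lambda>h. Cls (conj_class F h)) ` H"

text \<open>A multiset of subgroups is represented by a family \<open>(H i)\<^sub>i\<^sub>\<in>\<^sub>I\<close>, so that repetitions and
  infinitely many factors are allowed a priori; its size is the cardinality of \<open>I\<close>.\<close>

definition factorization :: "('a, 'b) monoid_scheme \<Rightarrow> 'i set \<Rightarrow> ('i \<Rightarrow> 'a set) \<Rightarrow> bool" where
  "factorization F I H \<longleftrightarrow> (\<forall>i\<in>I. subgroup (H i) F) \<and>
     induced_map F snd \<in> iso (free_product I (\<lambda>i. F\<lparr>carrier := H i\<rparr>)) F"

definition allocating ::
    "('a, 'b) monoid_scheme \<Rightarrow> 'a elt_or_class set \<Rightarrow> 'i set \<Rightarrow> ('i \<Rightarrow> 'a set) \<Rightarrow> bool" where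
  "allocating F R I H \<longleftrightarrow> factorization F I H \<and> (\<forall>i\<in>I. H i \<noteq> {\<one>\<^bsub>F\<^esub>}) \<and>
     R \<subseteq> (\<Union>i\<in>I. elts_and_classes F (H i))"

text \<open>In a refinement, \<open>p j\<close> is the index of the factor of which \<open>K j\<close> is a part.\<close>

definition refinement ::
    "('a, 'b) monoid_scheme \<Rightarrow> 'i set \<Rightarrow> ('i \<Rightarrow> 'a set) \<Rightarrow> 'j set \<Rightarrow> ('j \<Rightarrow> 'i) \<Rightarrow> ('j \<Rightarrow> 'a set) \<Rightarrow> bool"
  where
  "refinement F I H J p K \<longleftrightarrow> p ` J \<subseteq> I \<and> (\<forall>j\<in>J. K j \<noteq> {\<one>\<^bsub>F\<^esub>}) \<and>
     (\<forall>i\<in>I. factorization (F\<lparr>carrier := H i\<rparr>) {j \<in> J. p j = i} K)"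

definition proper_refinement ::
    "('a, 'b) monoid_scheme \<Rightarrow> 'i set \<Rightarrow> ('i \<Rightarrow> 'a set) \<Rightarrow> 'j set \<Rightarrow> ('j \<Rightarrow> 'i) \<Rightarrow> ('j \<Rightarrow> 'a set) \<Rightarrow> bool"
  where
  "proper_refinement F I H J p K \<longleftrightarrow> refinement F I H J p K \<and>
     \<not> (bij_betw p J I \<and> (\<forall>j\<in>J. K j = H (p j)))"

text \<open>The type argument provides the index type of the refinements.\<close>

definition atomic ::
    "'j itself \<Rightarrow> ('a, 'b) monoid_scheme \<Rightarrow> 'a elt_or_class set \<Rightarrow> 'i set \<Rightarrow> ('i \<Rightarrow> 'a set) \<Rightarrow> bool"
  where
  "atomic _ F R I H \<longleftrightarrow>
     \<not> (\<exists>(J :: 'j set) p K. proper_refinement F I H J p K \<and> allocating F R J K)"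


section \<open>Words, turns, supports\<close>

definition pm :: "('a, 'b) monoid_scheme \<Rightarrow> 'a set \<Rightarrow> 'a set" where
  "pm F X = X \<union> m_inv F ` X"

definition pm0 :: "('a, 'b) monoid_scheme \<Rightarrow> 'a set \<Rightarrow> 'a set" where
  "pm0 F X = insert \<one>\<^bsub>F\<^esub> (pm F X)"

text \<open>\<open>extended F r [x\<^sub>1, \<dots>, x\<^sub>n]\<close> is \<open>[x\<^sub>0, x\<^sub>1, \<dots>, x\<^sub>n, x\<^sub>n\<^sub>+\<^sub>1]\<close>; it is only used for \<open>n \<ge> 1\<close>.\<close>

fun extended :: "('a, 'b) monoid_scheme \<Rightarrow> 'a elt_or_class \<Rightarrow> 'a list \<Rightarrow> 'a list" where
  "extended F (Elt g) xs = \<one>\<^bsub>F\<^esub> # xs @ [\<one>\<^bsub>F\<^esub>]"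
| "extended F (Cls C) xs = last xs # xs @ [hd xs]"

fun represents :: "('a, 'b) monoid_scheme \<Rightarrow> 'a list \<Rightarrow> 'a elt_or_class \<Rightarrow> bool" where
  "represents F xs (Elt g) \<longleftrightarrow> g = word_prod F xs"
| "represents F xs (Cls C) \<longleftrightarrow> word_prod F xs \<in> C"

definition normal_word ::
    "('a, 'b) monoid_scheme \<Rightarrow> 'a set \<Rightarrow> 'a elt_or_class \<Rightarrow> 'a list \<Rightarrow> bool" where
  "normal_word F X r xs \<longleftrightarrow> xs \<noteq> [] \<and> set xs \<subseteq> pm F X \<and> represents F xs r \<and>
     (\<forall>i\<le>length xs. inv\<^bsub>F\<^esub> (extended F r xs ! i) \<noteq> extended F r xs ! Suc i)"

text \<open>The normal word of \<open>r\<close> is unique for an element and unique up to cyclic permutation for a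
  class, so the following unions do not depend on a choice of word.\<close>

definition turns :: "('a, 'b) monoid_scheme \<Rightarrow> 'a set \<Rightarrow> 'a elt_or_class \<Rightarrow> ('a \<times> 'a) set" where
  "turns F X r = {(inv\<^bsub>F\<^esub> (extended F r xs ! i), extended F r xs ! Suc i) | xs i.
     normal_word F X r xs \<and> i \<le> length xs}"

definition support :: "('a, 'b) monoid_scheme \<Rightarrow> 'a set \<Rightarrow> 'a elt_or_class \<Rightarrow> 'a set" where
  "support F X r = (\<Union>xs\<in>{xs. normal_word F X r xs}. pm F (set xs) \<inter> X)"

definition includes_supports ::
    "('a, 'b) monoid_scheme \<Rightarrow> 'a set \<Rightarrow> 'a elt_or_class set \<Rightarrow> 'a set set \<Rightarrow> bool" where
  "includes_supports F X R P \<longleftrightarrow> (\<forall>r\<in>R. \<exists>Y\<in>P. support F X r \<subseteq> Y)"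

definition support_partition ::
    "('a, 'b) monoid_scheme \<Rightarrow> 'a set \<Rightarrow> 'a elt_or_class set \<Rightarrow> 'a set set" where
  "support_partition F X R =
     (THE P. partition_on X P \<and> includes_supports F X R P \<and>
        (\<forall>Q. partition_on X Q \<and> includes_supports F X R Q \<longrightarrow> refines X P Q))"

text \<open>For an \<open>F\<close>-class \<open>C\<close> whose support lies in the part \<open>Y\<close> of a basis, \<open>C \<inter> \<langle>Y\<rangle>\<close> is the
  corresponding \<open>\<langle>Y\<rangle>\<close>-class.\<close>

fun restrict_to :: "('a, 'b) monoid_scheme \<Rightarrow> 'a set \<Rightarrow> 'a elt_or_class \<Rightarrow> 'a elt_or_class" where
  "restrict_to F Y (Elt g) = Elt g"
| "restrict_to F Y (Cls C) = Cls (C \<inter> generate F Y)"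

definition restricted ::
    "('a, 'b) monoid_scheme \<Rightarrow> 'a elt_or_class set \<Rightarrow> 'a set \<Rightarrow> 'a set \<Rightarrow> 'a elt_or_class set" where
  "restricted F R Y X = restrict_to F Y ` {r \<in> R. support F X r \<subseteq> Y}"


section \<open>Whitehead graphs and the cutvertex algorithm\<close>

text \<open>A graph is a pair of a vertex-set and an edge-set.\<close>

type_synonym 'v graph = "'v set \<times> ('v \<times> 'v) set"

definition meets :: "'v \<times> 'v \<Rightarrow> 'v set \<Rightarrow> bool" where
  "meets e S \<longleftrightarrow> fst e \<in> S \<or> snd e \<in> S"

definition separated :: "'v graph \<Rightarrow> 'v \<Rightarrow> 'v set \<Rightarrow> 'v set \<Rightarrow> bool" where
  "separated \<Gamma> v V\<^sub>1 V\<^sub>2 \<longleftrightarrow> V\<^sub>1 \<inter> V\<^sub>2 = {} \<and> V\<^sub>1 \<union> V\<^sub>2 = fst \<Gamma> - {v} \<and>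
     \<not> (\<exists>e\<in>snd \<Gamma>. meets e V\<^sub>1 \<and> meets e V\<^sub>2)"

definition cutvertex :: "'v graph \<Rightarrow> 'v \<Rightarrow> bool" where
  "cutvertex \<Gamma> v \<longleftrightarrow> v \<in> fst \<Gamma> \<and> (\<exists>V\<^sub>1 V\<^sub>2. V\<^sub>1 \<noteq> {} \<and> V\<^sub>2 \<noteq> {} \<and> separated \<Gamma> v V\<^sub>1 V\<^sub>2)"

definition whitehead_graph ::
    "('a, 'b) monoid_scheme \<Rightarrow> 'a set \<Rightarrow> 'a elt_or_class set \<Rightarrow> 'a graph" where
  "whitehead_graph F X R =
     (let E = \<Union>r\<in>R. turns F X r in ({v \<in> pm0 F X. \<exists>e\<in>E. meets e {v}}, E))"

definition has_basis_cutvertex ::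
    "('a, 'b) monoid_scheme \<Rightarrow> 'a set \<Rightarrow> 'a elt_or_class set \<Rightarrow> bool" where
  "has_basis_cutvertex F X R \<longleftrightarrow> (\<exists>v\<in>pm F X. cutvertex (whitehead_graph F X R) v)"

text \<open>\<open>subroutine F Y S Y'\<close> means that \<open>Y'\<close> is a possible output for the group \<open>\<langle>Y\<rangle>\<close> with the basis
  \<open>Y\<close> and the set \<open>S\<close>; the operations of \<open>\<langle>Y\<rangle>\<close> are those of \<open>F\<close>.\<close>

definition subroutine ::
    "('a, 'b) monoid_scheme \<Rightarrow> 'a set \<Rightarrow> 'a elt_or_class set \<Rightarrow> 'a set \<Rightarrow> bool" where
  "subroutine F Y S Y' \<longleftrightarrow>
     (\<exists>y\<in>pm F Y. \<exists>Y\<^sub>m Y\<^sub>p. \<exists>(l::int) (\<chi>::'a \<Rightarrow> int).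
        separated (whitehead_graph F Y S) y Y\<^sub>m Y\<^sub>p \<and>
        inv\<^bsub>F\<^esub> y \<in> Y\<^sub>m \<and>
        (\<exists>e\<in>snd (whitehead_graph F Y S). meets e Y\<^sub>p \<and> meets e {y}) \<and>
        l = (if \<one>\<^bsub>F\<^esub> \<in> Y\<^sub>p then -1 else 0) \<and>
        (\<forall>x\<in>pm0 F Y. \<chi> x \<in> {l, l + 1}) \<and>
        \<chi> \<one>\<^bsub>F\<^esub> = 0 \<and>
        (\<forall>x\<in>Y\<^sub>m \<union> {y}. \<chi> x = l) \<and>
        (\<forall>x\<in>Y\<^sub>p. \<chi> x = l + 1) \<and>
        Y' = {(y [^]\<^bsub>F\<^esub> (- \<chi> x)) \<otimes>\<^bsub>F\<^esub> x \<otimes>\<^bsub>F\<^esub> (y [^]\<^bsub>F\<^esub> \<chi> (inv\<^bsub>F\<^esub> x)) | x. x \<in> Y})"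

definition reducible_parts ::
    "('a, 'b) monoid_scheme \<Rightarrow> 'a elt_or_class set \<Rightarrow> 'a set \<Rightarrow> 'a set set" where
  "reducible_parts F R X =
     {Y \<in> support_partition F X R. has_basis_cutvertex F Y (restricted F R Y X)}"

definition algorithm_step ::
    "('a, 'b) monoid_scheme \<Rightarrow> 'a elt_or_class set \<Rightarrow> 'a set \<Rightarrow> 'a set \<Rightarrow> bool" where
  "algorithm_step F R X X' \<longleftrightarrow>
     (\<exists>Y\<in>reducible_parts F R X. \<exists>Y'.
        subroutine F Y (restricted F R Y X) Y' \<and> X' = (X - Y) \<union> Y')"

text \<open>\<open>X\<^sub>1\<close> is a basis that some run of the algorithm with input \<open>(X, R)\<close> arrives at.\<close>

definition algorithm_reaches ::
    "('a, 'b) monoid_scheme \<Rightarrow> 'a elt_or_class set \<Rightarrow> 'a set \<Rightarrow> 'a set \<Rightarrow> bool" where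
  "algorithm_reaches F R X X\<^sub>1 \<longleftrightarrow> (algorithm_step F R)\<^sup>*\<^sup>* X X\<^sub>1"

definition algorithm_outputs ::
    "('a, 'b) monoid_scheme \<Rightarrow> 'a elt_or_class set \<Rightarrow> 'a set \<Rightarrow> 'a set \<Rightarrow> bool" where
  "algorithm_outputs F R X X\<^sub>1 \<longleftrightarrow> algorithm_reaches F R X X\<^sub>1 \<and> reducible_parts F R X\<^sub>1 = {}"

text \<open>Every run stops: no run is infinite, and a run never gets stuck because the subroutine has no
  admissible choice for a part that was selected.\<close>

definition algorithm_stops ::
    "('a, 'b) monoid_scheme \<Rightarrow> 'a elt_or_class set \<Rightarrow> 'a set \<Rightarrow> bool" where
  "algorithm_stops F R X \<longleftrightarrow>
     \<not> (\<exists>B :: nat \<Rightarrow> 'a set. B 0 = X \<and> (\<forall>n. algorithm_step F R (B n) (B (Suc n)))) \<and>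
     (\<forall>X\<^sub>1 Y. algorithm_reaches F R X X\<^sub>1 \<and> Y \<in> reducible_parts F R X\<^sub>1 \<longrightarrow>
        (\<exists>Y'. subroutine F Y (restricted F R Y X\<^sub>1) Y'))"

end

theory Submission
  imports Defs
begin

text \<open>Termination: if the subroutine moves letters past \<open>y\<^sub>\<dagger>\<close>, every turn between \<open>y\<^sub>\<dagger>\<close> and \<open>Y\<^sub>+\<close> lets a
  letter \<open>y\<^sub>\<dagger>\<^sup>\<plusminus>\<^sup>1\<close> cancel and no turn adds a letter, so the total length of \<open>R\<close> decreases.

  Maximality, by Stallings folds: given an \<open>R\<close>-allocating factorization \<open>(H i)\<close>, let \<open>\<Gamma>\<close> be the wedge
  of finite connected subgraphs of the coset graphs \<open>H i \ F\<close>, large enough that the normal words of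
  all \<open>r \<in> R\<close> lift to \<open>\<Gamma>\<close> and that \<open>\<Gamma>\<close> carries \<open>F\<close>. Counting homomorphisms to the group of order two
  shows that \<open>\<Gamma>\<close> has the Euler characteristic of the rose with petals \<open>X\<close>, to which it folds. Hence
  each fold identifies just one pair of edges, so undoing a fold splits a vertex into two vertices
  with at most one direction in common. If the Whitehead graph of a part \<open>Y\<close> has no \<open>Y\<close>-cutvertex, then
  the turns of \<open>Y\<close>, all located at one vertex of the rose, stay at one vertex all the way back to \<open>\<Gamma>\<close>.
  So the letters of \<open>Y\<close> label loops in the coset graph of a single factor, and are conjugate into it.
  Thus distinct factors that meet \<open>R\<close> use distinct parts; the number of the other factors is at most
  the number of letters outside the supports, again by homomorphisms to the group of order two.\<close>

text \<open>The Euler characteristic enters as two opposite inequalities between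
  \<open>card A\<close> and \<open>2 * card V\<close>, where \<open>A\<close> holds each edge in
  both orientations. Any connected graph that carries \<open>F\<close> has at least the rank of
  \<open>F\<close>, because a fold costs one vertex and at least one edge. For the wedge the reverse
  bound is a count: a set of edges is encoded by one bit per letter of \<open>X\<close> and one bit
  per vertex other than the base point, because parities add along paths and a free product lets
  homomorphisms be prescribed factor by factor. The group theory rests on extending maps from bases
  and from factors, with permutations, integers, bits or \<open>F\<close> itself as targets. A turn
  has to be recorded together with the vertex at which it is taken, since the same turn may occur at
  several vertices of the wedge, while the rose has only one. Atomicity follows from maximality: a
  proper allocating refinement of a factorization of maximum size would have more factors.\<close>

text \<open>The default rules unfold membership in \<open>lists\<close> to a bounded quantifier, on which the premises of
  the simplification rules below cannot be discharged.\<close>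

declare in_listsD [rule del] in_listsI [rule del]

lemma in_lists_iff_subset [simp]: "w \<in> lists A \<longleftrightarrow> set w \<subseteq> A"
  by (auto simp: in_lists_conv_set)

section \<open>Monoids given by generators and relations\<close>

lemma rewrite_step_append:
  assumes "(u, v) \<in> rewrite_step A S" "p \<in> lists A" "q \<in> lists A"
  shows "(p @ u @ q, p @ v @ q) \<in> rewrite_step A S"
proof -
  obtain p' l r q' where "u = p' @ l @ q'" "v = p' @ r @ q'" "p' \<in> lists A" "q' \<in> lists A" "(l, r) \<in> S"
    using assms(1) by (auto simp: rewrite_step_def)
  moreover have "p @ u @ q = (p @ p') @ l @ (q' @ q)" "p @ v @ q = (p @ p') @ r @ (q' @ q)"
    using calculation by auto
  moreover have "p @ p' \<in> lists A" "q' @ q \<in> lists A"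
    using calculation assms(2,3) by auto
  ultimately show ?thesis
    unfolding rewrite_step_def mem_Collect_eq by blast
qed

lemma word_cong_append:
  assumes "(u, v) \<in> word_cong A S" "p \<in> lists A" "q \<in> lists A"
  shows "(p @ u @ q, p @ v @ q) \<in> word_cong A S"
proof -
  have "(u, v) \<in> (rewrite_step A S \<union> (rewrite_step A S)\<inverse>)\<^sup>*" using assms(1) by (simp add: word_cong_def)
  then have "(p @ u @ q, p @ v @ q) \<in> (rewrite_step A S \<union> (rewrite_step A S)\<inverse>)\<^sup>*"
  proof (induction rule: rtrancl_induct)
    case (step y z)
    then have "(p @ y @ q, p @ z @ q) \<in> rewrite_step A S \<union> (rewrite_step A S)\<inverse>"
      using rewrite_step_append[OF _ assms(2,3)] by auto
    with step show ?case by (meson rtrancl.rtrancl_into_rtrancl)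
  qed simp
  with assms show ?thesis by (auto simp: word_cong_def)
qed

lemma word_cong_refl: "u \<in> lists A \<Longrightarrow> (u, u) \<in> word_cong A S"
  by (simp add: word_cong_def)

lemma word_cong_sym: "(u, v) \<in> word_cong A S \<Longrightarrow> (v, u) \<in> word_cong A S"
proof -
  have "sym ((rewrite_step A S \<union> (rewrite_step A S)\<inverse>)\<^sup>*)"
    by (intro sym_rtrancl) (auto simp: sym_def)
  then show "(u, v) \<in> word_cong A S \<Longrightarrow> (v, u) \<in> word_cong A S"
    by (auto simp: word_cong_def sym_def)
qed

lemma word_cong_trans: "(u, v) \<in> word_cong A S \<Longrightarrow> (v, w) \<in> word_cong A S \<Longrightarrow> (u, w) \<in> word_cong A S"
  by (auto simp: word_cong_def)

lemma word_cong_lists: "(u, v) \<in> word_cong A S \<Longrightarrow> u \<in> lists A \<and> v \<in> lists A"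
  by (simp add: word_cong_def)

lemma word_cong_cong:
  assumes "(u, u') \<in> word_cong A S" "(v, v') \<in> word_cong A S"
  shows "(u @ v, u' @ v') \<in> word_cong A S"
proof -
  have "(u @ v, u' @ v) \<in> word_cong A S"
    using word_cong_append[OF assms(1), of "[]" v] word_cong_lists[OF assms(2)] by auto
  moreover have "(u' @ v, u' @ v') \<in> word_cong A S"
    using word_cong_append[OF assms(2), of u' "[]"] word_cong_lists[OF assms(1)] by auto
  ultimately show ?thesis by (rule word_cong_trans)
qed

lemma word_cong_rel:
  assumes "(l, r) \<in> S" "l \<in> lists A" "r \<in> lists A"
  shows "(l, r) \<in> word_cong A S"
proof -
  have "(l, r) \<in> rewrite_step A S"
    unfolding rewrite_step_def using assms by (intro CollectI exI[of _ "[]"] exI[of _ l] exI[of _ r]) auto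
  with assms show ?thesis by (auto simp: word_cong_def)
qed

lemma equiv_word_cong: "equiv (lists A) (word_cong A S)"
  by (intro equivI refl_onI symI transI)
    (auto intro: word_cong_refl word_cong_sym word_cong_trans dest: word_cong_lists)

text \<open>Transports congruences along a change of alphabet: to the letters of an image basis, and
  from signed letters to letters of a free product. A relation only has to become a congruence,
  because a free cancellation takes two steps in a free product.\<close>

lemma word_cong_map:
  assumes f: "\<And>a. a \<in> A \<Longrightarrow> f a \<in> B"
    and rel: "\<And>l r. (l, r) \<in> S \<Longrightarrow> (map f l, map f r) \<in> word_cong B T"
    and "(u, v) \<in> word_cong A S"
  shows "(map f u, map f v) \<in> word_cong B T"
proof -
  have mf: "map f w \<in> lists B" if "w \<in> lists A" for w using that f by (auto simp: in_lists_conv_set)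
  have one_step: "(map f u, map f v) \<in> word_cong B T" if "(u, v) \<in> rewrite_step A S" for u v
  proof -
    obtain p' l r q' where "u = p' @ l @ q'" "v = p' @ r @ q'" "p' \<in> lists A" "q' \<in> lists A" "(l, r) \<in> S"
      using \<open>(u, v) \<in> rewrite_step A S\<close> by (auto simp: rewrite_step_def)
    then show ?thesis using word_cong_append[OF rel[OF \<open>(l, r) \<in> S\<close>] mf[OF \<open>p' \<in> lists A\<close>] mf[OF \<open>q' \<in> lists A\<close>]]
      by simp
  qed
  have "(u, v) \<in> (rewrite_step A S \<union> (rewrite_step A S)\<inverse>)\<^sup>*" "u \<in> lists A"
    using assms(3) by (auto simp: word_cong_def)
  then show ?thesis
  proof (induction rule: rtrancl_induct)
    case base then show ?case by (intro word_cong_refl mf)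
  next
    case (step y z)
    then have "(map f u, map f y) \<in> word_cong B T" by blast
    moreover have "(map f y, map f z) \<in> word_cong B T"
      using step(2) one_step[of y z] word_cong_sym[OF one_step[of z y]] by auto
    ultimately show ?case by (rule word_cong_trans)
  qed
qed

lemma word_prod_Nil [simp]: "word_prod G [] = \<one>\<^bsub>G\<^esub>"
  by (simp add: word_prod_def)

lemma word_prod_Cons [simp]: "word_prod G (x # xs) = x \<otimes>\<^bsub>G\<^esub> word_prod G xs"
  by (simp add: word_prod_def)

lemma (in monoid) word_prod_closed [simp]:
  "set xs \<subseteq> carrier G \<Longrightarrow> word_prod G xs \<in> carrier G"
  by (induction xs) auto

lemma (in monoid) word_prod_append:
  "set xs \<subseteq> carrier G \<Longrightarrow> set ys \<subseteq> carrier G \<Longrightarrow> word_prod G (xs @ ys) = word_prod G xs \<otimes> word_prod G ys"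
  by (induction xs) (auto simp: m_assoc)

lemma word_prod_consistent: "word_prod (G\<lparr>carrier := H\<rparr>) xs = word_prod G xs"
  by (simp add: word_prod_def)

text \<open>Free groups and free products are treated at once: \<open>\<phi>\<close> evaluates
  letters in \<open>G\<close>, and respecting the relations makes \<open>ev\<close> constant on
  congruence classes, so that \<open>the_elem\<close> in \<open>induced_map\<close> is
  legitimate.\<close>

locale presentation = monoid G for G (structure) +
  fixes A :: "'l set" and S :: "('l list \<times> 'l list) set" and \<phi> :: "'l \<Rightarrow> 'a"
  assumes phi: "\<And>a. a \<in> A \<Longrightarrow> \<phi> a \<in> carrier G"
    and rel_lists: "\<And>l r. (l, r) \<in> S \<Longrightarrow> l \<in> lists A \<and> r \<in> lists A"
    and rel: "\<And>l r. (l, r) \<in> S \<Longrightarrow> word_prod G (map \<phi> l) = word_prod G (map \<phi> r)"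
begin

definition ev :: "'l list \<Rightarrow> 'a" where "ev w = word_prod G (map \<phi> w)"

lemma ev_closed [simp]: "w \<in> lists A \<Longrightarrow> ev w \<in> carrier G"
  unfolding ev_def using phi by (intro word_prod_closed) (auto simp: in_lists_conv_set)

lemma ev_append: "u \<in> lists A \<Longrightarrow> v \<in> lists A \<Longrightarrow> ev (u @ v) = ev u \<otimes> ev v"
  unfolding ev_def using phi by (simp, intro word_prod_append) (auto simp: in_lists_conv_set)

lemma ev_cong: assumes "(u, v) \<in> word_cong A S" shows "ev u = ev v"
proof -
  have step: "ev u = ev v" if "(u, v) \<in> rewrite_step A S" for u v
  proof -
    obtain p' l r q' where "u = p' @ l @ q'" "v = p' @ r @ q'" "p' \<in> lists A" "q' \<in> lists A" "(l, r) \<in> S"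
      using \<open>(u, v) \<in> rewrite_step A S\<close> by (auto simp: rewrite_step_def)
    moreover have "ev l = ev r" using rel[OF \<open>(l, r) \<in> S\<close>] by (simp add: ev_def)
    ultimately show ?thesis using rel_lists[OF \<open>(l, r) \<in> S\<close>] by (simp add: ev_append)
  qed
  have "(u, v) \<in> (rewrite_step A S \<union> (rewrite_step A S)\<inverse>)\<^sup>*"
    using assms by (auto simp: word_cong_def)
  then show ?thesis
    by (induction rule: rtrancl_induct) (auto dest: step)
qed

lemma induced_map_class:
  assumes "w \<in> lists A"
  shows "induced_map G \<phi> (word_cong A S `` {w}) = ev w"
proof -
  have "(\<lambda>w. word_prod G (map \<phi> w)) ` (word_cong A S `` {w}) = {ev w}"
    using ev_cong word_cong_refl[OF assms] by (fastforce simp: ev_def[symmetric])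
  then show ?thesis by (simp add: induced_map_def)
qed

lemma mult_class:
  assumes "u \<in> lists A" "v \<in> lists A"
  shows "word_cong A S `` {u} \<otimes>\<^bsub>presented A S\<^esub> word_cong A S `` {v} = word_cong A S `` {u @ v}"
proof -
  let ?U = "word_cong A S `` {u}" and ?V = "word_cong A S `` {v}" and ?W = "word_cong A S `` {u @ v}"
  have *: "word_cong A S `` {u' @ v'} = ?W" if "u' \<in> ?U" "v' \<in> ?V" for u' v'
  proof -
    have "(u @ v, u' @ v') \<in> word_cong A S" using that by (intro word_cong_cong) auto
    then show ?thesis using equiv_class_eq[OF equiv_word_cong] by metis
  qed
  have "u \<in> ?U" "v \<in> ?V" using word_cong_refl[OF assms(1)] word_cong_refl[OF assms(2)] by auto
  then have "(\<Union>u'\<in>?U. \<Union>v'\<in>?V. word_cong A S `` {u' @ v'}) = ?W"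
    using * by (intro equalityI UN_least) (blast, blast)
  then show ?thesis by (simp add: presented_def)
qed

lemma carrier_presented: "carrier (presented A S) = lists A // word_cong A S"
  by (simp add: presented_def)

text \<open>Removes the quotient: surjectivity means that each element has a word, injectivity that
  words of equal value are congruent. Bases and factorizations are handled through this
  form.\<close>

lemma induced_map_iso_iff:
  "induced_map G \<phi> \<in> iso (presented A S) G \<longleftrightarrow>
     (\<forall>g\<in>carrier G. \<exists>w\<in>lists A. ev w = g) \<and>
     (\<forall>u\<in>lists A. \<forall>v\<in>lists A. ev u = ev v \<longrightarrow> (u, v) \<in> word_cong A S)" (is "?L \<longleftrightarrow> ?S \<and> ?I")
proof -
  let ?c = "\<lambda>w. word_cong A S `` {w}"
  have im: "induced_map G \<phi> ` carrier (presented A S) = ev ` lists A"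
  proof -
    have "lists A // word_cong A S = ?c ` lists A" by (auto simp: quotient_def)
    then show ?thesis
      unfolding carrier_presented by (simp add: image_image induced_map_class cong: image_cong_simp)
  qed
  have hom: "induced_map G \<phi> \<in> hom (presented A S) G"
  proof (rule homI)
    fix U assume "U \<in> carrier (presented A S)"
    then have "induced_map G \<phi> U \<in> ev ` lists A" using im by blast
    then show "induced_map G \<phi> U \<in> carrier G" by (elim imageE) simp
  next
    fix U V assume "U \<in> carrier (presented A S)" "V \<in> carrier (presented A S)"
    then obtain u v where "u \<in> lists A" "U = ?c u" "v \<in> lists A" "V = ?c v"
      unfolding carrier_presented by (meson quotientE)
    then show "induced_map G \<phi> (U \<otimes>\<^bsub>presented A S\<^esub> V) = induced_map G \<phi> U \<otimes> induced_map G \<phi> V"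
      by (simp add: mult_class induced_map_class ev_append)
  qed
  have inj: "inj_on (induced_map G \<phi>) (carrier (presented A S)) \<longleftrightarrow> ?I"
  proof
    assume inj: "inj_on (induced_map G \<phi>) (carrier (presented A S))"
    show ?I
    proof (intro ballI impI)
      fix u v assume uv: "u \<in> lists A" "v \<in> lists A" "ev u = ev v"
      have "?c u \<in> carrier (presented A S)" "?c v \<in> carrier (presented A S)"
        unfolding carrier_presented by (rule quotientI[OF uv(1)], rule quotientI[OF uv(2)])
      moreover have "induced_map G \<phi> (?c u) = induced_map G \<phi> (?c v)"
        using uv by (simp add: induced_map_class)
      ultimately have "?c u = ?c v" using inj by (simp add: inj_on_eq_iff)
      then show "(u, v) \<in> word_cong A S"
        using uv eq_equiv_class_iff[OF equiv_word_cong] by metis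
    qed
  next
    assume I: ?I
    show "inj_on (induced_map G \<phi>) (carrier (presented A S))"
    proof (rule inj_onI)
      fix U V assume UV: "U \<in> carrier (presented A S)" "V \<in> carrier (presented A S)"
        and e: "induced_map G \<phi> U = induced_map G \<phi> V"
      obtain u v where uv: "u \<in> lists A" "U = ?c u" "v \<in> lists A" "V = ?c v"
        using UV unfolding carrier_presented by (meson quotientE)
      then have "ev u = ev v" using e by (simp add: induced_map_class)
      then have "(u, v) \<in> word_cong A S" using I uv by blast
      then show "U = V" using uv equiv_class_eq[OF equiv_word_cong] by metis
    qed
  qed
  have "ev ` lists A = carrier G \<longleftrightarrow> ?S"
  proof
    assume "ev ` lists A = carrier G"
    then show ?S by (metis imageE)
  next
    assume ?S
    then have "carrier G \<subseteq> ev ` lists A" by (metis image_eqI subsetI)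
    moreover have "ev ` lists A \<subseteq> carrier G" by (intro image_subsetI) simp
    ultimately show "ev ` lists A = carrier G" by simp
  qed
  then show ?thesis
    unfolding iso_iff im inj using hom by blast
qed

text \<open>Evaluate in \<open>M\<close> an arbitrarily chosen word for \<open>g\<close>. Two
  choices are congruent by injectivity, and \<open>M\<close> satisfies the same relations, so the
  value does not depend on the choice.\<close>

lemma universal:
  assumes iso: "induced_map G \<phi> \<in> iso (presented A S) G" and M: "presentation M A S \<psi>"
  obtains \<Phi> where "\<Phi> \<in> hom G M" "\<And>a. a \<in> A \<Longrightarrow> \<Phi> (\<phi> a) = \<psi> a" "\<Phi> \<one> = \<one>\<^bsub>M\<^esub>"
proof -
  interpret M: presentation M A S \<psi> by (rule M)
  define \<Phi> where "\<Phi> = (\<lambda>g. M.ev (SOME w. w \<in> lists A \<and> ev w = g))"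
  have ev: "\<Phi> (ev w) = M.ev w" if "w \<in> lists A" for w
  proof -
    let ?w = "SOME w'. w' \<in> lists A \<and> ev w' = ev w"
    have "?w \<in> lists A \<and> ev ?w = ev w" by (rule someI[of _ w]) (use that in auto)
    then have "(?w, w) \<in> word_cong A S" using iso that unfolding induced_map_iso_iff by blast
    then show ?thesis unfolding \<Phi>_def by (rule M.ev_cong)
  qed
  have surj: "\<exists>w\<in>lists A. ev w = g" if "g \<in> carrier G" for g
    using iso that unfolding induced_map_iso_iff by blast
  show ?thesis
  proof
    show "\<Phi> \<in> hom G M"
    proof (rule homI)
      fix g assume "g \<in> carrier G"
      then show "\<Phi> g \<in> carrier M" using surj ev by force
    next
      fix g h assume gh: "g \<in> carrier G" "h \<in> carrier G"
      obtain u where u: "u \<in> lists A" "ev u = g" using surj[OF gh(1)] by blast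
      obtain v where v: "v \<in> lists A" "ev v = h" using surj[OF gh(2)] by blast
      have "\<Phi> (ev (u @ v)) = \<Phi> (ev u) \<otimes>\<^bsub>M\<^esub> \<Phi> (ev v)"
        using ev u(1) v(1) by (simp add: M.ev_append)
      then show "\<Phi> (g \<otimes> h) = \<Phi> g \<otimes>\<^bsub>M\<^esub> \<Phi> h"
        using u v by (simp add: ev_append)
    qed
    show "\<Phi> \<one> = \<one>\<^bsub>M\<^esub>" using ev[of "[]"] by (simp add: ev_def M.ev_def)
    show "\<Phi> (\<phi> a) = \<psi> a" if "a \<in> A" for a
      using ev[of "[a]"] that phi M.phi by (simp add: ev_def M.ev_def)
  qed
qed

end

section \<open>Universal properties of bases and of factorizations\<close>

definition signed_letter :: "('a, 'b) monoid_scheme \<Rightarrow> 'a \<times> bool \<Rightarrow> 'a" where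
  "signed_letter F = (\<lambda>(x, b). if b then x else inv\<^bsub>F\<^esub> x)"

abbreviation free_rels :: "'x set \<Rightarrow> (('x \<times> bool) list \<times> ('x \<times> bool) list) set" where
  "free_rels X \<equiv> {([(x, b), (x, \<not> b)], []) | x b. x \<in> X}"

lemma free_presentation:
  assumes "group F" "X \<subseteq> carrier F"
  shows "presentation F (X \<times> UNIV) (free_rels X) (signed_letter F)"
proof -
  interpret group F by fact
  show ?thesis using assms(2) by unfold_locales (auto simp: signed_letter_def subset_iff)
qed

lemma free_basis_iff:
  assumes "group F"
  shows "free_basis F X \<longleftrightarrow> X \<subseteq> carrier F \<and>
    (\<forall>g\<in>carrier F. \<exists>w\<in>lists (X \<times> UNIV). word_prod F (map (signed_letter F) w) = g) \<and>
    (\<forall>u\<in>lists (X \<times> UNIV). \<forall>v\<in>lists (X \<times> UNIV).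
       word_prod F (map (signed_letter F) u) = word_prod F (map (signed_letter F) v) \<longrightarrow>
       (u, v) \<in> word_cong (X \<times> UNIV) (free_rels X))"
proof (cases "X \<subseteq> carrier F")
  case True
  interpret presentation F "X \<times> UNIV" "free_rels X" "signed_letter F"
    using free_presentation[OF assms True] .
  show ?thesis
    unfolding free_basis_def free_group_def signed_letter_def[symmetric] induced_map_iso_iff ev_def by blast
qed (simp add: free_basis_def)

lemma free_basis_universal:
  assumes "group F" "free_basis F X" "group M" "\<And>x. x \<in> X \<Longrightarrow> \<psi> x \<in> carrier M"
  obtains \<Phi> where "\<Phi> \<in> hom F M" "\<And>x. x \<in> X \<Longrightarrow> \<Phi> x = \<psi> x"
proof -
  have X: "X \<subseteq> carrier F" using assms by (simp add: free_basis_def)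
  interpret presentation F "X \<times> UNIV" "free_rels X" "signed_letter F"
    using free_presentation[OF assms(1) X] .
  interpret M: group M by fact
  have M: "presentation M (X \<times> UNIV) (free_rels X) (\<lambda>(x, b). if b then \<psi> x else inv\<^bsub>M\<^esub> \<psi> x)"
    using assms(4) by unfold_locales auto
  show ?thesis
  proof (rule universal[OF _ M])
    show "induced_map F (signed_letter F) \<in> iso (presented (X \<times> UNIV) (free_rels X)) F"
      using assms(2) by (simp add: free_basis_def free_group_def signed_letter_def)
    fix \<Phi> assume \<Phi>: "\<Phi> \<in> hom F M" "\<And>a. a \<in> X \<times> UNIV \<Longrightarrow> \<Phi> (signed_letter F a) = (case a of (x, b) \<Rightarrow> if b then \<psi> x else inv\<^bsub>M\<^esub> \<psi> x)"
    show thesis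
    proof (rule that[OF \<Phi>(1)])
      fix x assume "x \<in> X" then show "\<Phi> x = \<psi> x" using \<Phi>(2)[of "(x, True)"] by (simp add: signed_letter_def)
    qed
  qed
qed

abbreviation fp_alphabet :: "'i set \<Rightarrow> ('i \<Rightarrow> 'a set) \<Rightarrow> ('i \<times> 'a) set" where
  "fp_alphabet I H \<equiv> SIGMA i:I. H i"

abbreviation fp_rels :: "('a, 'b) monoid_scheme \<Rightarrow> 'i set \<Rightarrow> ('i \<Rightarrow> 'a set) \<Rightarrow> (('i \<times> 'a) list \<times> ('i \<times> 'a) list) set" where
  "fp_rels F I H \<equiv> ({([(i, \<one>\<^bsub>F\<^esub>)], []) | i. i \<in> I} \<union>
        {([(i, a), (i, b)], [(i, a \<otimes>\<^bsub>F\<^esub> b)]) | i a b.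
           i \<in> I \<and> a \<in> H i \<and> b \<in> H i})"

lemma fp_presentation:
  assumes "group F" "\<And>i. i \<in> I \<Longrightarrow> subgroup (H i) F"
  shows "presentation F (fp_alphabet I H) (fp_rels F I H) snd"
proof -
  interpret group F by fact
  have c: "a \<in> carrier F" if "i \<in> I" "a \<in> H i" for i a using assms(2)[OF that(1)] that(2) by (rule subgroup.mem_carrier)
  show ?thesis
    by unfold_locales (auto simp: c subgroup.one_closed[OF assms(2)] subgroup.m_closed[OF assms(2)])
qed

lemma factorization_iff:
  assumes "group F"
  shows "factorization F I H \<longleftrightarrow> (\<forall>i\<in>I. subgroup (H i) F) \<and>
    (\<forall>g\<in>carrier F. \<exists>w\<in>lists (fp_alphabet I H). word_prod F (map snd w) = g) \<and>
    (\<forall>u\<in>lists (fp_alphabet I H). \<forall>v\<in>lists (fp_alphabet I H).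
       word_prod F (map snd u) = word_prod F (map snd v) \<longrightarrow>
       (u, v) \<in> word_cong (fp_alphabet I H) (fp_rels F I H))"
proof (cases "\<forall>i\<in>I. subgroup (H i) F")
  case True
  interpret presentation F "fp_alphabet I H" "fp_rels F I H" snd
    by (rule fp_presentation[OF assms]) (use True in simp)
  show ?thesis
    using induced_map_iso_iff True
    unfolding factorization_def free_product_def ev_def by simp
qed (unfold factorization_def, metis)

text \<open>Homomorphisms prescribed on the factors glue. The counts of factors and of edges rest on
  this, with the group of order two as target.\<close>

lemma factorization_universal:
  assumes "group F" "factorization F I H" "group M"
    and "\<And>i. i \<in> I \<Longrightarrow> \<psi> i \<in> hom (F\<lparr>carrier := H i\<rparr>) M"
  obtains \<Phi> where "\<Phi> \<in> hom F M" "\<And>i h. i \<in> I \<Longrightarrow> h \<in> H i \<Longrightarrow> \<Phi> h = \<psi> i h"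
proof -
  have sub: "\<And>i. i \<in> I \<Longrightarrow> subgroup (H i) F" using assms by (simp add: factorization_def)
  interpret presentation F "fp_alphabet I H" "fp_rels F I H" snd
    using fp_presentation[OF assms(1) sub] .
  interpret M: group M by fact
  interpret F: group F by fact
  have one: "\<psi> i \<one>\<^bsub>F\<^esub> = \<one>\<^bsub>M\<^esub>" if "i \<in> I" for i
    using hom_one[OF assms(4)[OF that]] F.subgroup_imp_group[OF sub[OF that]] assms(3) by simp
  have cl: "\<psi> i h \<in> carrier M" if "i \<in> I" "h \<in> H i" for i h
    using assms(4)[OF that(1)] that(2) by (auto simp: hom_def)
  have mu: "\<psi> i (h \<otimes>\<^bsub>F\<^esub> k) = \<psi> i h \<otimes>\<^bsub>M\<^esub> \<psi> i k" if "i \<in> I" "h \<in> H i" "k \<in> H i" for i h k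
    using assms(4)[OF that(1)] that(2,3) by (auto simp: hom_def)
  have M: "presentation M (fp_alphabet I H) (fp_rels F I H) (\<lambda>(i, h). \<psi> i h)"
    by unfold_locales (auto simp: one cl mu subgroup.one_closed[OF sub] subgroup.m_closed[OF sub])
  show ?thesis
  proof (rule universal[OF _ M])
    show "induced_map F snd \<in> iso (presented (fp_alphabet I H) (fp_rels F I H)) F"
      using assms(2) by (simp add: factorization_def free_product_def)
    fix \<Phi> assume \<Phi>: "\<Phi> \<in> hom F M" "\<And>a. a \<in> fp_alphabet I H \<Longrightarrow> \<Phi> (snd a) = (case a of (i, h) \<Rightarrow> \<psi> i h)"
    show thesis
    proof (rule that[OF \<Phi>(1)])
      fix i h assume "i \<in> I" "h \<in> H i" then show "\<Phi> h = \<psi> i h" using \<Phi>(2)[of "(i, h)"] by simp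
    qed
  qed
qed

subsection \<open>Words in a group\<close>

lemma (in group) word_prod_rev_inv:
  "set xs \<subseteq> carrier G \<Longrightarrow> word_prod G (rev (map (m_inv G) xs)) = inv (word_prod G xs)"
proof (induction xs)
  case (Cons x xs)
  have "word_prod G (rev (map (m_inv G) xs) @ [inv x]) = word_prod G (rev (map (m_inv G) xs)) \<otimes> word_prod G [inv x]"
    using Cons.prems by (intro word_prod_append) auto
  then show ?case using Cons by (simp add: inv_mult_group)
qed simp

lemma (in group) inv_cancel [simp]:
  assumes "f \<in> carrier G" "z \<in> carrier G"
  shows "inv f \<otimes> (f \<otimes> z) = z" "f \<otimes> (inv f \<otimes> z) = z"
  using assms by (simp_all add: m_assoc[symmetric])

lemma (in group) pm_closed: "Y \<subseteq> carrier G \<Longrightarrow> pm G Y \<subseteq> carrier G"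
  by (auto simp: pm_def)

lemma (in group) inv_in_pm: "Y \<subseteq> carrier G \<Longrightarrow> d \<in> pm G Y \<Longrightarrow> inv d \<in> pm G Y"
  by (auto simp: pm_def subset_iff)

lemma pm_mono: "Y \<subseteq> Z \<Longrightarrow> pm G Y \<subseteq> pm G Z"
  by (auto simp: pm_def)

lemma (in group) generate_iff_word:
  assumes "Y \<subseteq> carrier G"
  shows "g \<in> generate G Y \<longleftrightarrow> (\<exists>xs. set xs \<subseteq> pm G Y \<and> word_prod G xs = g)"
proof
  note pmc = pm_closed[OF assms]
  assume "g \<in> generate G Y"
  then show "\<exists>xs. set xs \<subseteq> pm G Y \<and> word_prod G xs = g"
  proof induction
    case one show ?case by (intro exI[of _ "[]"]) simp
  next
    case (incl h) then show ?case using assms by (intro exI[of _ "[h]"]) (auto simp: pm_def)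
  next
    case (inv h) then show ?case using assms by (intro exI[of _ "[inv h]"]) (auto simp: pm_def)
  next
    case (eng h1 h2)
    then obtain xs ys where "set xs \<subseteq> pm G Y" "word_prod G xs = h1" "set ys \<subseteq> pm G Y" "word_prod G ys = h2" by blast
    then show ?case using pmc by (intro exI[of _ "xs @ ys"]) (simp add: word_prod_append)
  qed
next
  assume "\<exists>xs. set xs \<subseteq> pm G Y \<and> word_prod G xs = g"
  then obtain xs where "set xs \<subseteq> pm G Y" "word_prod G xs = g" by blast
  then show "g \<in> generate G Y"
  proof (induction xs arbitrary: g)
    case Nil then show ?case using generate.one[of G Y] by auto
  next
    case (Cons x xs)
    then have "x \<in> generate G Y" by (auto simp: pm_def intro: generate.incl generate.inv)
    moreover have "word_prod G xs \<in> generate G Y" using Cons by auto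
    ultimately show ?case using Cons.prems generate.eng[of x G Y] by auto
  qed
qed

text \<open>The product is composition in reverse order, so that a homomorphism from
  \<open>F\<close> is a right action: a word acts letter by letter from left to right, as when it is
  read along a path.\<close>

definition perm_group :: "('s \<Rightarrow> 's) monoid" where
  "perm_group = \<lparr>carrier = {f. bij f}, monoid.mult = (\<lambda>f g. g \<circ> f), one = id\<rparr>"

lemma group_perm_group: "group (perm_group :: ('s \<Rightarrow> 's) monoid)"
proof (rule groupI)
  fix f :: "'s \<Rightarrow> 's" assume "f \<in> carrier perm_group"
  then have "bij f" by (simp add: perm_group_def)
  then have "inv_into UNIV f \<in> carrier perm_group" "f \<circ> inv_into UNIV f = id"
    by (auto simp: perm_group_def bij_imp_bij_inv bij_is_surj surj_iff[symmetric])
  then show "\<exists>g\<in>carrier perm_group. g \<otimes>\<^bsub>perm_group\<^esub> f = \<one>\<^bsub>perm_group\<^esub>"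
    by (auto simp: perm_group_def)
qed (auto simp: perm_group_def bij_comp comp_assoc)

section \<open>Groups with a chosen free basis\<close>

locale based_group = group F for F (structure) +
  fixes X
  assumes basis: "free_basis F X"
begin

abbreviation L where "L \<equiv> pm F X"

lemma X_carrier: "X \<subseteq> carrier F"
  using basis by (simp add: free_basis_def)

lemma X_carrier' [simp]: "x \<in> X \<Longrightarrow> x \<in> carrier F"
  using X_carrier by auto

lemma L_carrier: "L \<subseteq> carrier F"
  using pm_closed[OF X_carrier] .

lemma L_carrier' [simp]: "x \<in> L \<Longrightarrow> x \<in> carrier F"
  using L_carrier by auto

lemma set_L_carrier [simp]: "set xs \<subseteq> L \<Longrightarrow> set xs \<subseteq> carrier F"
  using L_carrier by auto

lemma inv_L [simp]: "d \<in> L \<Longrightarrow> inv d \<in> L"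
  using inv_in_pm[OF X_carrier] .

lemma pm_L: "Y \<subseteq> X \<Longrightarrow> pm F Y \<subseteq> L"
  by (rule pm_mono)

lemma word_exists:
  assumes "g \<in> carrier F"
  obtains xs where "set xs \<subseteq> L" "word_prod F xs = g"
proof -
  obtain w where w: "w \<in> lists (X \<times> UNIV)" "word_prod F (map (signed_letter F) w) = g"
    using basis assms unfolding free_basis_iff[OF group_axioms] by blast
  have "set (map (signed_letter F) w) \<subseteq> L"
    using w(1) by (fastforce simp: signed_letter_def pm_def)
  with w that show ?thesis by blast
qed

text \<open>Any bijections may be assigned to the basis letters. The two actions built in this way
  are on stacks of letters and on pairs of a coset and a bit.\<close>

lemma action_exists:
  fixes \<sigma> :: "'a \<Rightarrow> 's \<Rightarrow> 's"
  assumes "\<And>x. x \<in> X \<Longrightarrow> bij (\<sigma> x)"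
  shows "\<exists>A. (\<forall>x\<in>X. A x = \<sigma> x) \<and> (\<forall>s. A \<one> s = s) \<and>
    (\<forall>g\<in>carrier F. \<forall>h\<in>carrier F. \<forall>s. A (g \<otimes> h) s = A h (A g s))"
proof -
  have "\<And>x. x \<in> X \<Longrightarrow> \<sigma> x \<in> carrier perm_group" using assms by (simp add: perm_group_def)
  then obtain A where A: "A \<in> hom F perm_group" "\<And>x. x \<in> X \<Longrightarrow> A x = \<sigma> x"
    using free_basis_universal[OF group_axioms basis group_perm_group] by blast
  show ?thesis
  proof (intro exI conjI ballI allI)
    show "A \<one> s = s" for s
      using hom_one[OF A(1) group_axioms group_perm_group] by (simp add: perm_group_def)
    show "A (g \<otimes> h) s = A h (A g s)" if "g \<in> carrier F" "h \<in> carrier F" for g h s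
      using hom_mult[OF A(1) that] by (simp add: perm_group_def)
  qed (use A in auto)
qed

text \<open>The exponent sum of \<open>x\<close>, a homomorphism to the integers. It separates basis
  letters from \<open>\<one>\<close> and from inverses of basis letters, and later shows that bases
  are finite.\<close>

lemma counting:
  assumes "x \<in> X"
  obtains \<epsilon> :: "'a \<Rightarrow> int" where "\<epsilon> x = 1" "\<And>y. y \<in> X \<Longrightarrow> y \<noteq> x \<Longrightarrow> \<epsilon> y = 0" "\<epsilon> \<one> = 0"
    "\<And>g h. g \<in> carrier F \<Longrightarrow> h \<in> carrier F \<Longrightarrow> \<epsilon> (g \<otimes> h) = \<epsilon> g + \<epsilon> h"
    "\<And>g. g \<in> carrier F \<Longrightarrow> \<epsilon> (inv g) = - \<epsilon> g"
proof -
  let ?Z = "\<lparr>carrier = UNIV :: int set, monoid.mult = (+), one = 0\<rparr>"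
  have Z: "group ?Z" by (rule groupI) (auto intro: exI[of _ "- _"])
  obtain e where e: "e \<in> hom F ?Z" "\<And>y. y \<in> X \<Longrightarrow> e y = (if y = x then 1 else 0)"
    using free_basis_universal[OF group_axioms basis Z, of "\<lambda>y. if y = x then 1 else 0"] by auto
  have one: "e \<one> = 0" using hom_one[OF e(1) group_axioms Z] by simp
  have mult: "e (g \<otimes> h) = e g + e h" if "g \<in> carrier F" "h \<in> carrier F" for g h
    using hom_mult[OF e(1) that] by simp
  have inv: "e (inv g) = - e g" if "g \<in> carrier F" for g
    using mult[of g "inv g"] that one by simp
  show ?thesis
  proof (rule that[of e])
    show "e x = 1" "\<And>y. y \<in> X \<Longrightarrow> y \<noteq> x \<Longrightarrow> e y = 0" using e(2) assms by auto
  qed (use one mult inv in auto)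
qed

lemma one_notin_X: "\<one> \<notin> X"
proof
  assume "\<one> \<in> X"
  then show False by (rule counting) simp
qed

lemma inv_notin_X: assumes "x \<in> X" shows "inv x \<notin> X"
proof
  assume i: "inv x \<in> X"
  obtain \<epsilon> :: "'a \<Rightarrow> int" where e: "\<epsilon> x = 1" "\<And>y. y \<in> X \<Longrightarrow> y \<noteq> x \<Longrightarrow> \<epsilon> y = 0" "\<And>g. g \<in> carrier F \<Longrightarrow> \<epsilon> (inv g) = - \<epsilon> g"
    by (rule counting[OF assms]) blast
  show False using e(1) e(2)[OF i] e(3)[of x] assms by (cases "inv x = x") auto
qed

lemma one_notin_L: "\<one> \<notin> L"
  using one_notin_X by (auto simp: pm_def) (metis X_carrier' inv_eq_1_iff)

lemma inv_neq_L: assumes "d \<in> L" shows "inv d \<noteq> d"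
proof (cases "d \<in> X")
  case True then show ?thesis using inv_notin_X[OF True] by metis
next
  case False
  then obtain x where "x \<in> X" "d = inv x" using assms by (auto simp: pm_def)
  then show ?thesis using False by auto
qed

lemma pm_inter_X: "Y \<subseteq> X \<Longrightarrow> pm F Y \<inter> X = Y"
  using inv_notin_X by (auto simp: pm_def)

subsection \<open>Reduced words\<close>

abbreviation reduced :: "'a list \<Rightarrow> bool" where
  "reduced \<equiv> successively (\<lambda>a b. inv a \<noteq> b)"

text \<open>Van der Waerden's device: \<open>F\<close> acts on reduced words by appending a letter
  or cancelling the last one. The list is a stack with the last letter first, so it spells the word
  backwards.\<close>

definition push :: "'a \<Rightarrow> 'a list \<Rightarrow> 'a list" where
  "push d s = (if s \<noteq> [] \<and> hd s = inv d then tl s else d # s)"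

definition Red :: "'a list set" where
  "Red = {s. set s \<subseteq> L \<and> reduced s}"

lemma inv_eq_iff: "a \<in> L \<Longrightarrow> b \<in> L \<Longrightarrow> inv a = b \<longleftrightarrow> inv b = a"
  by auto

lemma push_push:
  assumes "s \<in> Red" "d \<in> L"
  shows "push (inv d) (push d s) = s" "push d s \<in> Red"
proof -
  show "push d s \<in> Red"
    using assms by (cases s) (auto simp: push_def Red_def successively_Cons)
  show "push (inv d) (push d s) = s"
  proof (cases "s \<noteq> [] \<and> hd s = inv d")
    case True
    then obtain t where s: "s = inv d # t" by (metis list.collapse)
    then have "t = [] \<or> hd t \<noteq> d" using assms by (auto simp: Red_def successively_Cons)
    then show ?thesis using s assms(2) by (auto simp: push_def)
  qed (use assms in \<open>auto simp: push_def\<close>)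
qed

lemma reduced_word_action:
  obtains A :: "'a \<Rightarrow> 'a list \<Rightarrow> 'a list" where
    "\<And>d s. d \<in> L \<Longrightarrow> s \<in> Red \<Longrightarrow> A d s = push d s" "\<And>s. A \<one> s = s"
    "\<And>g h s. g \<in> carrier F \<Longrightarrow> h \<in> carrier F \<Longrightarrow> A (g \<otimes> h) s = A h (A g s)"
proof -
  \<comment> \<open>Lists that are not reduced stay fixed, so that every letter acts by a bijection
    of the whole type.\<close>
  define \<sigma> where "\<sigma> d s = (if s \<in> Red then push d s else s)" for d s
  have inv: "\<sigma> (inv d) (\<sigma> d s) = s" if "d \<in> L" for d s
    using push_push[OF _ that] by (auto simp: \<sigma>_def)
  have "bij (\<sigma> x)" if "x \<in> L" for x
  proof (rule o_bij)
    show "\<sigma> (inv x) \<circ> \<sigma> x = id" using inv[OF that] by (simp add: fun_eq_iff)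
    show "\<sigma> x \<circ> \<sigma> (inv x) = id" using inv[OF inv_L[OF that]] that by (simp add: fun_eq_iff)
  qed
  then have "\<And>x. x \<in> X \<Longrightarrow> bij (\<sigma> x)" by (auto simp: pm_def)
  then obtain A where "\<forall>x\<in>X. A x = \<sigma> x" "\<forall>s. A \<one> s = s"
    "\<forall>g\<in>carrier F. \<forall>h\<in>carrier F. \<forall>s. A (g \<otimes> h) s = A h (A g s)"
    using action_exists[of \<sigma>] by metis
  then have A: "\<And>x. x \<in> X \<Longrightarrow> A x = \<sigma> x" "\<And>s. A \<one> s = s"
    "\<And>g h s. g \<in> carrier F \<Longrightarrow> h \<in> carrier F \<Longrightarrow> A (g \<otimes> h) s = A h (A g s)"
    by simp_all
  have "A d s = \<sigma> d s" if d: "d \<in> L" for d s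
  proof (cases "d \<in> X")
    case False
    then obtain x where x: "x \<in> X" "d = inv x" using d by (auto simp: pm_def)
    have xL: "x \<in> L" using x by (auto simp: pm_def)
    have "A d s = A d (A x (\<sigma> d s))" using A(1)[OF x(1)] inv[OF d] x by simp
    also have "\<dots> = \<sigma> d s" using A(3)[of x d] A(2) x by simp
    finally show ?thesis .
  qed (use A in auto)
  then show ?thesis using that[of A] A by (auto simp: \<sigma>_def)
qed

text \<open>The normal form is the stack reached from the empty one, reversed. A reduced word never
  cancels on its way to the stack, which gives uniqueness of reduced words; each letter raises the
  height by at most one, so reduced words are shortest.\<close>

lemma reduced_normal_form:
  obtains nf :: "'a \<Rightarrow> 'a list" where
    "\<And>xs. set xs \<subseteq> L \<Longrightarrow> reduced xs \<Longrightarrow> nf (word_prod F xs) = xs"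
    "\<And>xs. set xs \<subseteq> L \<Longrightarrow> length (nf (word_prod F xs)) \<le> length xs"
proof -
  obtain A :: "'a \<Rightarrow> 'a list \<Rightarrow> 'a list" where A:
    "\<And>d s. d \<in> L \<Longrightarrow> s \<in> Red \<Longrightarrow> A d s = push d s" "\<And>s. A \<one> s = s"
    "\<And>g h s. g \<in> carrier F \<Longrightarrow> h \<in> carrier F \<Longrightarrow> A (g \<otimes> h) s = A h (A g s)"
    by (rule reduced_word_action) blast
  have len: "length (A (word_prod F xs) s) \<le> length xs + length s" if "set xs \<subseteq> L" "s \<in> Red" for xs s
    using that
  proof (induction xs arbitrary: s)
    case (Cons x xs)
    have "A (word_prod F (x # xs)) s = A (word_prod F xs) (push x s)"
      using Cons.prems A by simp
    moreover have "length (push x s) \<le> Suc (length s)" by (auto simp: push_def)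
    ultimately show ?case using Cons.IH[of "push x s"] Cons.prems push_push(2)[of s x] by simp
  qed (simp add: A)
  have red: "A (word_prod F xs) s = rev xs @ s" if "set xs \<subseteq> L" "rev xs @ s \<in> Red" for xs s
    using that
  proof (induction xs arbitrary: s)
    case (Cons x xs)
    have xs: "x # s \<in> Red" "s \<in> Red"
      using Cons.prems by (auto simp: Red_def successively_append_iff successively_Cons)
    have "s = [] \<or> hd s \<noteq> inv x" using xs by (auto simp: Red_def successively_Cons)
    then have "push x s = x # s" by (auto simp: push_def)
    then have "A (word_prod F (x # xs)) s = A (word_prod F xs) (x # s)"
      using Cons.prems A xs by simp
    then show ?case using Cons by simp
  qed (simp add: A)
  show ?thesis
  proof (rule that[of "\<lambda>g. rev (A g [])"])
    fix xs assume xs: "set xs \<subseteq> L"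
    show "length (rev (A (word_prod F xs) [])) \<le> length xs"
      using len[OF xs, of "[]"] by (simp add: Red_def)
    assume r: "reduced xs"
    have "successively (\<lambda>x y. inv y \<noteq> x) xs"
      by (rule successively_mono[OF r]) (use xs inv_eq_iff in blast)
    then have "rev xs @ [] \<in> Red" using xs by (simp add: Red_def)
    from red[OF xs this] show "rev (A (word_prod F xs) []) = xs" by simp
  qed
qed

lemma reduced_unique:
  assumes "set xs \<subseteq> L" "set ys \<subseteq> L" "reduced xs" "reduced ys" "word_prod F xs = word_prod F ys"
  shows "xs = ys"
  by (rule reduced_normal_form) (use assms in metis)

lemma reduced_shortest:
  assumes "set xs \<subseteq> L" "set ys \<subseteq> L" "reduced xs" "word_prod F xs = word_prod F ys"
  shows "length xs \<le> length ys"
  by (rule reduced_normal_form) (use assms in metis)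

lemma not_reduced_shorten:
  assumes "set xs \<subseteq> L" "\<not> reduced xs"
  obtains us vs a where "xs = us @ a # inv a # vs" "word_prod F (us @ vs) = word_prod F xs"
proof -
  obtain i where i: "Suc i < length xs" "xs ! Suc i = inv (xs ! i)"
    using assms(2) by (auto simp: successively_conv_nth)
  define a where "a = xs ! i"
  have e: "xs = take i xs @ a # inv a # drop (Suc (Suc i)) xs"
    using i by (metis Cons_nth_drop_Suc Suc_lessD a_def append_take_drop_id)
  have s: "set (take i xs) \<subseteq> carrier F" "set (drop (Suc (Suc i)) xs) \<subseteq> carrier F" "a \<in> carrier F"
    using set_L_carrier[OF assms(1)] set_take_subset[of i xs] set_drop_subset[of "Suc (Suc i)" xs] i
    by (auto simp: a_def)
  have "word_prod F (take i xs @ a # inv a # drop (Suc (Suc i)) xs) = word_prod F (take i xs @ drop (Suc (Suc i)) xs)"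
    using s by (simp add: word_prod_append m_assoc[symmetric])
  then show ?thesis using that[OF e] e by simp
qed

lemma reduced_form:
  assumes "set xs \<subseteq> L"
  obtains ys where "set ys \<subseteq> set xs" "reduced ys" "word_prod F ys = word_prod F xs"
proof -
  have "\<exists>ys. set ys \<subseteq> set xs \<and> reduced ys \<and> word_prod F ys = word_prod F xs"
    using assms
  proof (induction "length xs" arbitrary: xs rule: less_induct)
    case less
    show ?case
    proof (cases "reduced xs")
      case False
      obtain us vs a where xs: "xs = us @ a # inv a # vs" "word_prod F (us @ vs) = word_prod F xs"
        using not_reduced_shorten[OF less.prems False] by blast
      have "\<exists>ys. set ys \<subseteq> set (us @ vs) \<and> reduced ys \<and> word_prod F ys = word_prod F (us @ vs)"
        using less.prems xs(1) by (intro less.hyps) auto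
      then show ?thesis using xs by auto
    qed auto
  qed
  then show ?thesis using that by blast
qed

lemma reduced_power:
  assumes "reduced xs" "xs \<noteq> []" "inv (last xs) \<noteq> hd xs"
  shows "reduced (concat (replicate N xs))"
proof (induction N)
  case (Suc N)
  have "concat (replicate N xs) = [] \<or> hd (concat (replicate N xs)) = hd xs"
    by (cases N) (auto simp: assms(2))
  then show ?case using Suc assms by (auto simp: successively_append_iff)
qed simp

lemma word_prod_power:
  assumes "set xs \<subseteq> carrier F"
  shows "word_prod F (concat (replicate N xs)) = word_prod F xs [^] N"
proof (induction N)
  case (Suc N)
  have "set (concat (replicate N xs)) \<subseteq> carrier F" using assms by (induction N) auto
  then show ?case using Suc assms nat_pow_Suc2[of "word_prod F xs" N] by (simp add: word_prod_append)
qed simp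

lemma set_concat_replicate: "set (concat (replicate N xs)) \<subseteq> set xs"
  by (induction N) auto

lemma length_concat_replicate: "length (concat (replicate N xs)) = N * length xs"
  by (induction N) auto

text \<open>Compare the lengths of the \<open>N\<close>th powers, which are \<open>N |xs|\<close> and at most \<open>N |ys| + 2 |c|\<close>.\<close>

lemma cyclically_reduced_shortest:
  assumes "set xs \<subseteq> L" "set ys \<subseteq> L" "reduced xs" "xs \<noteq> []" "inv (last xs) \<noteq> hd xs"
    and "f \<in> carrier F" "word_prod F xs = f \<otimes> word_prod F ys \<otimes> inv f"
  shows "length xs \<le> length ys"
proof (rule ccontr)
  assume "\<not> length xs \<le> length ys"
  obtain c where c: "set c \<subseteq> L" "word_prod F c = f" using word_exists[OF assms(6)] by blast
  \<comment> \<open>Any \<open>N\<close> above \<open>2 * length c\<close> works: if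
    \<open>xs\<close> were longer than \<open>ys\<close> by at least one letter, its power would be
    longer by at least \<open>N\<close>.\<close>
  define N where "N = 2 * length c + 1"
  define xN yN where "xN = concat (replicate N xs)" and "yN = concat (replicate N ys)"
  let ?c' = "rev (map (m_inv F) c)"
  have c': "set ?c' \<subseteq> L" using c(1) by auto
  have sy: "set yN \<subseteq> L" "set xN \<subseteq> L" 
    using set_concat_replicate[of N ys] set_concat_replicate[of N xs] assms(1,2)
    unfolding xN_def yN_def by (meson subset_trans)+
  have wy: "word_prod F ys \<in> carrier F" using assms(2) by simp
  have pw: "word_prod F xs [^] n = f \<otimes> word_prod F ys [^] n \<otimes> inv f" for n :: nat
  proof (induction n)
    case 0 then show ?case using assms(6) by simp
  next
    case (Suc n)
    have "word_prod F xs [^] Suc n = (f \<otimes> word_prod F ys [^] n \<otimes> inv f) \<otimes> (f \<otimes> word_prod F ys \<otimes> inv f)"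
      using Suc assms(7) by simp
    also have "\<dots> = f \<otimes> word_prod F ys [^] Suc n \<otimes> inv f"
      using wy assms(6) by (simp add: m_assoc)
    finally show ?case .
  qed
  have "word_prod F (c @ yN @ ?c') = f \<otimes> (word_prod F yN \<otimes> inv f)"
    using c sy set_L_carrier[OF c'] word_prod_rev_inv[of c] assms(6) by (simp add: word_prod_append)
  also have "\<dots> = word_prod F xN"
    using pw[of N] wy assms(6) by (simp add: xN_def yN_def word_prod_power assms m_assoc)
  finally have eq: "word_prod F xN = word_prod F (c @ yN @ ?c')" by simp
  have "length xN \<le> length (c @ yN @ ?c')"
    using reduced_power[OF assms(3-5), of N] c c' sy
    by (intro reduced_shortest[OF _ _ _ eq]) (auto simp: xN_def)
  then have le: "N * length xs \<le> N * length ys + 2 * length c" by (simp add: xN_def yN_def length_concat_replicate)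
  have "N * length ys + N \<le> N * length xs"
    using mult_le_mono2[of "Suc (length ys)" "length xs" N] \<open>\<not> length xs \<le> length ys\<close> by simp
  with le show False unfolding N_def by linarith
qed

end

subsection \<open>Normal words of elements and classes\<close>

lemma length_extended [simp]: "length (extended F r xs) = Suc (Suc (length xs))"
  by (cases r) auto

lemma extended_Suc: "i < length xs \<Longrightarrow> extended F r xs ! Suc i = xs ! i"
  by (cases r) (auto simp: nth_append)

lemma normal_word_iff:
  "normal_word F X r xs \<longleftrightarrow> xs \<noteq> [] \<and> set xs \<subseteq> pm F X \<and> represents F xs r \<and>
     successively (\<lambda>a b. inv\<^bsub>F\<^esub> a \<noteq> b) (extended F r xs)"
  unfolding normal_word_def successively_conv_nth by (auto simp: less_Suc_eq_le)

lemma extended_restrict_to [simp]: "extended F (restrict_to F Y r) = extended F r"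
  by (cases r) (auto simp: fun_eq_iff)

context group begin

lemma conj_classI: "g \<in> carrier G \<Longrightarrow> g \<in> conj_class G g"
  unfolding conj_class_def by (intro CollectI exI[of _ \<one>]) auto

lemma conj_class_conj:
  assumes "h \<in> conj_class G g" "f \<in> carrier G" "g \<in> carrier G"
  shows "f \<otimes> h \<otimes> inv f \<in> conj_class G g"
proof -
  obtain k where k: "k \<in> carrier G" "h = k \<otimes> g \<otimes> inv k" using assms(1) by (auto simp: conj_class_def)
  then have "f \<otimes> h \<otimes> inv f = (f \<otimes> k) \<otimes> g \<otimes> inv (f \<otimes> k)"
    using assms by (simp add: m_assoc inv_mult_group)
  then show ?thesis using k assms unfolding conj_class_def by blast
qed

lemma conj_class_carrier: "g \<in> carrier G \<Longrightarrow> h \<in> conj_class G g \<Longrightarrow> h \<in> carrier G"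
  by (auto simp: conj_class_def)

lemma conj_class_conjugate:
  assumes "h \<in> conj_class G g" "h' \<in> conj_class G g" "g \<in> carrier G"
  obtains f where "f \<in> carrier G" "h = f \<otimes> h' \<otimes> inv f"
proof -
  obtain k k' where k: "k \<in> carrier G" "h = k \<otimes> g \<otimes> inv k" "k' \<in> carrier G" "h' = k' \<otimes> g \<otimes> inv k'"
    using assms(1,2) by (auto simp: conj_class_def)
  then have "h = (k \<otimes> inv k') \<otimes> h' \<otimes> inv (k \<otimes> inv k')"
    using assms(3) by (simp add: m_assoc inv_mult_group)
  then show ?thesis by (rule that[rotated]) (use k in simp)
qed

lemma conj_class_eq:
  assumes "h \<in> conj_class G g" "g \<in> carrier G"
  shows "conj_class G h = conj_class G g"
proof -
  have h: "h \<in> carrier G" using conj_class_carrier assms by blast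
  obtain f where f: "f \<in> carrier G" "g = f \<otimes> h \<otimes> inv f"
    by (rule conj_class_conjugate[OF conj_classI[OF assms(2)] assms(1,2)])
  show ?thesis
  proof (intro equalityI subsetI)
    fix k assume "k \<in> conj_class G h"
    then obtain a where "a \<in> carrier G" "k = a \<otimes> h \<otimes> inv a" by (auto simp: conj_class_def)
    then show "k \<in> conj_class G g" using conj_class_conj[OF assms(1) _ assms(2)] by blast
  next
    fix k assume "k \<in> conj_class G g"
    then obtain a where "a \<in> carrier G" "k = a \<otimes> g \<otimes> inv a" by (auto simp: conj_class_def)
    moreover have "g \<in> conj_class G h" using f by (auto simp: conj_class_def)
    ultimately show "k \<in> conj_class G h" using conj_class_conj[OF _ _ h] by blast
  qed
qed

lemma one_notin_conj_class:
  assumes "g \<in> carrier G" "g \<noteq> \<one>" shows "\<one> \<notin> conj_class G g"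
proof
  assume "\<one> \<in> conj_class G g"
  then obtain f where f: "f \<in> carrier G" "g = f \<otimes> \<one> \<otimes> inv f"
    by (rule conj_class_conjugate[OF conj_classI[OF assms(1)] _ assms(1)])
  then show False using assms by simp
qed

end

text \<open>A minimum over all words representing \<open>r\<close>, normal or not. An upper bound
  then needs only some word, which is how a step of the algorithm is shown to shorten
  \<open>r\<close>.\<close>

definition word_length :: "('a, 'b) monoid_scheme \<Rightarrow> 'a set \<Rightarrow> 'a elt_or_class \<Rightarrow> nat" where
  "word_length F X r = (LEAST n. \<exists>xs. length xs = n \<and> set xs \<subseteq> pm F X \<and> represents F xs r)"

lemma word_length_le: "set xs \<subseteq> pm F X \<Longrightarrow> represents F xs r \<Longrightarrow> word_length F X r \<le> length xs"
  unfolding word_length_def by (rule Least_le) blast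

context based_group begin

abbreviation nontriv :: "'a elt_or_class \<Rightarrow> bool" where
  "nontriv r \<equiv> r \<in> elts_and_classes F (carrier F - {\<one>})"

lemma nontriv_cases:
  assumes "nontriv r"
  obtains (Elt) g where "r = Elt g" "g \<in> carrier F" "g \<noteq> \<one>"
  | (Cls) g where "r = Cls (conj_class F g)" "g \<in> carrier F" "g \<noteq> \<one>"
  using assms by (auto simp: elts_and_classes_def)

lemma normal_Elt_iff:
  "normal_word F X (Elt g) xs \<longleftrightarrow> xs \<noteq> [] \<and> set xs \<subseteq> L \<and> g = word_prod F xs \<and> reduced xs"
proof (cases "xs \<noteq> [] \<and> set xs \<subseteq> L")
  case True
  then have "hd xs \<in> L" "last xs \<in> L" by auto
  then have "hd xs \<noteq> \<one>" "inv (last xs) \<noteq> \<one>" using one_notin_L inv_L by metis+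
  then show ?thesis using True
    by (auto simp: normal_word_iff successively_append_iff successively_Cons)
qed (auto simp: normal_word_iff)

lemma normal_Cls_iff:
  "normal_word F X (Cls C) xs \<longleftrightarrow>
     xs \<noteq> [] \<and> set xs \<subseteq> L \<and> word_prod F xs \<in> C \<and> reduced xs \<and> inv (last xs) \<noteq> hd xs"
  by (auto simp: normal_word_iff successively_append_iff successively_Cons)

lemma represents_exists:
  assumes "nontriv r"
  obtains xs where "set xs \<subseteq> L" "represents F xs r"
  using assms
proof (cases rule: nontriv_cases)
  case (Elt g)
  obtain xs where "set xs \<subseteq> L" "word_prod F xs = g" using word_exists Elt by blast
  then show ?thesis using that[of xs] Elt by auto
next
  case (Cls g)
  obtain xs where "set xs \<subseteq> L" "word_prod F xs = g" using word_exists Cls by blast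
  then show ?thesis using that[of xs] Cls conj_classI by auto
qed

lemma word_length_attained:
  assumes "nontriv r"
  obtains xs where "length xs = word_length F X r" "set xs \<subseteq> L" "represents F xs r"
proof -
  have "\<exists>n xs. length xs = n \<and> set xs \<subseteq> L \<and> represents F xs r"
    using represents_exists[OF assms] by metis
  then have "\<exists>xs. length xs = word_length F X r \<and> set xs \<subseteq> L \<and> represents F xs r"
    unfolding word_length_def by (rule LeastI_ex)
  then show ?thesis using that by blast
qed

text \<open>Any failure of normality yields a shorter representative: an adjacent inverse pair is
  deleted, and for a class a first letter inverse to the last is removed together with it by
  conjugation. These two are different occurrences because no letter is its own inverse.\<close>

lemma shortest_normal:
  assumes "nontriv r" "length xs = word_length F X r" "set xs \<subseteq> L" "represents F xs r"
  shows "normal_word F X r xs"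
proof -
  have red: "reduced xs"
  proof (rule ccontr)
    assume "\<not> reduced xs"
    then obtain us vs a where xs: "xs = us @ a # inv a # vs" "word_prod F (us @ vs) = word_prod F xs"
      using not_reduced_shorten[OF assms(3)] by blast
    have "represents F (us @ vs) r" using assms(4) xs(2) by (cases r) auto
    then have "word_length F X r \<le> length (us @ vs)" using assms(3) xs(1) by (intro word_length_le) auto
    then show False using assms(2) xs(1) by simp
  qed
  show ?thesis using assms(1)
  proof (cases rule: nontriv_cases)
    case (Elt g)
    then show ?thesis using red assms by (auto simp: normal_Elt_iff)
  next
    case (Cls g)
    have ne: "xs \<noteq> []" using Cls assms(4) one_notin_conj_class by auto
    have "inv (last xs) \<noteq> hd xs"
    proof
      assume e: "inv (last xs) = hd xs"
      have last: "last xs \<in> L" using ne assms(3) by auto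
      obtain x ms where xs: "xs = x # ms" using ne by (cases xs) auto
      have "ms \<noteq> []" using e inv_neq_L[OF last] xs by auto
      then obtain ns where ms: "ms = ns @ [last xs]" using xs by (metis append_butlast_last_id last_ConsR)
      have x: "x = inv (last xs)" using e xs by simp
      have "xs = x # ns @ [last xs]" using xs ms by simp
      have c: "set ns \<subseteq> L" using assms(3) xs ms by (metis le_sup_iff list.set(2) set_append subset_insertI subset_trans)
      define z where "z = last xs"
      have z: "z \<in> carrier F" using last z_def by simp
      have xz: "xs = inv z # ns @ [z]" using xs ms x z_def by simp
      have "word_prod F xs = inv z \<otimes> (word_prod F ns \<otimes> z)"
        unfolding xz using c z by (simp add: word_prod_append)
      then have "word_prod F ns = z \<otimes> word_prod F xs \<otimes> inv z"
        using c z by (simp add: m_assoc)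
      then have "represents F ns r"
        using conj_class_conj[of "word_prod F xs" g z] Cls assms(4) z by simp
      then have "word_length F X r \<le> length ns" using c by (intro word_length_le) auto
      then show False using assms(2) xz by (metis Suc_n_not_le_n le_SucI length_Cons length_append_singleton)
    qed
    then show ?thesis using ne red assms Cls by (auto simp: normal_Cls_iff)
  qed
qed

text \<open>With \<open>shortest_normal\<close> this identifies the normal words of \<open>r\<close>
  with its shortest representatives. Their existence follows, and for finite \<open>X\<close> also
  their finite number.\<close>

lemma normal_word_length:
  assumes "nontriv r" "normal_word F X r xs"
  shows "length xs = word_length F X r"
proof (rule antisym)
  show "word_length F X r \<le> length xs"
    using assms(2) by (intro word_length_le) (auto simp: normal_word_iff)
  obtain ys where ys: "length ys = word_length F X r" "set ys \<subseteq> L" "represents F ys r"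
    using word_length_attained[OF assms(1)] by blast
  have "length xs \<le> length ys" using assms(1)
  proof (cases rule: nontriv_cases)
    case (Elt g)
    then show ?thesis using assms(2) ys by (intro reduced_shortest) (auto simp: normal_Elt_iff)
  next
    case (Cls g)
    then have n: "xs \<noteq> []" "set xs \<subseteq> L" "word_prod F xs \<in> conj_class F g" "reduced xs" "inv (last xs) \<noteq> hd xs"
      using assms(2) by (auto simp: normal_Cls_iff)
    moreover have "word_prod F ys \<in> conj_class F g" using ys Cls by simp
    ultimately obtain f where "f \<in> carrier F" "word_prod F xs = f \<otimes> word_prod F ys \<otimes> inv f"
      using conj_class_conjugate Cls by metis
    then show ?thesis using n ys by (intro cyclically_reduced_shortest) auto
  qed
  then show "length xs \<le> word_length F X r" using ys by simp
qed

lemma normal_word_exists: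
  assumes "nontriv r" obtains xs where "normal_word F X r xs"
  using word_length_attained[OF assms] shortest_normal[OF assms] by metis

lemma finite_normal_words:
  assumes "finite X" "nontriv r"
  shows "finite {xs. normal_word F X r xs}"
proof (rule finite_subset)
  show "{xs. normal_word F X r xs} \<subseteq> {xs. set xs \<subseteq> L \<and> length xs = word_length F X r}"
    using normal_word_length[OF assms(2)] by (auto simp: normal_word_iff)
  show "finite {xs. set xs \<subseteq> L \<and> length xs = word_length F X r}"
    using assms(1) by (intro finite_lists_length_eq) (simp add: pm_def)
qed

lemma normal_word_letters:
  assumes "normal_word F X r xs"
  shows "set xs \<subseteq> pm F (support F X r)"
proof
  fix x assume x: "x \<in> set xs"
  then have xL: "x \<in> L" using assms by (auto simp: normal_word_iff)
  show "x \<in> pm F (support F X r)"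
  proof (cases "x \<in> X")
    case True
    then have "x \<in> support F X r" using assms x by (auto simp: support_def pm_def)
    then show ?thesis by (simp add: pm_def)
  next
    case False
    then obtain y where y: "y \<in> X" "x = inv y" using xL by (auto simp: pm_def)
    then have "y = inv x" by simp
    then have "y \<in> pm F (set xs)" using x by (auto simp: pm_def)
    then have "y \<in> support F X r" using assms y by (auto simp: support_def)
    then show ?thesis using y by (simp add: pm_def)
  qed
qed

lemma support_subset: "support F X r \<subseteq> X"
  by (auto simp: support_def)

lemma supportE:
  assumes "y \<in> support F X r"
  obtains xs where "normal_word F X r xs" "y \<in> X" "y \<in> set xs \<or> inv y \<in> set xs"
proof -
  obtain xs where xs: "normal_word F X r xs" "y \<in> pm F (set xs)" "y \<in> X"
    using assms by (auto simp: support_def)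
  have "set xs \<subseteq> carrier F" using xs by (auto simp: normal_word_iff)
  then have "y \<in> set xs \<or> inv y \<in> set xs" using xs(2) by (auto simp: pm_def subset_iff)
  with xs that show ?thesis by blast
qed

lemma support_nonempty: assumes "nontriv r" shows "support F X r \<noteq> {}"
proof -
  obtain xs where xs: "normal_word F X r xs" using normal_word_exists[OF assms] .
  then have "xs \<noteq> []" by (auto simp: normal_word_iff)
  then show ?thesis using normal_word_letters[OF xs] by (cases xs) (auto simp: pm_def)
qed

subsection \<open>Turns and Whitehead graphs\<close>

lemma turns_iff:
  "(d, e) \<in> turns F X r \<longleftrightarrow> (\<exists>xs i. normal_word F X r xs \<and> i \<le> length xs \<and>
      d = inv (extended F r xs ! i) \<and> e = extended F r xs ! Suc i)"
  by (auto simp: turns_def)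

text \<open>A normal word uses only letters of the support, so its product lies in
  \<open>generate F Y\<close> and, for a class, in the trace of the class there. Thus the Whitehead
  graph of a part can be computed with words over the whole basis.\<close>

lemma normal_restrict_iff:
  assumes "Y \<subseteq> X" "support F X r \<subseteq> Y"
  shows "normal_word F Y (restrict_to F Y r) xs \<longleftrightarrow> normal_word F X r xs"
proof
  assume n: "normal_word F Y (restrict_to F Y r) xs"
  have "represents F xs r" using n by (cases r) (auto simp: normal_word_iff)
  then show "normal_word F X r xs" using n pm_L[OF assms(1)] by (auto simp: normal_word_iff)
next
  assume n: "normal_word F X r xs"
  have s: "set xs \<subseteq> pm F Y" using normal_word_letters[OF n] pm_mono[OF assms(2)] by blast
  then have "word_prod F xs \<in> generate F Y" using generate_iff_word[of Y] assms(1) X_carrier by blast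
  then have "represents F xs (restrict_to F Y r)" using n by (cases r) (auto simp: normal_word_iff)
  then show "normal_word F Y (restrict_to F Y r) xs" using n s by (auto simp: normal_word_iff)
qed

definition part_turns :: "'a elt_or_class set \<Rightarrow> 'a set \<Rightarrow> ('a \<times> 'a) set" where
  "part_turns R Y = (\<Union>r\<in>{r \<in> R. support F X r \<subseteq> Y}. turns F X r)"

lemma extended_letters:
  assumes "normal_word F X r xs" "i < Suc (Suc (length xs))" 
  shows "extended F r xs ! i \<in> insert \<one> (set xs)"
proof -
  have "extended F r xs ! i \<in> set (extended F r xs)" using assms(2) by (intro nth_mem) simp
  also have "set (extended F r xs) \<subseteq> insert \<one> (set xs)"
    using assms(1) by (cases r) (auto simp: normal_word_iff)
  finally show ?thesis .
qed

lemma turns_neq: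
  assumes "(d, e) \<in> turns F X r" shows "d \<noteq> e"
  using assms unfolding turns_iff normal_word_def by auto

lemma turns_letters:
  assumes "(d, e) \<in> turns F X r" "support F X r \<subseteq> Y" "Y \<subseteq> X"
  shows "d \<in> pm0 F Y" "e \<in> pm0 F Y"
proof -
  obtain xs i where n: "normal_word F X r xs" "i \<le> length xs"
    "d = inv (extended F r xs ! i)" "e = extended F r xs ! Suc i"
    using assms(1) unfolding turns_iff by blast
  have s: "set xs \<subseteq> pm F Y" using normal_word_letters[OF n(1)] pm_mono[OF assms(2)] by blast
  have Y: "Y \<subseteq> carrier F" using assms(3) X_carrier by auto
  have "extended F r xs ! i \<in> insert \<one> (pm F Y)" "e \<in> insert \<one> (pm F Y)"
    using extended_letters[OF n(1), of i] extended_letters[OF n(1), of "Suc i"] n s by auto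
  then show "d \<in> pm0 F Y" "e \<in> pm0 F Y" using n(3) inv_in_pm[OF Y] by (auto simp: pm0_def)
qed

lemma letter_turns:
  assumes "normal_word F X r xs" "x \<in> set xs"
  shows "x \<in> snd ` turns F X r" "inv x \<in> fst ` turns F X r"
proof -
  obtain i where i: "i < length xs" "xs ! i = x" using assms(2) by (auto simp: in_set_conv_nth)
  have "(inv (extended F r xs ! i), x) \<in> turns F X r"
    unfolding turns_iff using assms(1) i by (metis extended_Suc less_imp_le)
  then show "x \<in> snd ` turns F X r" by force
  have "(inv x, extended F r xs ! Suc (Suc i)) \<in> turns F X r"
    unfolding turns_iff using assms(1) i by (metis extended_Suc Suc_leI)
  then show "inv x \<in> fst ` turns F X r" by force
qed

text \<open>A letter \<open>x\<close> is the second entry of the turn before it, and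
  \<open>inv x\<close> is the first entry of the turn after it. So the inverse of a cutvertex that
  is a letter is a vertex too and lies on one of the two sides.\<close>

lemma turn_vertex_inv:
  assumes "d \<in> fst ` turns F X r \<union> snd ` turns F X r" "d \<noteq> \<one>"
  shows "inv d \<in> fst ` turns F X r \<union> snd ` turns F X r"
proof -
  consider e where "(d, e) \<in> turns F X r" | e where "(e, d) \<in> turns F X r" using assms(1) by auto
  then show ?thesis
  proof cases
    case 1
    then obtain xs i where n: "normal_word F X r xs" "i \<le> length xs" "d = inv (extended F r xs ! i)"
      unfolding turns_iff by blast
    then have "extended F r xs ! i \<in> set xs" using extended_letters[OF n(1), of i] assms(2) by auto
    moreover have "inv d = extended F r xs ! i" using n calculation by (auto simp: normal_word_iff)
    ultimately show ?thesis using letter_turns[OF n(1)] by simp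
  next
    case 2
    then obtain xs i where n: "normal_word F X r xs" "i \<le> length xs" "d = extended F r xs ! Suc i"
      unfolding turns_iff by blast
    then have "d \<in> set xs" using extended_letters[OF n(1), of "Suc i"] assms(2) by auto
    then show ?thesis using letter_turns[OF n(1)] by simp
  qed
qed

lemma whitehead_graph_restricted:
  assumes "Y \<subseteq> X"
  shows "whitehead_graph F Y (restricted F R Y X) =
    (fst ` part_turns R Y \<union> snd ` part_turns R Y, part_turns R Y)"
proof -
  have t: "turns F Y (restrict_to F Y r) = turns F X r" if "support F X r \<subseteq> Y" for r
    unfolding turns_def normal_restrict_iff[OF assms that] by simp
  have "(\<Union>r\<in>restricted F R Y X. turns F Y r) = part_turns R Y"
    unfolding restricted_def part_turns_def using t by auto
  moreover have "{v \<in> pm0 F Y. \<exists>e\<in>part_turns R Y. meets e {v}} = fst ` part_turns R Y \<union> snd ` part_turns R Y"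
  proof (intro equalityI subsetI)
    fix v assume "v \<in> {v \<in> pm0 F Y. \<exists>e\<in>part_turns R Y. meets e {v}}"
    then show "v \<in> fst ` part_turns R Y \<union> snd ` part_turns R Y" by (auto simp: meets_def)
  next
    fix v assume "v \<in> fst ` part_turns R Y \<union> snd ` part_turns R Y"
    then obtain d e where de: "(d, e) \<in> part_turns R Y" "v = d \<or> v = e" by force
    then obtain r where "(d, e) \<in> turns F X r" "support F X r \<subseteq> Y" by (auto simp: part_turns_def)
    then have "v \<in> pm0 F Y" using turns_letters[OF _ _ assms] de(2) by blast
    moreover have "meets (d, e) {v}" using de(2) by (auto simp: meets_def)
    ultimately show "v \<in> {v \<in> pm0 F Y. \<exists>e\<in>part_turns R Y. meets e {v}}" using de(1) by blast
  qed
  ultimately show ?thesis by (simp add: whitehead_graph_def Let_def)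
qed

subsection \<open>The support partition\<close>

text \<open>The finest admissible partition is the common refinement of all admissible ones. It is
  admissible because supports are nonempty: the blocks that contain a given support have a nonempty
  intersection, which is a block.\<close>

lemma support_partition_finest:
  assumes "R \<subseteq> elts_and_classes F (carrier F - {\<one>})"
  defines "P \<equiv> support_partition F X R"
  shows "partition_on X P" "includes_supports F X R P"
    "\<And>Q. partition_on X Q \<Longrightarrow> includes_supports F X R Q \<Longrightarrow> refines X P Q"
proof -
  define \<Q> where "\<Q> = {Q. partition_on X Q \<and> includes_supports F X R Q}"
  \<comment> \<open>The partition with the single block \<open>X\<close> is admissible unless
    \<open>X\<close> is empty, since blocks must not be empty.\<close>
  have ne: "\<Q> \<noteq> {}"
  proof (cases "X = {}")
    case True
    then have "R = {}" using assms(1) support_nonempty support_subset by blast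
    then have "{} \<in> \<Q>" using True by (auto simp: \<Q>_def includes_supports_def partition_on_def)
    then show ?thesis by blast
  next
    case False
    then have "{X} \<in> \<Q>" using support_subset by (auto simp: \<Q>_def includes_supports_def partition_on_space)
    then show ?thesis by blast
  qed
  let ?P = "common_refinement \<Q>"
  have p: "partition_on X ?P" using ne by (intro partition_on_common_refinement) (auto simp: \<Q>_def)
  have inc: "includes_supports F X R ?P"
    unfolding includes_supports_def
  proof
    fix r assume r: "r \<in> R"
    have "\<forall>Q\<in>\<Q>. \<exists>Y\<in>Q. support F X r \<subseteq> Y" using r by (auto simp: \<Q>_def includes_supports_def)
    then obtain f where f: "\<forall>Q\<in>\<Q>. f Q \<in> Q \<and> support F X r \<subseteq> f Q" by metis
    then have s: "support F X r \<subseteq> \<Inter> (f ` \<Q>)" by blast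
    then have "\<Inter> (f ` \<Q>) \<noteq> {}" using support_nonempty[of r] r assms(1) by blast
    then have "\<Inter> (f ` \<Q>) \<in> ?P" using f unfolding common_refinement by blast
    with s show "\<exists>Y\<in>?P. support F X r \<subseteq> Y" by blast
  qed
  have ref: "refines X ?P Q" if "partition_on X Q" "includes_supports F X R Q" for Q
    using that by (intro refines_common_refinement) (auto simp: \<Q>_def)
  have "P = ?P"
    unfolding P_def support_partition_def
  proof (rule the_equality)
    show "partition_on X ?P \<and> includes_supports F X R ?P \<and>
      (\<forall>Q. partition_on X Q \<and> includes_supports F X R Q \<longrightarrow> refines X ?P Q)"
      using p inc ref by blast
    fix P' assume "partition_on X P' \<and> includes_supports F X R P' \<and>
      (\<forall>Q. partition_on X Q \<and> includes_supports F X R Q \<longrightarrow> refines X P' Q)"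
    then show "P' = ?P" using p inc ref refines_asym by metis
  qed
  then show "partition_on X P" "includes_supports F X R P"
    "\<And>Q. partition_on X Q \<Longrightarrow> includes_supports F X R Q \<Longrightarrow> refines X P Q"
    using p inc ref by auto
qed

text \<open>Replacing \<open>Y\<close> by two nonempty pieces would give an admissible partition
  that the finest one does not refine. This indecomposability turns statements about single supports
  into statements about whole parts.\<close>

lemma support_partition_split:
  assumes "R \<subseteq> elts_and_classes F (carrier F - {\<one>})" "Y \<in> support_partition F X R"
    and "Y = A \<union> B" "A \<inter> B = {}"
    and "\<And>r. r \<in> R \<Longrightarrow> support F X r \<subseteq> Y \<Longrightarrow> support F X r \<subseteq> A \<or> support F X r \<subseteq> B"
  shows "A = {} \<or> B = {}"
proof (rule ccontr)
  assume ne: "\<not> (A = {} \<or> B = {})"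
  note fin = support_partition_finest[OF assms(1)]
  let ?P = "support_partition F X R"
  define Q where "Q = insert A (insert B (?P - {Y}))"
  have d: "disjnt Y Z" if "Z \<in> ?P" "Z \<noteq> Y" for Z
    using fin(1) assms(2) that by (auto simp: partition_on_def pairwise_def)
  have "partition_on X Q"
  proof (rule partition_onI)
    have "\<Union> ?P = X" using fin(1) by (simp add: partition_on_def)
    then show "\<Union> Q = X" using assms(2,3) by (auto simp: Q_def)
    show "disjnt p q" if "p \<in> Q" "q \<in> Q" "p \<noteq> q" for p q
    proof -
      have dAB: "disjnt A B" "disjnt B A" using assms(4) by (auto simp: disjnt_def)
      have dZ: "disjnt A Z" "disjnt B Z" "disjnt Z A" "disjnt Z B" if "Z \<in> ?P" "Z \<noteq> Y" for Z
        using d[OF that] assms(3) by (auto simp: disjnt_def)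
      have dPP: "disjnt p q" if "p \<in> ?P" "q \<in> ?P" "p \<noteq> q" for p q
        using fin(1) that by (auto simp: partition_on_def pairwise_def)
      show ?thesis using that unfolding Q_def by (elim insertE DiffE) (simp_all add: dAB dZ dPP)
    qed
    show "{} \<notin> Q" using ne fin(1) by (auto simp: Q_def partition_on_def)
  qed
  moreover have "includes_supports F X R Q"
    using fin(2) assms(5) unfolding includes_supports_def Q_def by (metis Diff_iff insert_iff singletonD)
  ultimately have "refines X ?P Q" using fin(3) by blast
  then obtain Z where Z: "Z \<in> Q" "Y \<subseteq> Z" using assms(2) by (auto simp: refines_def)
  then show False using ne d[of Z] assms(3,4) unfolding Q_def disjnt_def by blast
qed

lemma support_part_disjoint:
  assumes "R \<subseteq> elts_and_classes F (carrier F - {\<one>})" "Y \<in> support_partition F X R"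
    "r \<in> R" "\<not> support F X r \<subseteq> Y"
  shows "support F X r \<inter> Y = {}"
proof -
  note fin = support_partition_finest[OF assms(1)]
  obtain Z where "Z \<in> support_partition F X R" "support F X r \<subseteq> Z"
    using fin(2) assms(3) by (auto simp: includes_supports_def)
  moreover from this have "disjnt Y Z"
    using fin(1) assms(2,4) by (auto simp: partition_on_def pairwise_def)
  ultimately show ?thesis by (auto simp: disjnt_def)
qed

lemma part_subset:
  assumes "R \<subseteq> elts_and_classes F (carrier F - {\<one>})" "Y \<in> support_partition F X R"
  shows "Y \<subseteq> X" "Y \<noteq> {}"
  using support_partition_finest(1)[OF assms(1)] assms(2) by (auto simp: partition_on_def)

end

subsection \<open>Whitehead moves\<close>

lemma (in group_hom) hom_word_prod:
  "set xs \<subseteq> carrier G \<Longrightarrow> h (word_prod G xs) = word_prod H (map h xs)"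
  by (induction xs) auto

context based_group begin

lemma endo_fixing_basis:
  assumes "h \<in> hom F F" "\<And>x. x \<in> X \<Longrightarrow> h x = x" "g \<in> carrier F"
  shows "h g = g"
proof -
  interpret h: group_hom F F h by unfold_locales (rule assms(1))
  obtain xs where xs: "set xs \<subseteq> L" "word_prod F xs = g" using word_exists[OF assms(3)] .
  have "h d = d" if "d \<in> L" for d using that assms(2) by (auto simp: pm_def)
  then have "map h xs = xs" using xs(1) by (intro map_idI) auto
  then show ?thesis using h.hom_word_prod[of xs] xs by simp
qed

lemma free_basis_image:
  assumes "\<theta> \<in> iso F F"
  shows "free_basis F (\<theta> ` X)"
proof -
  interpret h: group_hom F F \<theta> using assms by unfold_locales (auto simp: iso_def)
  have bij: "inj_on \<theta> (carrier F)" "\<theta> ` carrier F = carrier F" using assms by (auto simp: iso_iff)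
  let ?m = "\<lambda>(x, b :: bool). (\<theta> x, b)"
  have ev: "word_prod F (map (signed_letter F) (map ?m w)) = \<theta> (word_prod F (map (signed_letter F) w))"
    if "w \<in> lists (X \<times> UNIV)" for w
    using that
  proof (induction w)
    case (Cons a w)
    obtain x b where a: "a = (x, b)" by (cases a)
    have x: "x \<in> X" "w \<in> lists (X \<times> UNIV)" using Cons(1,2) a by auto
    have "set (map (signed_letter F) w) \<subseteq> carrier F" using x(2) by (auto simp: signed_letter_def)
    then show ?case using x Cons.IH by (simp add: a signed_letter_def)
  qed simp
  have lift: "\<exists>w\<in>lists (X \<times> UNIV). w' = map ?m w" if "w' \<in> lists (\<theta> ` X \<times> UNIV)" for w'
    using that
  proof (induction w')
    case (Cons a w')
    then obtain w where w: "w \<in> lists (X \<times> UNIV)" "w' = map ?m w" by auto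
    obtain x b where "x \<in> X" "a = (\<theta> x, b)" using Cons(1) by (cases a) auto
    then show ?case using w by (intro bexI[of _ "(x, b) # w"]) auto
  qed auto
  have B: "\<forall>g\<in>carrier F. \<exists>w\<in>lists (X \<times> UNIV). word_prod F (map (signed_letter F) w) = g"
    "\<And>u v. u \<in> lists (X \<times> UNIV) \<Longrightarrow> v \<in> lists (X \<times> UNIV) \<Longrightarrow>
       word_prod F (map (signed_letter F) u) = word_prod F (map (signed_letter F) v) \<Longrightarrow>
       (u, v) \<in> word_cong (X \<times> UNIV) (free_rels X)"
    using basis unfolding free_basis_iff[OF group_axioms] by blast+
  have evc: "word_prod F (map (signed_letter F) w) \<in> carrier F" if "w \<in> lists (X \<times> UNIV)" for w
    using that by (intro word_prod_closed) (auto simp: signed_letter_def)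
  show ?thesis
    unfolding free_basis_iff[OF group_axioms]
  proof (intro conjI ballI impI)
    show "\<theta> ` X \<subseteq> carrier F" by auto
    fix g assume "g \<in> carrier F"
    then obtain g' where g': "g' \<in> carrier F" "g = \<theta> g'" using bij(2) by blast
    then obtain w where w: "w \<in> lists (X \<times> UNIV)" "word_prod F (map (signed_letter F) w) = g'" using B(1) by blast
    then show "\<exists>w\<in>lists (\<theta> ` X \<times> UNIV). word_prod F (map (signed_letter F) w) = g"
      using ev[OF w(1)] g' by (intro bexI[of _ "map ?m w"]) auto
  next
    fix u' v' assume uv': "u' \<in> lists (\<theta> ` X \<times> UNIV)" "v' \<in> lists (\<theta> ` X \<times> UNIV)"
      and e: "word_prod F (map (signed_letter F) u') = word_prod F (map (signed_letter F) v')"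
    obtain u where u: "u \<in> lists (X \<times> UNIV)" "u' = map ?m u" using lift[OF uv'(1)] by blast
    obtain v where v: "v \<in> lists (X \<times> UNIV)" "v' = map ?m v" using lift[OF uv'(2)] by blast
    have "\<theta> (word_prod F (map (signed_letter F) u)) = \<theta> (word_prod F (map (signed_letter F) v))"
      using e u v ev by metis
    then have "word_prod F (map (signed_letter F) u) = word_prod F (map (signed_letter F) v)"
      using bij(1) evc u v by (meson inj_onD)
    then have c: "(u, v) \<in> word_cong (X \<times> UNIV) (free_rels X)" using B(2) u v by blast
    show "(u', v') \<in> word_cong (\<theta> ` X \<times> UNIV) (free_rels (\<theta> ` X))"
      unfolding u(2) v(2)
    proof (rule word_cong_map[OF _ _ c])
      fix l r assume "(l, r) \<in> free_rels X"
      then obtain x b where "l = [(x, b), (x, \<not> b)]" "r = []" "x \<in> X" by auto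
      then show "(map ?m l, map ?m r) \<in> word_cong (\<theta> ` X \<times> UNIV) (free_rels (\<theta> ` X))"
        by (intro word_cong_rel) auto
    qed auto
  qed
qed

text \<open>When \<open>\<chi>\<close> agrees on \<open>y\<close> and its inverse and takes two
  consecutive values, one of them 0, this is a Whitehead automorphism with multiplier
  \<open>y\<close> or its inverse. The formula commutes with inversion, so it may be applied to
  inverse letters as well.\<close>

definition wmove :: "'a \<Rightarrow> ('a \<Rightarrow> int) \<Rightarrow> 'a \<Rightarrow> 'a" where
  "wmove y \<chi> x = y [^] (- \<chi> x) \<otimes> x \<otimes> y [^] \<chi> (inv x)"

lemma wmove_closed [simp]: "y \<in> carrier F \<Longrightarrow> x \<in> carrier F \<Longrightarrow> wmove y \<chi> x \<in> carrier F"
  by (simp add: wmove_def)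

lemma wmove_inv:
  "y \<in> carrier F \<Longrightarrow> x \<in> carrier F \<Longrightarrow> wmove y \<chi> (inv x) = inv (wmove y \<chi> x)"
  by (simp add: wmove_def inv_mult_group m_assoc int_pow_neg)

lemma wmove_self:
  assumes "y \<in> carrier F" "\<chi> (inv y) = \<chi> y"
  shows "wmove y \<chi> y = y"
proof -
  have "wmove y \<chi> y = y [^] (- \<chi> y) \<otimes> y [^] (1::int) \<otimes> y [^] \<chi> y" using assms by (simp add: wmove_def)
  also have "\<dots> = y [^] (- \<chi> y + 1 + \<chi> y)" using assms by (simp only: int_pow_mult)
  finally show ?thesis using assms by simp
qed

lemma wmove_hom:
  assumes "y \<in> L" "\<chi> (inv y) = \<chi> y"
  obtains \<theta> where "\<theta> \<in> hom F F" "\<And>d. d \<in> L \<Longrightarrow> \<theta> d = wmove y \<chi> d"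
proof -
  obtain \<theta> where t: "\<theta> \<in> hom F F" "\<And>x. x \<in> X \<Longrightarrow> \<theta> x = wmove y \<chi> x"
    using free_basis_universal[OF group_axioms basis group_axioms, of "wmove y \<chi>"] assms by auto
  interpret h: group_hom F F \<theta> using t by unfold_locales
  have "\<theta> d = wmove y \<chi> d" if "d \<in> L" for d
    using that t(2) assms wmove_inv by (auto simp: pm_def)
  then show ?thesis using that t(1) by blast
qed

text \<open>The inverse is the move with \<open>- \<chi>\<close>: as both moves fix
  \<open>y\<close>, the inserted powers cancel. That the composites are the identity has to be
  checked on the basis only.\<close>

lemma wmove_iso:
  assumes "y \<in> L" "\<chi> (inv y) = \<chi> y"
  obtains \<theta> where "\<theta> \<in> iso F F" "\<And>d. d \<in> L \<Longrightarrow> \<theta> d = wmove y \<chi> d"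
proof -
  obtain \<theta> where t: "\<theta> \<in> hom F F" "\<And>d. d \<in> L \<Longrightarrow> \<theta> d = wmove y \<chi> d"
    using wmove_hom[OF assms] by blast
  obtain \<psi> where p: "\<psi> \<in> hom F F" "\<And>d. d \<in> L \<Longrightarrow> \<psi> d = wmove y (\<lambda>x. - \<chi> x) d"
    using wmove_hom[of y "\<lambda>x. - \<chi> x"] assms by auto
  interpret t: group_hom F F \<theta> using t by unfold_locales
  interpret p: group_hom F F \<psi> using p by unfold_locales
  have y: "\<theta> y = y" "\<psi> y = y" using t(2) p(2) wmove_self assms by auto
  have XL: "x \<in> L" if "x \<in> X" for x using that by (simp add: pm_def)
  have tp: "\<theta> (\<psi> x) = x" if "x \<in> X" for x
    using that assms XL[OF that] y p(2)[OF XL[OF that]] t(2)[OF XL[OF that]]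
    by (simp add: wmove_def t.hom_int_pow m_assoc int_pow_neg)
  have pt: "\<psi> (\<theta> x) = x" if "x \<in> X" for x
    using that assms XL[OF that] y p(2)[OF XL[OF that]] t(2)[OF XL[OF that]]
    by (simp add: wmove_def p.hom_int_pow m_assoc int_pow_neg)
  have 1: "\<theta> (\<psi> g) = g" if "g \<in> carrier F" for g
    using endo_fixing_basis[of "\<theta> \<circ> \<psi>" g] Group.hom_compose[OF p(1) t(1)] tp that by simp
  have 2: "\<psi> (\<theta> g) = g" if "g \<in> carrier F" for g
    using endo_fixing_basis[of "\<psi> \<circ> \<theta>" g] Group.hom_compose[OF t(1) p(1)] pt that by simp
  have "bij_betw \<theta> (carrier F) (carrier F)"
    by (rule bij_betw_byWitness[where f' = \<psi>]) (use 1 2 in auto)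
  then have "\<theta> \<in> iso F F" using t(1) by (simp add: iso_def)
  then show ?thesis using that t(2) by blast
qed

end

text \<open>The letter \<open>x\<close> of a word, preceded by \<open>p\<close> and followed by \<open>q\<close>, absorbs the powers of \<open>y\<close> that the
  two adjacent turns produce when the word is rewritten in the new basis.\<close>

definition (in group) lturn :: "'a \<Rightarrow> 'a set \<Rightarrow> 'a \<Rightarrow> 'a \<Rightarrow> 'a" where
  "lturn y Y d e = (if d = y \<and> e \<in> Y then y else \<one>)"

definition (in group) rturn :: "'a \<Rightarrow> 'a set \<Rightarrow> 'a \<Rightarrow> 'a \<Rightarrow> 'a" where
  "rturn y Y d e = (if e = y \<and> d \<in> Y then inv y else \<one>)"

fun (in group) rewritten :: "'a \<Rightarrow> 'a set \<Rightarrow> ('a \<Rightarrow> 'a) \<Rightarrow> 'a \<Rightarrow> 'a list \<Rightarrow> 'a \<Rightarrow> 'a list" where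
  "rewritten y Y \<theta> p [] q = []"
| "rewritten y Y \<theta> p (x # xs) q =
     (rturn y Y (inv p) x \<otimes> \<theta> x \<otimes> lturn y Y (inv x) (hd (xs @ [q]))) # rewritten y Y \<theta> x xs q"

lemma (in group) length_rewritten [simp]: "length (rewritten y Y \<theta> p xs q) = length xs"
  by (induction xs arbitrary: p) auto

lemma (in group) rewritten_nth:
  assumes "j < length xs"
  shows "rewritten y Y \<theta> p xs q ! j =
    rturn y Y (inv ((p # xs) ! j)) (xs ! j) \<otimes> \<theta> (xs ! j) \<otimes> lturn y Y (inv (xs ! j)) ((xs @ [q]) ! Suc j)"
  using assms
proof (induction xs arbitrary: p j)
  case (Cons x xs)
  show ?case
  proof (cases j)
    case 0
    then show ?thesis by (cases xs) auto
  next
    case (Suc i)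
    then show ?thesis using Cons by simp
  qed
qed simp

text \<open>\<open>E\<close> stands for any set of turns compatible with the separation, so that the
  estimates apply to every \<open>r\<close> whose turns lie in \<open>E\<close>. The automorphism
  acts on all of \<open>F\<close>, although the choice is made for one part.\<close>

locale whitehead_move = based_group +
  fixes E :: "('a \<times> 'a) set" and y :: 'a and Ym Yp :: "'a set" and l :: int and \<chi> :: "'a \<Rightarrow> int" and \<theta>
  assumes yL: "y \<in> L" and yYm: "inv y \<in> Ym" and y_notin: "y \<notin> Ym" "y \<notin> Yp" and disj: "Ym \<inter> Yp = {}"
    and chi_y: "\<chi> y = l" and chi_m: "\<And>d. d \<in> Ym \<Longrightarrow> \<chi> d = l" and chi_p: "\<And>d. d \<in> Yp \<Longrightarrow> \<chi> d = l + 1"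
    and chi_one: "\<chi> \<one> = 0"
    and sep: "\<And>d e. (d, e) \<in> E \<Longrightarrow> d \<noteq> e \<and> {d, e} \<subseteq> insert y (Ym \<union> Yp) \<and> \<not> (d \<in> Ym \<and> e \<in> Yp) \<and> \<not> (d \<in> Yp \<and> e \<in> Ym)"
    and theta: "\<theta> \<in> iso F F" "\<And>d. d \<in> L \<Longrightarrow> \<theta> d = wmove y \<chi> d"
begin

lemma y_carrier [simp]: "y \<in> carrier F" using yL by simp

lemma lturn_closed [simp]: "lturn y Yp d e \<in> carrier F"
  by (simp add: lturn_def)

lemma rturn_closed [simp]: "rturn y Yp d e \<in> carrier F"
  by (simp add: rturn_def)

text \<open>Along an edge the exponents \<open>\<chi> d\<close> and \<open>\<chi> e\<close> agree
  unless the edge joins \<open>y\<close> to \<open>Yp\<close>. Then they differ by one, and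
  \<open>lturn\<close> or \<open>rturn\<close> supplies the compensating letter.\<close>

lemma join:
  assumes "(d, e) \<in> E"
  shows "y [^] \<chi> d \<otimes> lturn y Yp d e \<otimes> rturn y Yp d e \<otimes> y [^] (- \<chi> e) = \<one>"
proof -
  have s: "y [^] (l + 1) = y [^] l \<otimes> y" "y [^] (- (l + 1)) = inv y \<otimes> y [^] (- l)" 
    using int_pow_mult[of y l 1] int_pow_mult[of y "-1" "-l"] int_pow_neg[of y 1] by (simp_all add: add.commute)
  have t: "y [^] l \<otimes> y [^] (- l) = \<one>" using int_pow_mult[of y l "- l"] by simp
  have u: "y [^] (l + 1) \<otimes> y [^] (- (l + 1)) = \<one>" using int_pow_mult[of y "l + 1" "- (l + 1)"] by simp
  consider "d = y" "e \<in> Ym" | "d = y" "e \<in> Yp" | "d \<in> Yp" "e = y" | "d \<in> Yp" "e \<in> Yp"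
    | "d \<in> Ym" "e = y" | "d \<in> Ym" "e \<in> Ym" using sep[OF assms] by blast
  then show ?thesis
  proof cases
    case 1
    then have "e \<noteq> y" "e \<notin> Yp" using y_notin disj by auto
    then show ?thesis using 1 t by (simp add: lturn_def rturn_def chi_y chi_m)
  next
    case 2
    then have "e \<noteq> y" using y_notin by auto
    have "y [^] l \<otimes> y \<otimes> \<one> \<otimes> y [^] (- (l + 1)) = \<one>" using u s(1) by simp
    then show ?thesis using 2 \<open>e \<noteq> y\<close> by (simp add: lturn_def rturn_def chi_y chi_p)
  next
    case 3
    then have "d \<noteq> y" using y_notin by auto
    have "y [^] (l + 1) \<otimes> \<one> \<otimes> inv y \<otimes> y [^] (- l) = \<one>" using u s(2) by (simp add: m_assoc)
    then show ?thesis using 3 \<open>d \<noteq> y\<close> by (simp add: lturn_def rturn_def chi_y chi_p)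
  next
    case 4
    then have "d \<noteq> y" "e \<noteq> y" using y_notin by auto
    then show ?thesis using 4 u by (simp add: lturn_def rturn_def chi_p)
  next
    case 5
    then have "d \<noteq> y" "d \<notin> Yp" using y_notin disj by auto
    then show ?thesis using 5 t by (simp add: lturn_def rturn_def chi_y chi_m)
  next
    case 6
    then have "d \<noteq> y" "e \<noteq> y" using y_notin by auto
    then show ?thesis using 6 t by (simp add: lturn_def rturn_def chi_m)
  qed
qed

text \<open>A telescoping product: what two neighbouring letters contribute at the turn between them
  cancels by \<open>join\<close>, and only the contributions at the two ends remain.\<close>

lemma rewritten_prod:
  assumes "xs \<noteq> []" "set xs \<subseteq> L" "\<And>i. Suc i < length xs \<Longrightarrow> (inv (xs ! i), xs ! Suc i) \<in> E"
  shows "word_prod F (rewritten y Yp \<theta> p xs q) =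
    rturn y Yp (inv p) (hd xs) \<otimes> y [^] (- \<chi> (hd xs)) \<otimes> word_prod F xs \<otimes>
    (y [^] \<chi> (inv (last xs)) \<otimes> lturn y Yp (inv (last xs)) q)"
  using assms
proof (induction xs arbitrary: p)
  case (Cons x xs)
  have x: "x \<in> L" "set xs \<subseteq> L" using Cons.prems by auto
  show ?case
  proof (cases xs)
    case Nil
    then show ?thesis using x theta(2)[OF x(1)] by (simp add: wmove_def m_assoc)
  next
    case (Cons z zs)
    have "xs \<noteq> []" using Cons by simp
    have E: "(inv x, z) \<in> E" using Cons.prems(3)[of 0] Cons by simp
    have IH: "word_prod F (rewritten y Yp \<theta> x xs q) =
      rturn y Yp (inv x) (hd xs) \<otimes> y [^] (- \<chi> (hd xs)) \<otimes> word_prod F xs \<otimes>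
      (y [^] \<chi> (inv (last xs)) \<otimes> lturn y Yp (inv (last xs)) q)"
      using Cons.IH[OF \<open>xs \<noteq> []\<close> x(2)] Cons.prems(3)[of "Suc _"] by simp
    have hd: "hd (xs @ [q]) = z" "hd xs = z" using Cons by auto
    define B where "B = word_prod F xs"
    define C where "C = y [^] \<chi> (inv (last xs)) \<otimes> lturn y Yp (inv (last xs)) q"
    define J1 J2 J3 J4 where "J1 = y [^] \<chi> (inv x)" and "J2 = lturn y Yp (inv x) z"
      and "J3 = rturn y Yp (inv x) z" and "J4 = y [^] (- \<chi> z)"
    have [simp]: "B \<in> carrier F" "C \<in> carrier F" using x by (simp_all add: B_def C_def)
    have Jc [simp]: "J1 \<in> carrier F" "J2 \<in> carrier F" "J3 \<in> carrier F" "J4 \<in> carrier F"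
      by (simp_all add: J1_def J2_def J3_def J4_def)
    have J: "J1 \<otimes> J2 \<otimes> J3 \<otimes> J4 = \<one>" using join[OF E] by (simp add: J1_def J2_def J3_def J4_def)
    have J': "J1 \<otimes> (J2 \<otimes> (J3 \<otimes> (J4 \<otimes> w))) = w" if "w \<in> carrier F" for w
    proof -
      have "J1 \<otimes> (J2 \<otimes> (J3 \<otimes> (J4 \<otimes> w))) = J1 \<otimes> J2 \<otimes> J3 \<otimes> J4 \<otimes> w" using that by (simp add: m_assoc)
      then show ?thesis using J that by simp
    qed
    have th: "\<theta> x = y [^] (- \<chi> x) \<otimes> x \<otimes> J1" using theta(2)[OF x(1)] by (simp add: wmove_def J1_def)
    have "word_prod F (rewritten y Yp \<theta> p (x # xs) q) =
      rturn y Yp (inv p) x \<otimes> (y [^] (- \<chi> x) \<otimes> x \<otimes> J1) \<otimes> J2 \<otimes> (J3 \<otimes> J4 \<otimes> B \<otimes> C)"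
      using IH by (simp add: th hd J1_def[symmetric] J2_def[symmetric] J3_def[symmetric] J4_def[symmetric] B_def[symmetric] C_def[symmetric])
    also have "\<dots> = rturn y Yp (inv p) x \<otimes> (y [^] (- \<chi> x) \<otimes> (x \<otimes> (J1 \<otimes> (J2 \<otimes> (J3 \<otimes> (J4 \<otimes> (B \<otimes> C)))))))"
      using x(1) by (simp add: m_assoc)
    also have "\<dots> = rturn y Yp (inv p) x \<otimes> y [^] (- \<chi> x) \<otimes> (x \<otimes> B) \<otimes> C"
      using x(1) by (simp add: J' m_assoc)
    finally show ?thesis using Cons by (simp add: B_def C_def)
  qed
qed simp

lemma theta_y: "\<theta> y = y" "\<theta> (inv y) = inv y"
proof -
  have "\<chi> (inv y) = \<chi> y" using chi_y chi_m[OF yYm] by simp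
  then show "\<theta> y = y" using theta(2)[OF yL] wmove_self by simp
  then show "\<theta> (inv y) = inv y" using theta(2)[of "inv y"] theta(2)[OF yL] wmove_inv yL by simp
qed

text \<open>Only \<open>y\<close> and its inverse can absorb anything, and what they absorb is their
  own inverse. So no turn creates a letter.\<close>

lemma rewritten_letter:
  assumes "x \<in> L"
  shows "rturn y Yp d x \<otimes> \<theta> x \<otimes> lturn y Yp (inv x) e \<in> {\<one>, \<theta> x}"
proof -
  have c: "\<theta> x \<in> carrier F" using theta assms by simp
  have n: "inv y \<noteq> y" using inv_neq_L[OF yL] .
  consider "x = y" | "x = inv y" | "x \<noteq> y" "inv x \<noteq> y" using assms by (metis L_carrier' inv_inv)
  then show ?thesis
  proof cases
    case 1 then show ?thesis using n theta_y by (auto simp: lturn_def rturn_def)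
  next
    case 2 then show ?thesis using n theta_y by (auto simp: lturn_def rturn_def)
  next
    case 3 then show ?thesis using c by (auto simp: lturn_def rturn_def)
  qed
qed

lemma rewritten_letters:
  assumes "set xs \<subseteq> L"
  shows "set (rewritten y Yp \<theta> p xs q) \<subseteq> insert \<one> (\<theta> ` set xs)"
proof
  fix z assume "z \<in> set (rewritten y Yp \<theta> p xs q)"
  then obtain j where j: "j < length xs" "z = rewritten y Yp \<theta> p xs q ! j" by (auto simp: in_set_conv_nth)
  then have "xs ! j \<in> set xs" "xs ! j \<in> L" using assms by auto
  then have "z \<in> {\<one>, \<theta> (xs ! j)}"
    using rewritten_letter unfolding j(2) rewritten_nth[OF j(1)] by blast
  then show "z \<in> insert \<one> (\<theta> ` set xs)" using \<open>xs ! j \<in> set xs\<close> by auto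
qed

lemma rewritten_cancels:
  assumes "j < length xs"
    and "xs ! j = inv y \<and> (xs @ [q]) ! Suc j \<in> Yp \<or> xs ! j = y \<and> inv ((p # xs) ! j) \<in> Yp"
  shows "\<one> \<in> set (rewritten y Yp \<theta> p xs q)"
proof -
  have n: "inv y \<noteq> y" using inv_neq_L[OF yL] .
  have "rewritten y Yp \<theta> p xs q ! j = \<one>"
    unfolding rewritten_nth[OF assms(1)] using assms(2)
  proof
    assume "xs ! j = inv y \<and> (xs @ [q]) ! Suc j \<in> Yp"
    then show "rturn y Yp (inv ((p # xs) ! j)) (xs ! j) \<otimes> \<theta> (xs ! j) \<otimes> lturn y Yp (inv (xs ! j)) ((xs @ [q]) ! Suc j) = \<one>"
      using n theta_y by (simp add: lturn_def rturn_def)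
  next
    assume "xs ! j = y \<and> inv ((p # xs) ! j) \<in> Yp"
    then show "rturn y Yp (inv ((p # xs) ! j)) (xs ! j) \<otimes> \<theta> (xs ! j) \<otimes> lturn y Yp (inv (xs ! j)) ((xs @ [q]) ! Suc j) = \<one>"
      using n theta_y by (simp add: lturn_def rturn_def)
  qed
  then show ?thesis using assms(1) by (metis length_rewritten nth_mem)
qed

lemma word_prod_filter:
  "set zs \<subseteq> carrier F \<Longrightarrow> word_prod F (filter (\<lambda>z. z \<noteq> \<one>) zs) = word_prod F zs"
  by (induction zs) auto

lemma pm_theta: "\<theta> ` L = pm F (\<theta> ` X)"
proof -
  interpret h: group_hom F F \<theta> using theta by unfold_locales (simp add: iso_def)
  show ?thesis by (auto simp: pm_def image_Un image_image cong: image_cong)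
qed

text \<open>Rewrite a normal word over \<open>X\<close> and delete the trivial letters: the result
  is a word for \<open>r\<close> over the image basis, and at least one letter is deleted if a turn
  joins \<open>y\<close> to \<open>Yp\<close>.\<close>

lemma word_length_move:
  assumes r: "nontriv r" "turns F X r \<subseteq> E"
  shows "word_length F (\<theta> ` X) r \<le> word_length F X r"
    and "(\<exists>d\<in>Yp. (d, y) \<in> turns F X r \<or> (y, d) \<in> turns F X r) \<Longrightarrow>
      word_length F (\<theta> ` X) r < word_length F X r"
proof -
  have main: "\<exists>zs. set zs \<subseteq> pm F (\<theta> ` X) \<and> represents F zs r \<and> length zs \<le> length xs \<and>
      ((\<exists>d\<in>Yp. \<exists>i\<le>length xs. (inv (extended F r xs ! i), extended F r xs ! Suc i) \<in> {(d, y), (y, d)}) \<longrightarrow>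
        length zs < length xs)"
    if n: "normal_word F X r xs" for xs
  proof -
    obtain p q where pq: "extended F r xs = p # xs @ [q]" by (cases r) auto
    have xs: "xs \<noteq> []" "set xs \<subseteq> L" using n by (auto simp: normal_word_iff)
    have tE: "(inv (extended F r xs ! i), extended F r xs ! Suc i) \<in> E" if "i \<le> length xs" for i
      using n that r(2) unfolding turns_iff[symmetric] by (auto simp: turns_def)
    define zs where "zs = rewritten y Yp \<theta> p xs q"
    have int: "(inv (xs ! i), xs ! Suc i) \<in> E" if "Suc i < length xs" for i
      using tE[of "Suc i"] that by (simp add: extended_Suc)
    have first: "(inv p, hd xs) \<in> E" using tE[of 0] pq xs by (simp add: hd_conv_nth nth_append)
    have last: "(inv (last xs), q) \<in> E"
      using tE[of "length xs"] pq xs by (simp add: last_conv_nth nth_append nth_Cons')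
    define A where "A = rturn y Yp (inv p) (hd xs) \<otimes> y [^] (- \<chi> (hd xs))"
    define B where "B = y [^] \<chi> (inv (last xs)) \<otimes> lturn y Yp (inv (last xs)) q"
    have AB: "A \<in> carrier F" "B \<in> carrier F" by (simp_all add: A_def B_def)
    have prod: "word_prod F zs = A \<otimes> word_prod F xs \<otimes> B"
      unfolding zs_def A_def B_def by (rule rewritten_prod[OF xs int])
    have zc: "set zs \<subseteq> insert \<one> (\<theta> ` L)" using rewritten_letters[OF xs(2), of p q] xs(2) unfolding zs_def by auto
    have pc: "pm F (\<theta> ` X) \<subseteq> carrier F" using pm_closed[of "\<theta> ` X"] theta(1) X_carrier by (auto simp: iso_iff)
    have zc': "set zs \<subseteq> carrier F" using zc pc pm_theta by auto
    \<comment> \<open>The end factors are trivial for an element because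
      \<open>\<chi> \<one> = 0\<close>. For a class the two ends meet in the cyclic turn, so
      together they conjugate.\<close>
    have rep: "represents F zs r" using r(1)
    proof (cases rule: nontriv_cases)
      case (Elt g)
      then have p: "p = \<one>" "q = \<one>" using pq by auto
      have yn: "\<one> \<noteq> y" using yL one_notin_L by auto
      have "A = \<one>" using join[OF first] yn unfolding A_def p by (simp add: lturn_def chi_one)
      moreover have "B = \<one>" using join[OF last] yn unfolding B_def p by (simp add: rturn_def chi_one)
      ultimately show ?thesis using prod xs n Elt by (simp add: normal_word_iff)
    next
      case (Cls g)
      then have p: "p = last xs" "q = hd xs" using pq by auto
      have "B \<otimes> A = \<one>" using join[OF first] unfolding A_def B_def p by (simp add: m_assoc)
      then have A: "A = inv B" using AB by (metis inv_equality inv_inv r_inv inv_comm)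
      have "word_prod F zs = inv B \<otimes> word_prod F xs \<otimes> inv (inv B)" using prod A AB by simp
      then show ?thesis using conj_class_conj[of "word_prod F xs" g "inv B"] Cls n AB by (simp add: normal_word_iff)
    qed
    let ?zs = "filter (\<lambda>z. z \<noteq> \<one>) zs"
    have "set ?zs \<subseteq> pm F (\<theta> ` X)" using zc pm_theta by auto
    moreover have "represents F ?zs r" using rep word_prod_filter[OF zc'] by (cases r) auto
    moreover have "length ?zs \<le> length xs" by (metis length_filter_le length_rewritten zs_def)
    moreover have "length ?zs < length xs"
      if d: "d \<in> Yp" and i: "i \<le> length xs" and t: "(inv (extended F r xs ! i), extended F r xs ! Suc i) \<in> {(d, y), (y, d)}" for d i
    proof -
      have yn: "y \<noteq> \<one>" using yL one_notin_L by auto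
      have ec: "extended F r xs ! k \<in> carrier F" if "k < Suc (Suc (length xs))" for k
        using extended_letters[OF n that] xs(2) by auto
      \<comment> \<open>Either the letter after the turn is \<open>y\<close>, or the letter before
        it is the inverse of \<open>y\<close>. For a class the ends continue cyclically; for an
        element the end value \<open>\<one>\<close> is excluded because it is not a letter.\<close>
      have "\<exists>j<length xs. xs ! j = inv y \<and> (xs @ [q]) ! Suc j \<in> Yp \<or> xs ! j = y \<and> inv ((p # xs) ! j) \<in> Yp"
      proof (cases "extended F r xs ! Suc i = y")
        case True
        then have dY: "inv (extended F r xs ! i) \<in> Yp" using t d y_notin by auto
        show ?thesis
        proof (cases "i < length xs")
          case True
          then have "xs ! i = y" "(p # xs) ! i = extended F r xs ! i"
            using \<open>extended F r xs ! Suc i = y\<close> unfolding pq by (auto simp: nth_append nth_Cons' split: if_splits)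
          then show ?thesis using True dY by auto
        next
          case False
          then have il: "i = length xs" using i by simp
          then have q: "q = y" using \<open>extended F r xs ! Suc i = y\<close> pq by (simp add: nth_append)
          then obtain C where "r = Cls C" using pq yn by (cases r) auto
          then have "p = last xs" "q = hd xs" using pq by auto
          moreover have "extended F r xs ! i = last xs" using il pq xs by (simp add: nth_append nth_Cons' last_conv_nth)
          ultimately show ?thesis using q dY xs by (intro exI[of _ 0]) (auto simp: hd_conv_nth)
        qed
      next
        case False
        then have 1: "inv (extended F r xs ! i) = y" "extended F r xs ! Suc i \<in> Yp" using t d by auto
        then have e: "extended F r xs ! i = inv y" using ec[of i] i by auto
        show ?thesis
        proof (cases i)
          case 0
          then have p: "p = inv y" using e pq by simp
          have "inv y \<noteq> \<one>" using inv_L[OF yL] one_notin_L by auto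
          with p have "p \<noteq> \<one>" by argo
          then obtain C where "r = Cls C" using pq by (cases r) auto
          then have "p = last xs" "q = hd xs" using pq by auto
          moreover have "hd xs \<in> Yp" using 1(2) 0 pq xs by (simp add: hd_conv_nth nth_append)
          ultimately show ?thesis using p xs
            by (intro exI[of _ "length xs - 1"]) (auto simp: last_conv_nth nth_append)
        next
          case (Suc j)
          then have "xs ! j = inv y" "(xs @ [q]) ! Suc j \<in> Yp" "j < length xs"
            using e 1(2) i unfolding pq by (auto simp: nth_append split: if_splits)
          then show ?thesis by blast
        qed
      qed
      then have "\<one> \<in> set zs" using rewritten_cancels unfolding zs_def by blast
      then have "length ?zs < length zs" by (intro length_filter_less) auto
      then show ?thesis by (simp add: zs_def)
    qed
    ultimately show ?thesis by blast
  qed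
  have le: "word_length F (\<theta> ` X) r \<le> length zs" if "set zs \<subseteq> pm F (\<theta> ` X)" "represents F zs r" for zs
    using that by (rule word_length_le)
  obtain xs where "normal_word F X r xs" using normal_word_exists[OF r(1)] .
  then show "word_length F (\<theta> ` X) r \<le> word_length F X r"
    using main le normal_word_length[OF r(1)] by (metis le_trans)
  assume "\<exists>d\<in>Yp. (d, y) \<in> turns F X r \<or> (y, d) \<in> turns F X r"
  then obtain d ys i where "d \<in> Yp" "normal_word F X r ys" "i \<le> length ys"
    "(inv (extended F r ys ! i), extended F r ys ! Suc i) \<in> {(d, y), (y, d)}"
    unfolding turns_iff by auto
  then show "word_length F (\<theta> ` X) r < word_length F X r"
    using main[of ys] le normal_word_length[OF r(1)] by (metis le_less_trans)
qed

end

section \<open>One step of the algorithm: decrease of length and existence of a choice\<close>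

context based_group begin

lemma subroutine_step:
  assumes R: "R \<subseteq> elts_and_classes F (carrier F - {\<one>})"
    and Y: "Y \<in> support_partition F X R" and sub: "subroutine F Y (restricted F R Y X) Y'"
  shows "free_basis F ((X - Y) \<union> Y')"
    and "\<And>r. r \<in> R \<Longrightarrow> word_length F ((X - Y) \<union> Y') r \<le> word_length F X r"
    and "\<exists>r\<in>R. word_length F ((X - Y) \<union> Y') r < word_length F X r"
proof -
  note YX = part_subset(1)[OF R Y]
  define E where "E = part_turns R Y"
  obtain y Ym Yp and l :: int and \<chi> :: "'a \<Rightarrow> int" where
    y: "y \<in> pm F Y" and sep: "separated (fst ` E \<union> snd ` E, E) y Ym Yp" and inv_y: "inv y \<in> Ym"
    and edge: "\<exists>e\<in>E. meets e Yp \<and> meets e {y}"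
    and chi0: "\<chi> \<one> = 0" "\<forall>x\<in>Ym \<union> {y}. \<chi> x = l" "\<forall>x\<in>Yp. \<chi> x = l + 1"
    and Y': "Y' = {(y [^] (- \<chi> x)) \<otimes> x \<otimes> (y [^] \<chi> (inv x)) | x. x \<in> Y}"
    using sub unfolding subroutine_def whitehead_graph_restricted[OF YX] E_def[symmetric] snd_conv
    by (elim bexE exE conjE) (rule that; (assumption | blast))
  have chi: "\<chi> \<one> = 0" "\<And>x. x \<in> Ym \<union> {y} \<Longrightarrow> \<chi> x = l" "\<And>x. x \<in> Yp \<Longrightarrow> \<chi> x = l + 1"
    using chi0 by auto
  have yL: "y \<in> L" using y pm_L[OF YX] by auto
  \<comment> \<open>Exponent 0 outside the part makes the move an automorphism of all of
    \<open>F\<close> that fixes the letters of the other parts, so any \<open>r\<close> with support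
    elsewhere keeps its words.\<close>
  define \<chi>' where "\<chi>' d = (if d \<in> pm F Y then \<chi> d else 0)" for d
  have Ysub: "Y \<subseteq> carrier F" using YX X_carrier by auto
  have one: "\<one> \<notin> pm F Y" using one_notin_L pm_L[OF YX] by auto
  have VE: "Ym \<union> Yp = fst ` E \<union> snd ` E - {y}" "Ym \<inter> Yp = {}"
    using sep by (auto simp: separated_def)
  have Epm: "fst ` E \<union> snd ` E \<subseteq> insert \<one> (pm F Y)"
    unfolding E_def part_turns_def using turns_letters[OF _ _ YX] by (fastforce simp: pm0_def)
  have chi': "\<chi>' d = \<chi> d" if "d \<in> insert \<one> (pm F Y)" for d
    using that chi(1) one by (auto simp: \<chi>'_def)
  have chi_y: "\<chi>' (inv y) = \<chi>' y"
    using chi'[of y] chi'[of "inv y"] chi(2)[of y] chi(2)[of "inv y"] y inv_y inv_in_pm[OF Ysub y] by simp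
  obtain \<theta> where \<theta>: "\<theta> \<in> iso F F" "\<And>d. d \<in> L \<Longrightarrow> \<theta> d = wmove y \<chi>' d"
    using wmove_iso[OF yL chi_y] by blast
  interpret whitehead_move F X E y Ym Yp l \<chi>' \<theta>
  proof unfold_locales
    show "y \<notin> Ym" "y \<notin> Yp" using VE by auto
    show "\<chi>' y = l" using chi' chi(2) y by simp
    have Vd: "d \<in> insert \<one> (pm F Y)" if "d \<in> Ym \<union> Yp" for d using that VE(1) Epm by blast
    show "\<chi>' d = l" if "d \<in> Ym" for d using chi'[OF Vd, of d] chi(2)[of d] that by simp
    show "\<chi>' d = l + 1" if "d \<in> Yp" for d using chi'[OF Vd, of d] chi(3)[of d] that by simp
    show "\<chi>' \<one> = 0" using chi' chi by simp
    fix d e assume de: "(d, e) \<in> E"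
    have "d \<noteq> e" using de turns_neq by (auto simp: E_def part_turns_def)
    moreover have "d \<in> fst ` E" "e \<in> snd ` E" using de by force+
    then have "{d, e} \<subseteq> insert y (Ym \<union> Yp)" unfolding VE by auto
    moreover have "\<not> (meets (d, e) Ym \<and> meets (d, e) Yp)" using sep de by (auto simp: separated_def)
    ultimately show "d \<noteq> e \<and> {d, e} \<subseteq> insert y (Ym \<union> Yp) \<and> \<not> (d \<in> Ym \<and> e \<in> Yp) \<and> \<not> (d \<in> Yp \<and> e \<in> Ym)"
      by (auto simp: meets_def)
  qed (use yL inv_y VE \<theta> in auto)
  have tY: "\<theta> x = (y [^] (- \<chi> x)) \<otimes> x \<otimes> (y [^] \<chi> (inv x))" if "x \<in> Y" for x
  proof -
    have "x \<in> pm F Y" "inv x \<in> pm F Y" using that by (auto simp: pm_def)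
    moreover have "x \<in> L" using that YX by (auto simp: pm_def)
    ultimately show ?thesis using \<theta>(2) by (simp add: wmove_def \<chi>'_def)
  qed
  have tX: "\<theta> x = x" if "x \<in> X - Y" for x
  proof -
    have x: "x \<in> L" "x \<notin> pm F Y" using that pm_inter_X[OF YX] by (auto simp: pm_def)
    then have "inv x \<notin> pm F Y" using inv_in_pm[OF Ysub, of "inv x"] by auto
    then show ?thesis using \<theta>(2) x by (simp add: wmove_def \<chi>'_def)
  qed
  have X': "(X - Y) \<union> Y' = \<theta> ` X"
  proof -
    have "\<theta> ` X = \<theta> ` (X - Y) \<union> \<theta> ` Y" using YX by auto
    also have "\<theta> ` (X - Y) = X - Y" using tX by simp
    also have "\<theta> ` Y = Y'" unfolding Y' using tY by (auto simp: image_def)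
    finally show ?thesis by simp
  qed
  show "free_basis F ((X - Y) \<union> Y')" unfolding X' using free_basis_image \<theta>(1) by blast
  have inE: "turns F X r \<subseteq> E" if "r \<in> R" "support F X r \<subseteq> Y" for r
    using that by (auto simp: E_def part_turns_def)
  show "word_length F ((X - Y) \<union> Y') r \<le> word_length F X r" if r: "r \<in> R" for r
  proof (cases "support F X r \<subseteq> Y")
    case True
    then show ?thesis unfolding X' using word_length_move(1)[of r] r R inE by auto
  next
    case False
    obtain xs where xs: "normal_word F X r xs" using normal_word_exists r R by blast
    have "support F X r \<subseteq> X - Y"
      using support_part_disjoint[OF R Y r False] support_subset[of r] by blast
    then have "pm F (support F X r) \<subseteq> pm F ((X - Y) \<union> Y')" by (intro pm_mono) auto
    then have "set xs \<subseteq> pm F ((X - Y) \<union> Y')" using normal_word_letters[OF xs] by blast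
    then have "word_length F ((X - Y) \<union> Y') r \<le> length xs"
      using xs by (intro word_length_le) (auto simp: normal_word_iff)
    then show ?thesis using normal_word_length xs r R by auto
  qed
  obtain d e where de: "(d, e) \<in> E" "meets (d, e) Yp" "meets (d, e) {y}" using edge by auto
  then obtain r where r: "r \<in> R" "support F X r \<subseteq> Y" "(d, e) \<in> turns F X r"
    by (auto simp: E_def part_turns_def)
  have "d \<noteq> e" using r turns_neq by blast
  then have "(d \<in> Yp \<and> e = y) \<or> (d = y \<and> e \<in> Yp)" using de VE by (auto simp: meets_def)
  then have "\<exists>d\<in>Yp. (d, y) \<in> turns F X r \<or> (y, d) \<in> turns F X r" using r(3) by blast
  then have "word_length F (\<theta> ` X) r < word_length F X r"
    using word_length_move(2)[of r] r R inE by blast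
  then show "\<exists>r\<in>R. word_length F ((X - Y) \<union> Y') r < word_length F X r" unfolding X' using r(1) by blast
qed

lemma kill_letters:
  assumes "A \<subseteq> X"
  obtains \<rho> where "\<rho> \<in> hom F F" "\<And>x. x \<in> pm F A \<Longrightarrow> \<rho> x = \<one>" "\<And>x. x \<in> pm F (X - A) \<Longrightarrow> \<rho> x = x"
proof -
  have "(if x \<in> A then \<one> else x) \<in> carrier F" if "x \<in> X" for x using that by simp
  then obtain \<rho> where r: "\<rho> \<in> hom F F" "\<And>x. x \<in> X \<Longrightarrow> \<rho> x = (if x \<in> A then \<one> else x)"
    using free_basis_universal[OF group_axioms basis group_axioms, of "\<lambda>x. if x \<in> A then \<one> else x"] by blast
  interpret group_hom F F \<rho> using r(1) by unfold_locales
  show ?thesis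
  proof (rule that[OF r(1)])
    show "\<rho> x = \<one>" if "x \<in> pm F A" for x using that r(2) assms by (auto simp: pm_def subset_iff)
    show "\<rho> x = x" if "x \<in> pm F (X - A)" for x using that r(2) by (auto simp: pm_def)
  qed
qed

text \<open>Killing the letters of \<open>A\<close> sends one word to \<open>\<one>\<close> and
  fixes the other, although both represent \<open>r\<close>. This controls \<open>support\<close>,
  which is a union over all normal words.\<close>

lemma normal_words_same_side:
  assumes "nontriv r" "normal_word F X r xs" "normal_word F X r ys"
    and "A \<subseteq> X" "set xs \<subseteq> pm F A" "set ys \<subseteq> pm F (X - A)"
  shows False
proof -
  obtain \<rho> where \<rho>: "\<rho> \<in> hom F F" "\<And>x. x \<in> pm F A \<Longrightarrow> \<rho> x = \<one>" "\<And>x. x \<in> pm F (X - A) \<Longrightarrow> \<rho> x = x"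
    using kill_letters[OF assms(4)] by blast
  interpret group_hom F F \<rho> using \<rho>(1) by unfold_locales
  have s: "set xs \<subseteq> carrier F" "set ys \<subseteq> carrier F" using assms(2,3) by (auto simp: normal_word_iff)
  have "map \<rho> xs = replicate (length xs) \<one>" using \<rho>(2) assms(5) by (intro replicate_eqI) auto
  moreover have "word_prod F (replicate n \<one>) = \<one>" for n by (induction n) auto
  ultimately have x: "\<rho> (word_prod F xs) = \<one>" using hom_word_prod[OF s(1)] by simp
  have "map \<rho> ys = ys" using \<rho>(3) assms(6) by (intro map_idI) auto
  then have y: "\<rho> (word_prod F ys) = word_prod F ys" using hom_word_prod[OF s(2)] by simp
  from assms(1) show False
  proof (cases rule: nontriv_cases)
    case (Elt g)
    then show ?thesis using x y assms(2,3) by (simp add: normal_word_iff)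
  next
    case (Cls g)
    then have c: "word_prod F xs \<in> conj_class F g" "word_prod F ys \<in> conj_class F g"
      using assms(2,3) by (auto simp: normal_word_iff)
    then obtain f where f: "f \<in> carrier F" "word_prod F ys = f \<otimes> word_prod F xs \<otimes> inv f"
      using conj_class_conjugate Cls by metis
    then have "\<rho> (word_prod F ys) = \<one>" using x s by simp
    then show ?thesis using y c one_notin_conj_class Cls by simp
  qed
qed

text \<open>Membership in \<open>A\<close> passes from a letter to its inverse, and from there along
  the turn to the next letter.\<close>

lemma clopen_words:
  assumes n: "normal_word F X r xs"
    and cl: "\<And>d e. (d, e) \<in> turns F X r \<Longrightarrow> d \<in> A \<longleftrightarrow> e \<in> A"
    and inv: "\<And>d. d \<in> set xs \<Longrightarrow> inv d \<in> A \<longleftrightarrow> d \<in> A"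
  shows "set xs \<subseteq> A \<or> set xs \<inter> A = {}"
proof -
  have step: "xs ! j \<in> A \<longleftrightarrow> xs ! Suc j \<in> A" if "Suc j < length xs" for j
  proof -
    have "(inv (xs ! j), xs ! Suc j) \<in> turns F X r"
      unfolding turns_iff using n that extended_Suc[of j xs F r] extended_Suc[of "Suc j" xs F r]
      by (intro exI[of _ xs] exI[of _ "Suc j"]) auto
    then show ?thesis using cl inv[of "xs ! j"] that by auto
  qed
  have all: "xs ! j \<in> A \<longleftrightarrow> xs ! 0 \<in> A" if "j < length xs" for j
    using that by (induction j) (use step in auto)
  show ?thesis
  proof (cases "xs ! 0 \<in> A")
    case True then show ?thesis using all by (auto simp: in_set_conv_nth)
  next
    case False then show ?thesis using all by (auto simp: in_set_conv_nth)
  qed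
qed

text \<open>If a cutvertex \<open>v\<close> has no edge to the side not containing \<open>v\<^sup>-\<^sup>1\<close>, the graph is disconnected;
  as the part cannot be split, some letter \<open>y\<close> is separated from \<open>y\<^sup>-\<^sup>1\<close> and serves as \<open>y\<^sub>\<dagger>\<close>.\<close>

lemma subroutine_exists:
  assumes R: "R \<subseteq> elts_and_classes F (carrier F - {\<one>})" and Y: "Y \<in> reducible_parts F R X"
  shows "\<exists>Y'. subroutine F Y (restricted F R Y X) Y'"
proof -
  have YP: "Y \<in> support_partition F X R" and cut: "has_basis_cutvertex F Y (restricted F R Y X)"
    using Y by (auto simp: reducible_parts_def)
  note YX = part_subset(1)[OF R YP]
  have Ysub: "Y \<subseteq> carrier F" using YX X_carrier by auto
  define E where "E = part_turns R Y"
  define V where "V = fst ` E \<union> snd ` E"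
  have wg: "whitehead_graph F Y (restricted F R Y X) = (V, E)"
    unfolding V_def E_def by (rule whitehead_graph_restricted[OF YX])
  have EV: "d \<in> V" "e \<in> V" if "(d, e) \<in> E" for d e using that unfolding V_def by force+
  have Eneq: "d \<noteq> e" if "(d, e) \<in> E" for d e using that turns_neq by (auto simp: E_def part_turns_def)
  have Vedge: "\<exists>e. (d, e) \<in> E \<or> (e, d) \<in> E" if "d \<in> V" for d using that unfolding V_def by auto
  have Vpm: "V \<subseteq> insert \<one> (pm F Y)"
    unfolding V_def E_def part_turns_def using turns_letters[OF _ _ YX] by (fastforce simp: pm0_def)
  have V_one: "\<one> \<notin> pm F Y" using one_notin_L pm_L[OF YX] by auto
  have Vinv: "inv d \<in> V" if "d \<in> V" "d \<noteq> \<one>" for d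
  proof -
    obtain e where "(d, e) \<in> E \<or> (e, d) \<in> E" using Vedge[OF \<open>d \<in> V\<close>] by blast
    then obtain r where r: "r \<in> R" "support F X r \<subseteq> Y" "(d, e) \<in> turns F X r \<or> (e, d) \<in> turns F X r"
      by (auto simp: E_def part_turns_def)
    then have "d \<in> fst ` turns F X r \<union> snd ` turns F X r" by force
    then have "inv d \<in> fst ` turns F X r \<union> snd ` turns F X r" using turn_vertex_inv that(2) by blast
    then show ?thesis using r unfolding V_def E_def part_turns_def by blast
  qed
  have choice: "\<exists>y\<in>pm F Y. \<exists>Ym Yp. separated (V, E) y Ym Yp \<and> inv y \<in> Ym \<and> (\<exists>e\<in>E. meets e Yp \<and> meets e {y})"
  proof -
    obtain v W1 W2 where v: "v \<in> pm F Y" "v \<in> V" "W1 \<noteq> {}" "W2 \<noteq> {}" "separated (V, E) v W1 W2"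
      using cut unfolding has_basis_cutvertex_def wg cutvertex_def by auto
    have vL: "v \<in> L" using v(1) pm_L[OF YX] by blast
    have "v \<noteq> \<one>" using v(1) V_one by auto
    then have "inv v \<in> V - {v}" using Vinv v(2) inv_neq_L[OF vL] by auto
    then have "inv v \<in> W1 \<or> inv v \<in> W2" using v(5) by (auto simp: separated_def)
    then obtain V1 V2 where V12: "V1 \<noteq> {}" "V2 \<noteq> {}" "separated (V, E) v V1 V2" "inv v \<in> V1"
      using v(3-5) unfolding separated_def by (metis Int_commute Un_commute)
    show ?thesis
    proof (cases "\<exists>e\<in>E. meets e V2 \<and> meets e {v}")
      case True
      then show ?thesis using V12 v(1) by blast
    next
      case False
      define B where "B = V - V2"
      have sub: "V2 \<subseteq> V" "v \<notin> V2" "v \<in> B" using V12(3) v(2) by (auto simp: separated_def B_def)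
      \<comment> \<open>With no edge from \<open>V2\<close> to \<open>v\<close> either,
        \<open>V2\<close> is a union of components of the graph.\<close>
      have cl: "d \<in> V2 \<longleftrightarrow> e \<in> V2" if de: "(d, e) \<in> E" for d e
      proof -
        have "d \<in> insert v (V1 \<union> V2)" "e \<in> insert v (V1 \<union> V2)"
          using EV[OF de] V12(3) by (auto simp: separated_def)
        moreover have "\<not> (meets (d, e) V1 \<and> meets (d, e) V2)" using V12(3) de by (auto simp: separated_def)
        moreover have "\<not> (meets (d, e) V2 \<and> meets (d, e) {v})" using False de by blast
        ultimately show ?thesis by (auto simp: meets_def)
      qed
      \<comment> \<open>If a union \<open>A\<close> of components contains \<open>y\<close> but not
        its inverse, then \<open>y\<close> serves: an edge at \<open>y\<close> stays inside
        \<open>A\<close> and is the one required between \<open>Yp\<close> and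
        \<open>y\<close>.\<close>
      have good: "\<exists>y\<in>pm F Y. \<exists>Ym Yp. separated (V, E) y Ym Yp \<and> inv y \<in> Ym \<and> (\<exists>e\<in>E. meets e Yp \<and> meets e {y})"
        if y: "y \<in> pm F Y" "y \<in> A" "inv y \<in> V - A" "A \<subseteq> V" and A: "\<And>d e. (d, e) \<in> E \<Longrightarrow> d \<in> A \<longleftrightarrow> e \<in> A" for y A
      proof -
        have s: "separated (V, E) y (V - A) (A - {y})"
          using y A by (auto simp: separated_def meets_def)
        obtain e where e: "(y, e) \<in> E \<or> (e, y) \<in> E" using Vedge[of y] y by blast
        then have "e \<in> A - {y}" using A Eneq y(2) by blast
        then have "\<exists>e\<in>E. meets e (A - {y}) \<and> meets e {y}" using e by (fastforce simp: meets_def)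
        then show ?thesis using s y by blast
      qed
      show ?thesis
      proof (rule ccontr)
        \<comment> \<open>Otherwise the letters in \<open>V2\<close> are closed under inversion, so
          \<open>V2\<close> divides the letters of the part and every support lies on one
          side.\<close>
        assume no: "\<not> ?thesis"
        have inv1: "inv d \<in> V2" if "d \<in> V2" "d \<in> pm F Y" for d
          using good[of d V2] no that sub(1) cl Vinv[of d] V_one by blast
        have inv2: "d \<in> V2" if "inv d \<in> V2" "d \<in> pm F Y" for d
          using inv1[OF that(1) inv_in_pm[OF Ysub that(2)]] that Ysub pm_closed[OF Ysub] by auto
        define YA where "YA = {x \<in> Y. x \<in> V2}"
        have YinpmY: "x \<in> pm F Y" if "x \<in> Y" for x using that by (simp add: pm_def)
        have pmYA: "d \<in> pm F YA" if d: "d \<in> pm F Y" "d \<in> V2" for d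
        proof -
          obtain x where x: "x \<in> Y" "d = x \<or> d = inv x" using d(1) by (auto simp: pm_def)
          then have "x \<in> V2" using d(2) inv2[OF _ YinpmY] by blast
          then show ?thesis using x by (auto simp: pm_def YA_def)
        qed
        have pmYB: "d \<in> pm F (Y - YA)" if d: "d \<in> pm F Y" "d \<notin> V2" for d
        proof -
          obtain x where x: "x \<in> Y" "d = x \<or> d = inv x" using d(1) by (auto simp: pm_def)
          then have "x \<notin> V2" using d(2) inv1[OF _ YinpmY] by blast
          then show ?thesis using x by (auto simp: pm_def YA_def)
        qed
        have supp: "support F X r \<subseteq> YA \<or> support F X r \<subseteq> Y - YA" if r: "r \<in> R" "support F X r \<subseteq> Y" for r
        proof -
          have rn: "nontriv r" using r R by blast
          have YAX: "YA \<subseteq> X" using YX by (auto simp: YA_def)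
          have side: "set xs \<subseteq> pm F YA \<or> set xs \<subseteq> pm F (Y - YA)" if n: "normal_word F X r xs" for xs
          proof -
            have xs: "set xs \<subseteq> pm F Y" using normal_word_letters[OF n] pm_mono[OF r(2)] by blast
            have "set xs \<subseteq> V2 \<or> set xs \<inter> V2 = {}"
            proof (rule clopen_words[OF n])
              show "d \<in> V2 \<longleftrightarrow> e \<in> V2" if "(d, e) \<in> turns F X r" for d e
                using cl that r by (auto simp: E_def part_turns_def)
              show "inv d \<in> V2 \<longleftrightarrow> d \<in> V2" if "d \<in> set xs" for d
                using inv1 inv2 xs that by blast
            qed
            then show ?thesis using pmYA pmYB xs by blast
          qed
          have pmX: "pm F (Y - YA) \<subseteq> pm F (X - YA)" using YX by (intro pm_mono) auto
          have supp_pm: "support F X r \<subseteq> A" if "\<And>xs. normal_word F X r xs \<Longrightarrow> set xs \<subseteq> pm F A" "A \<subseteq> X" for A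
          proof
            fix z assume "z \<in> support F X r"
            then obtain xs where z: "normal_word F X r xs" "z \<in> X" "z \<in> set xs \<or> inv z \<in> set xs" by (rule supportE)
            then have "z \<in> pm F A \<or> inv z \<in> pm F A" using that(1) by blast
            then have "z \<in> pm F A" using inv_in_pm[of A "inv z"] that(2) X_carrier z(2) by auto
            then show "z \<in> A" using pm_inter_X[OF that(2)] z(2) by auto
          qed
          show ?thesis
          proof (cases "\<exists>xs. normal_word F X r xs \<and> set xs \<subseteq> pm F YA")
            case True
            then obtain xs where xs: "normal_word F X r xs" "set xs \<subseteq> pm F YA" by blast
            have "set ys \<subseteq> pm F YA" if "normal_word F X r ys" for ys
              using side[OF that] normal_words_same_side[OF rn xs(1) that YAX xs(2)] pmX by blast
            then show ?thesis using supp_pm[OF _ YAX] by blast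
          next
            case False
            then have "set ys \<subseteq> pm F (Y - YA)" if "normal_word F X r ys" for ys using side[OF that] that by blast
            then show ?thesis using supp_pm[of "Y - YA"] YX by blast
          qed
        qed
        have "YA = {} \<or> Y - YA = {}"
          by (rule support_partition_split[OF R YP _ _ supp]) (auto simp: YA_def)
        then show False
        proof
          \<comment> \<open>Then \<open>V2\<close> could contain only \<open>\<one>\<close>, but a
            vertex of \<open>V2\<close> has an edge whose other end is different and also in
            \<open>V2\<close>.\<close>
          assume YA: "YA = {}"
          have "pm F YA = {}" using YA by (simp add: pm_def)
          then have "V2 \<subseteq> {\<one>}" using pmYA Vpm sub(1) by blast
          moreover obtain d where "d \<in> V2" using V12(2) by blast
          moreover obtain e where "(d, e) \<in> E \<or> (e, d) \<in> E" using Vedge sub(1) calculation by blast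
          ultimately show False using cl Eneq by blast
        next
          assume "Y - YA = {}"
          then show False using pmYB[OF v(1) sub(2)] by (auto simp: pm_def)
        qed
      qed
    qed
  qed
  then obtain y Ym Yp where y: "y \<in> pm F Y" "separated (V, E) y Ym Yp" "inv y \<in> Ym"
    "\<exists>e\<in>E. meets e Yp \<and> meets e {y}" by blast
  define l :: int where "l = (if \<one> \<in> Yp then -1 else 0)"
  \<comment> \<open>Letters that are not vertices may take either value and get \<open>l\<close>.
    The value 0 at \<open>\<one>\<close> is \<open>l + 1\<close> if \<open>\<one>\<close> lies in
    \<open>Yp\<close>, and \<open>l\<close> otherwise.\<close>
  define \<chi> where "\<chi> d = (if d \<in> Yp then l + 1 else if d = \<one> then 0 else l)" for d
  have yY: "y \<notin> Yp" "Ym \<inter> Yp = {}" using y(2) by (auto simp: separated_def)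
  have y1: "y \<noteq> \<one>" using y(1) V_one by auto
  have c1: "\<chi> \<one> = 0" by (simp add: \<chi>_def l_def)
  have c2: "\<chi> x \<in> {l, l + 1}" for x by (simp add: \<chi>_def l_def)
  have c3: "\<chi> x = l" if "x \<in> Ym \<union> {y}" for x
    using that yY y1 by (auto simp: \<chi>_def l_def)
  have c4: "\<chi> x = l + 1" if "x \<in> Yp" for x using that by (simp add: \<chi>_def)
  show ?thesis
    unfolding subroutine_def wg snd_conv
    by (rule exI, rule bexI[OF _ y(1)], rule exI[of _ Ym], rule exI[of _ Yp], rule exI[of _ l],
        rule exI[of _ \<chi>], intro conjI, rule y(2), rule y(3), rule y(4), rule l_def)
      (use c1 c2 c3 c4 in auto)
qed

end

section \<open>Termination of the algorithm\<close>

lemma algorithm_step_basis: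
  assumes "group F" "R \<subseteq> elts_and_classes F (carrier F - {\<one>\<^bsub>F\<^esub>})" "free_basis F X" "algorithm_step F R X X'"
  shows "free_basis F X'" "\<And>r. r \<in> R \<Longrightarrow> word_length F X' r \<le> word_length F X r"
    "\<exists>r\<in>R. word_length F X' r < word_length F X r"
proof -
  interpret based_group F X using assms by (simp add: based_group_def based_group_axioms_def)
  obtain Y Y' where "Y \<in> support_partition F X R" "subroutine F Y (restricted F R Y X) Y'" "X' = (X - Y) \<union> Y'"
    using assms(4) by (auto simp: algorithm_step_def reducible_parts_def)
  then show "free_basis F X'" "\<And>r. r \<in> R \<Longrightarrow> word_length F X' r \<le> word_length F X r"
    "\<exists>r\<in>R. word_length F X' r < word_length F X r"
    using subroutine_step[OF assms(2)] by auto
qed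

lemma algorithm_reaches_basis:
  assumes "group F" "R \<subseteq> elts_and_classes F (carrier F - {\<one>\<^bsub>F\<^esub>})" "free_basis F X" "algorithm_reaches F R X X'"
  shows "free_basis F X'"
  using assms(4) unfolding algorithm_reaches_def
  by (induction rule: rtranclp_induct) (use assms algorithm_step_basis in blast)+

lemma algorithm_stops:
  assumes "group F" "finite R" "R \<subseteq> elts_and_classes F (carrier F - {\<one>\<^bsub>F\<^esub>})" "free_basis F X"
  shows "algorithm_stops F R X"
  unfolding algorithm_stops_def
proof (intro conjI allI impI notI)
  assume "\<exists>B :: nat \<Rightarrow> 'a set. B 0 = X \<and> (\<forall>n. algorithm_step F R (B n) (B (Suc n)))"
  then obtain B :: "nat \<Rightarrow> 'a set" where B: "B 0 = X" "\<And>n. algorithm_step F R (B n) (B (Suc n))" by blast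
  have basis: "free_basis F (B n)" for n
    by (induction n) (use B assms algorithm_step_basis(1) in metis)+
  have "(\<Sum>r\<in>R. word_length F (B (Suc n)) r) < (\<Sum>r\<in>R. word_length F (B n) r)" for n
    using algorithm_step_basis(2,3)[OF assms(1,3) basis B(2)] assms(2) by (intro sum_strict_mono_ex1) auto
  then have "\<exists>f :: nat \<Rightarrow> nat. \<forall>n. (f (Suc n), f n) \<in> less_than"
    by (intro exI[of _ "\<lambda>n. \<Sum>r\<in>R. word_length F (B n) r"]) simp
  then show False using wf_less_than unfolding wf_iff_no_infinite_down_chain by blast
next
  fix X\<^sub>1 Y assume XY: "algorithm_reaches F R X X\<^sub>1 \<and> Y \<in> reducible_parts F R X\<^sub>1"
  then have "free_basis F X\<^sub>1" using algorithm_reaches_basis[OF assms(1,3,4)] by blast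
  then interpret based_group F X\<^sub>1 using assms by (simp add: based_group_def based_group_axioms_def)
  show "\<exists>Y'. subroutine F Y (restricted F R Y X\<^sub>1) Y'" using subroutine_exists[OF assms(3)] XY by blast
qed

subsection \<open>Folding labelled graphs\<close>

fun walk :: "('v \<times> 'a \<times> 'v) set \<Rightarrow> 'v \<Rightarrow> 'a list \<Rightarrow> 'v \<Rightarrow> bool" where
  "walk A v [] w \<longleftrightarrow> v = w"
| "walk A v (d # ds) w \<longleftrightarrow> (\<exists>u. (v, d, u) \<in> A \<and> walk A u ds w)"

lemma walk_append: "walk A v (ds @ es) w \<longleftrightarrow> (\<exists>u. walk A v ds u \<and> walk A u es w)"
  by (induction ds arbitrary: v) auto

definition relabel :: "('v \<Rightarrow> 'w) \<Rightarrow> 'v \<times> 'a \<times> 'v \<Rightarrow> 'w \<times> 'a \<times> 'w" where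
  "relabel m = (\<lambda>(v, d, w). (m v, d, m w))"

lemma walk_relabel: "walk A v ds w \<Longrightarrow> walk (relabel m ` A) (m v) ds (m w)"
proof (induction ds arbitrary: v)
  case (Cons d ds)
  then obtain u where "(v, d, u) \<in> A" "walk A u ds w" by auto
  then have "relabel m (v, d, u) \<in> relabel m ` A" "walk (relabel m ` A) (m u) ds (m w)" using Cons.IH by auto
  moreover have "relabel m (v, d, u) = (m v, d, m u)" by (simp add: relabel_def)
  ultimately show ?case by auto
qed simp

definition folded :: "('v \<times> 'a \<times> 'v) set \<Rightarrow> bool" where
  "folded A \<longleftrightarrow> (\<forall>v d w w'. (v, d, w) \<in> A \<longrightarrow> (v, d, w') \<in> A \<longrightarrow> w = w')"

text \<open>A turn placed in a graph is a triple of a vertex and two directions; the predicate says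
  that \<open>d\<close> is a direction in use at \<open>v\<close>.\<close>

definition located :: "('v \<times> 'a \<times> 'a) set \<Rightarrow> 'v \<Rightarrow> 'a \<Rightarrow> bool" where
  "located T v d \<longleftrightarrow> (\<exists>e. (v, d, e) \<in> T \<or> (v, e, d) \<in> T)"

context based_group begin

text \<open>Every edge occurs together with its reverse, which carries the inverse label. The last condition
  says that the labels of the closed walks at \<open>b\<close> represent all elements of \<open>F\<close>.\<close>

definition labelled_graph :: "'v set \<Rightarrow> ('v \<times> 'a \<times> 'v) set \<Rightarrow> 'v \<Rightarrow> bool" where
  "labelled_graph V A b \<longleftrightarrow> finite V \<and> b \<in> V \<and> A \<subseteq> V \<times> L \<times> V \<and>
     (\<forall>v d w. (v, d, w) \<in> A \<longrightarrow> (w, inv d, v) \<in> A) \<and>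
     (\<forall>v\<in>V. \<exists>ds. walk A b ds v) \<and>
     (\<forall>d\<in>L. \<exists>ds. set ds \<subseteq> L \<and> walk A b ds b \<and> word_prod F ds = d)"

lemma labelled_graph_relabel:
  assumes "labelled_graph V A b"
  shows "labelled_graph (m ` V) (relabel m ` A) (m b)"
  unfolding labelled_graph_def
proof (intro conjI allI impI ballI)
  show "finite (m ` V)" "m b \<in> m ` V" using assms by (auto simp: labelled_graph_def)
  show "relabel m ` A \<subseteq> m ` V \<times> L \<times> m ` V" using assms by (fastforce simp: labelled_graph_def relabel_def)
  show "\<exists>ds. walk (relabel m ` A) (m b) ds v" if "v \<in> m ` V" for v
    using that assms walk_relabel[of A b _ _ m] by (fastforce simp: labelled_graph_def)
  show "\<exists>ds. set ds \<subseteq> L \<and> walk (relabel m ` A) (m b) ds (m b) \<and> word_prod F ds = d" if "d \<in> L" for d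
    using that assms walk_relabel[of A b _ b m] unfolding labelled_graph_def by blast
  fix v d w assume "(v, d, w) \<in> relabel m ` A"
  then obtain v' w' where "(v', d, w') \<in> A" "v = m v'" "w = m w'" by (auto simp: relabel_def)
  then have "relabel m (w', inv d, v') \<in> relabel m ` A" using assms by (auto simp: labelled_graph_def)
  then show "(w, inv d, v) \<in> relabel m ` A" using \<open>v = m v'\<close> \<open>w = m w'\<close> by (simp add: relabel_def)
qed

text \<open>Deleting an inverse pair from a word does not move the end of its walk, because in a
  folded graph the second edge must return along the first. So a word for \<open>d\<close> can be
  shortened to \<open>d\<close> itself.\<close>

lemma folded_closed_walk:
  assumes "labelled_graph V A b" "folded A" "set ds \<subseteq> L" "walk A v ds w" "word_prod F ds = d" "d \<in> L"
  shows "(v, d, w) \<in> A"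
  using assms(3-5)
proof (induction "length ds" arbitrary: ds rule: less_induct)
  case less
  show ?case
  proof (cases "reduced ds")
    case True
    then have "ds = [d]" using less.prems assms(6) by (intro reduced_unique) auto
    then show ?thesis using less.prems by simp
  next
    case False
    obtain us vs a where ds: "ds = us @ a # inv a # vs" "word_prod F (us @ vs) = word_prod F ds"
      using not_reduced_shorten[OF less.prems(1) False] by blast
    then obtain p q p' where w: "walk A v us p" "(p, a, q) \<in> A" "(q, inv a, p') \<in> A" "walk A p' vs w"
      using less.prems(2) by (auto simp: walk_append)
    have "(q, inv a, p) \<in> A" using w(2) assms(1) by (auto simp: labelled_graph_def)
    then have "p' = p" using w(3) assms(2) by (auto simp: folded_def)
    then have "walk A v (us @ vs) w" using w by (auto simp: walk_append)
    then show ?thesis using less ds by (intro less.hyps[of "us @ vs"]) auto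
  qed
qed

text \<open>Closed walks represent every letter, so foldedness yields a loop at \<open>b\<close> for
  each letter. No further edge can then leave \<open>b\<close>, and the graph is connected.\<close>

lemma folded_rose:
  assumes "labelled_graph V A b" "folded A"
  shows "V = {b}" "A = {b} \<times> L \<times> {b}"
proof -
  have loop: "(b, d, b) \<in> A" if d: "d \<in> L" for d
    using folded_closed_walk[OF assms _ _ _ d] assms(1) d unfolding labelled_graph_def by blast
  have stay: "v = b" if "walk A b ds v" for ds v
    using that
  proof (induction ds)
    case (Cons d ds)
    then obtain u where u: "(b, d, u) \<in> A" "walk A u ds v" by auto
    then have "d \<in> L" using assms(1) by (auto simp: labelled_graph_def)
    then have "u = b" using loop u assms(2) by (auto simp: folded_def)
    then show ?case using Cons u by simp
  qed simp
  show V: "V = {b}" using stay assms(1) by (auto simp: labelled_graph_def)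
  show "A = {b} \<times> L \<times> {b}" using V loop assms(1) by (auto simp: labelled_graph_def)
qed

lemma finite_labelled_graph:
  assumes "finite X" "labelled_graph V A b" shows "finite A" "finite V"
proof -
  have "finite L" using assms(1) by (simp add: pm_def)
  then show "finite A" "finite V" using assms(2) by (auto simp: labelled_graph_def intro: finite_subset)
qed

text \<open>\<open>B\<close> drops one of the two edges to be identified, in both orientations;
  these are two triples because \<open>c\<close> is not its own inverse. The image stays the same,
  so a failure of injectivity on \<open>B\<close> would be an additional coincidence of
  edges.\<close>

lemma fold_edges:
  fixes m
  assumes "finite X" "labelled_graph V A b" "(u, c, w\<^sub>1) \<in> A" "(u, c, w\<^sub>2) \<in> A" "w\<^sub>1 \<noteq> w\<^sub>2" "m = (\<lambda>v. if v = w\<^sub>2 then w\<^sub>1 else v)"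
  defines "B \<equiv> A - {(u, c, w\<^sub>2), (w\<^sub>2, inv c, u)}"
  shows "card B + 2 = card A" "relabel m ` B = relabel m ` A" "m ` V = V - {w\<^sub>2}" "card (m ` V) + 1 = card V"
    "(u, c, w\<^sub>1) \<in> B" "c \<in> L"
proof -
  show c: "c \<in> L" using assms(2,3) by (auto simp: labelled_graph_def)
  have n: "inv c \<noteq> c" using inv_neq_L[OF c] .
  have sym: "(w\<^sub>2, inv c, u) \<in> A" "(w\<^sub>1, inv c, u) \<in> A" using assms(2-4) by (auto simp: labelled_graph_def)
  have V: "w\<^sub>1 \<in> V" "w\<^sub>2 \<in> V" using assms(2-4) by (auto simp: labelled_graph_def)
  have "card {(u, c, w\<^sub>2), (w\<^sub>2, inv c, u)} = 2" using n by auto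
  moreover have "card {(u, c, w\<^sub>2), (w\<^sub>2, inv c, u)} \<le> card A"
    using finite_labelled_graph[OF assms(1,2)] sym assms(4) by (intro card_mono) auto
  ultimately show "card B + 2 = card A"
    unfolding B_def using sym(1) assms(4) by (subst card_Diff_subset) auto
  have B1: "(u, c, w\<^sub>1) \<in> B" "(w\<^sub>1, inv c, u) \<in> B" using assms(3,5) sym n by (auto simp: B_def)
  then show "(u, c, w\<^sub>1) \<in> B" by simp
  have "relabel m (u, c, w\<^sub>2) = relabel m (u, c, w\<^sub>1)" "relabel m (w\<^sub>2, inv c, u) = relabel m (w\<^sub>1, inv c, u)"
    by (auto simp: relabel_def assms(6))
  then have "relabel m (u, c, w\<^sub>2) \<in> relabel m ` B" "relabel m (w\<^sub>2, inv c, u) \<in> relabel m ` B"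
    using B1 by (metis image_eqI)+
  moreover have "A = insert (u, c, w\<^sub>2) (insert (w\<^sub>2, inv c, u) B)" using sym(1) assms(4) by (auto simp: B_def)
  ultimately show "relabel m ` B = relabel m ` A" by (simp add: insert_absorb)
  show mV: "m ` V = V - {w\<^sub>2}" using V assms(5) by (auto simp: assms(6))
  show "card (m ` V) + 1 = card V" unfolding mV using V finite_labelled_graph[OF assms(1,2)]
    using card_Suc_Diff1[of V w\<^sub>2] by (metis Suc_eq_plus1)
qed

text \<open>In other terms, the rank of the graph is at least that of \<open>F\<close>. The rose
  attains equality, with one vertex and \<open>card L\<close> oriented edges, and a fold costs one
  vertex but at least two oriented edges.\<close>

lemma labelled_graph_card_ge:
  assumes "finite X" "labelled_graph V A b"
  shows "2 * card V + card L \<le> card A + 2"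
  using assms(2)
proof (induction "card V" arbitrary: V A b rule: less_induct)
  case less
  show ?case
  proof (cases "folded A")
    case True
    then show ?thesis using folded_rose[OF less.prems True] by (simp add: card_cartesian_product)
  next
    case False
    then obtain u c w\<^sub>1 w\<^sub>2 where e: "(u, c, w\<^sub>1) \<in> A" "(u, c, w\<^sub>2) \<in> A" "w\<^sub>1 \<noteq> w\<^sub>2" by (auto simp: folded_def)
    define m where "m = (\<lambda>v. if v = w\<^sub>2 then w\<^sub>1 else v)"
    note f = fold_edges[OF assms(1) less.prems e m_def]
    have "2 * card (m ` V) + card L \<le> card (relabel m ` A) + 2"
      using less.hyps[OF _ labelled_graph_relabel[OF less.prems]] f(4) by simp
    moreover have "card (relabel m ` A) \<le> card (A - {(u, c, w\<^sub>2), (w\<^sub>2, inv c, u)})"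
      unfolding f(2)[symmetric] using finite_labelled_graph[OF assms(1) less.prems] by (intro card_image_le) auto
    ultimately show ?thesis using f(1,4) by linarith
  qed
qed

text \<open>When two vertices \<open>w\<^sub>1\<close>, \<open>w\<^sub>2\<close> are merged by a fold along \<open>c\<close>, turns all located at the merged
  vertex lift to turns at \<open>w\<^sub>1\<close> and at \<open>w\<^sub>2\<close> which have no direction other than \<open>c\<^sup>-\<^sup>1\<close> in common, since
  by the count of edges the fold identifies no other pair of edges. So \<open>c\<^sup>-\<^sup>1\<close> is a cutvertex unless one
  of the two sides is empty.\<close>

lemma turns_at_one_vertex:
  assumes "finite X" "labelled_graph V A b" "card A + 2 \<le> 2 * card V + card L"
    and "\<And>v d e. (v, d, e) \<in> T \<Longrightarrow> d \<noteq> e \<and> v \<in> V"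
    and "\<And>v d. located T v d \<Longrightarrow> d \<noteq> \<one> \<Longrightarrow> d \<in> L \<and> (\<exists>w d'. (v, d, w) \<in> A \<and> located T w d')"
    and "\<And>v. located T v \<one> \<Longrightarrow> v = b"
    and E: "E = {(d, e). \<exists>v. (v, d, e) \<in> T}"
    and nocut: "\<And>c. c \<in> L \<Longrightarrow> \<not> cutvertex (fst ` E \<union> snd ` E, E) c"
  shows "\<exists>w. \<forall>v d e. (v, d, e) \<in> T \<longrightarrow> v = w"
  using assms(2-6) E
proof (induction "card V" arbitrary: V A b T rule: less_induct)
  case less
  note T1 = less.prems(3) and T2 = less.prems(4) and T3 = less.prems(5)
  show ?case
  proof (cases "folded A")
    case True
    then show ?thesis using folded_rose[OF less.prems(1) True] T1 by blast
  next
    case False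
    then obtain u c w\<^sub>1 w\<^sub>2 where e: "(u, c, w\<^sub>1) \<in> A" "(u, c, w\<^sub>2) \<in> A" "w\<^sub>1 \<noteq> w\<^sub>2" by (auto simp: folded_def)
    define m where "m = (\<lambda>v. if v = w\<^sub>2 then w\<^sub>1 else v)"
    define B where "B = A - {(u, c, w\<^sub>2), (w\<^sub>2, inv c, u)}"
    note f = fold_edges[OF assms(1) less.prems(1) e m_def, folded B_def]
    note finA = finite_labelled_graph[OF assms(1) less.prems(1)]
    have cle: "card (relabel m ` A) \<le> card B"
      unfolding f(2)[symmetric] using finA by (intro card_image_le) (auto simp: B_def)
    have xg: "labelled_graph (m ` V) (relabel m ` A) (m b)" using labelled_graph_relabel[OF less.prems(1)] .
    \<comment> \<open>The lower bound for the folded graph leaves no room for another coincidence of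
      edges, so relabelling is injective on \<open>B\<close>.\<close>
    have cge: "card B \<le> card (relabel m ` A)"
      using labelled_graph_card_ge[OF assms(1) xg] f(1,4) less.prems(2) by linarith
    have inj: "inj_on (relabel m) B"
    proof (rule eq_card_imp_inj_on)
    show "finite B" using finA by (simp add: B_def)
    show "card (relabel m ` B) = card B" using cge cle unfolding f(2) by simp
  qed
    define T' where "T' = (\<lambda>(v, d, e). (m v, d, e)) ` T"
    have T'iff: "(v', d, e) \<in> T' \<longleftrightarrow> (\<exists>v. (v, d, e) \<in> T \<and> v' = m v)" for v' d e
      unfolding T'_def by force
    have loc': "located T' v' d \<longleftrightarrow> (\<exists>v. located T v d \<and> v' = m v)" for v' d
      unfolding located_def T'iff by blast
    have "\<exists>w. \<forall>v d e. (v, d, e) \<in> T' \<longrightarrow> v = w"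
    proof (rule less.hyps[OF _ xg])
      show "card (m ` V) < card V" using f(4) by simp
      show "card (relabel m ` A) + 2 \<le> 2 * card (m ` V) + card L" using cle f(1,4) less.prems(2) by linarith
      show "d \<noteq> e \<and> v' \<in> m ` V" if "(v', d, e) \<in> T'" for v' d e using that T1 unfolding T'iff by blast
      show "v' = m b" if "located T' v' \<one>" for v' using that T3 unfolding loc' by blast
      show "E = {(d, e). \<exists>v. (v, d, e) \<in> T'}" unfolding T'iff less.prems(6) by auto
      show "d \<in> L \<and> (\<exists>w d'. (v', d, w) \<in> relabel m ` A \<and> located T' w d')"
        if h: "located T' v' d" "d \<noteq> \<one>" for v' d
      proof -
        obtain v where v: "located T v d" "v' = m v" using h(1) unfolding loc' by blast
        obtain w d' where "d \<in> L" "(v, d, w) \<in> A" "located T w d'" using T2[OF v(1) h(2)] by blast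
        moreover then have "relabel m (v, d, w) \<in> relabel m ` A" by blast
        moreover have "relabel m (v, d, w) = (m v, d, m w)" by (simp add: relabel_def)
        ultimately show ?thesis using v(2) unfolding loc' by metis
      qed
    qed
    then obtain w where w': "\<forall>v d e. (v, d, e) \<in> T' \<longrightarrow> v = w" by blast
    have w: "m v = w" if h: "(v, d, e) \<in> T" for v d e
    proof -
      have "(m v, d, e) \<in> T'" using h T'iff by blast
      then show ?thesis using w' by blast
    qed
    then have wloc: "m v = w" if "located T v d" for v d using that unfolding located_def by blast
    show ?thesis
    proof (cases "w = w\<^sub>1")
      case False
      then have "v = w" if "(v, d, e) \<in> T" for v d e using w[OF that] by (auto simp: m_def split: if_splits)
      then show ?thesis by blast
    next
      case True
      then have v12: "v = w\<^sub>1 \<or> v = w\<^sub>2" if "(v, d, e) \<in> T" for v d e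
        using w[OF that] by (auto simp: m_def split: if_splits)
      define D\<^sub>1 D\<^sub>2 where "D\<^sub>1 = {d. located T w\<^sub>1 d}" and "D\<^sub>2 = {d. located T w\<^sub>2 d}"
      \<comment> \<open>Any other common direction would start an edge at \<open>w\<^sub>1\<close>
        and one at \<open>w\<^sub>2\<close>. Both lead to vertices that carry turns, hence to the
        merged vertex, and would be identified. If one of them is the dropped edge,
        \<open>(u, c, w\<^sub>1)\<close> takes its place.\<close>
      have shared: "d = inv c" if d: "d \<in> D\<^sub>1" "d \<in> D\<^sub>2" for d
      proof (rule ccontr)
        assume "d \<noteq> inv c"
        have loc: "located T w\<^sub>1 d" "located T w\<^sub>2 d" using d by (auto simp: D\<^sub>1_def D\<^sub>2_def)
        then have "d \<noteq> \<one>" using T3 e(3) by metis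
        then obtain a\<^sub>1 a\<^sub>2 where a: "(w\<^sub>1, d, a\<^sub>1) \<in> A" "(w\<^sub>2, d, a\<^sub>2) \<in> A" "m a\<^sub>1 = w\<^sub>1" "m a\<^sub>2 = w\<^sub>1"
          using T2[OF loc(1)] T2[OF loc(2)] wloc True by metis
        have mw: "m w\<^sub>1 = w\<^sub>1" "m w\<^sub>2 = w\<^sub>1" by (auto simp: m_def)
        have r: "relabel m (w\<^sub>1, d, a\<^sub>1) = relabel m (w\<^sub>2, d, a\<^sub>2)" using a mw by (simp add: relabel_def)
        have B: "(p, d, q) \<in> B" if "(p, d, q) \<in> A" "(p, d, q) \<noteq> (u, c, w\<^sub>2)" for p q
          using that \<open>d \<noteq> inv c\<close> by (auto simp: B_def)
        consider "(w\<^sub>1, d, a\<^sub>1) = (u, c, w\<^sub>2)" | "(w\<^sub>2, d, a\<^sub>2) = (u, c, w\<^sub>2)"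
          | "(w\<^sub>1, d, a\<^sub>1) \<in> B" "(w\<^sub>2, d, a\<^sub>2) \<in> B" using B a by blast
        then show False
        proof cases
          case 1
          then have "(w\<^sub>2, d, a\<^sub>2) \<in> B" using B[OF a(2)] e(3) by auto
          moreover have "relabel m (u, c, w\<^sub>1) = relabel m (w\<^sub>2, d, a\<^sub>2)"
            using 1 a(4) mw by (auto simp: relabel_def)
          ultimately have "(u, c, w\<^sub>1) = (w\<^sub>2, d, a\<^sub>2)" using inj f(5) by (meson inj_onD)
          then show False using 1 e(3) by simp
        next
          case 2
          then have "(w\<^sub>1, d, a\<^sub>1) \<in> B" using B[OF a(1)] e(3) by auto
          moreover have "relabel m (u, c, w\<^sub>1) = relabel m (w\<^sub>1, d, a\<^sub>1)"
            using 2 a(3) mw by (auto simp: relabel_def)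
          ultimately have "(u, c, w\<^sub>1) = (w\<^sub>1, d, a\<^sub>1)" using inj f(5) by (meson inj_onD)
          then show False using 2 e(3) by simp
        next
          case 3
          then show False using inj r e(3) by (auto dest: inj_onD)
        qed
      qed
      have turn: "d \<in> D\<^sub>1 \<and> e \<in> D\<^sub>1 \<or> d \<in> D\<^sub>2 \<and> e \<in> D\<^sub>2" if "(d, e) \<in> E" for d e
        using that v12 unfolding less.prems(6) D\<^sub>1_def D\<^sub>2_def located_def by blast
      have two: "\<exists>d e. d \<in> D \<and> e \<in> D \<and> d \<noteq> e" if "D = D\<^sub>1 \<or> D = D\<^sub>2" "D \<noteq> {}" for D
        using that T1 unfolding D\<^sub>1_def D\<^sub>2_def located_def by blast
      have VE: "fst ` E \<union> snd ` E = D\<^sub>1 \<union> D\<^sub>2"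
      proof
        show "fst ` E \<union> snd ` E \<subseteq> D\<^sub>1 \<union> D\<^sub>2" using turn by force
        have "d \<in> fst ` E \<union> snd ` E" if "located T v d" for v d
          using that unfolding less.prems(6) located_def by force
        then show "D\<^sub>1 \<union> D\<^sub>2 \<subseteq> fst ` E \<union> snd ` E" unfolding D\<^sub>1_def D\<^sub>2_def by blast
      qed
      have letter: "d \<in> L" if "d \<in> D\<^sub>1 \<union> D\<^sub>2" "d \<noteq> \<one>" for d
        using that T2 by (auto simp: D\<^sub>1_def D\<^sub>2_def)
      have "D\<^sub>1 = {} \<or> D\<^sub>2 = {}"
      proof (rule ccontr)
        assume ne: "\<not> (D\<^sub>1 = {} \<or> D\<^sub>2 = {})"
        \<comment> \<open>The candidate is the common direction if there is one. Otherwise any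
          letter in use at \<open>w\<^sub>1\<close> serves; it exists because a turn has two
          different directions, so one of them is not \<open>\<one>\<close>. For the same reason
          removing \<open>z\<close> empties neither side.\<close>
        obtain z where z: "z \<in> D\<^sub>1 \<union> D\<^sub>2" "z \<in> L" "D\<^sub>1 \<inter> D\<^sub>2 \<subseteq> {z}"
        proof (cases "D\<^sub>1 \<inter> D\<^sub>2 = {}")
          case True
          obtain d e where "d \<in> D\<^sub>1" "e \<in> D\<^sub>1" "d \<noteq> e" using two[of D\<^sub>1] ne by blast
          then obtain z where "z \<in> D\<^sub>1" "z \<noteq> \<one>" by metis
          then show ?thesis using that[of z] letter True by blast
        next
          case False
          then obtain d where "d \<in> D\<^sub>1" "d \<in> D\<^sub>2" by blast
          then have "inv c \<in> D\<^sub>1" using shared by blast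
          moreover have "D\<^sub>1 \<inter> D\<^sub>2 \<subseteq> {inv c}" using shared by blast
          ultimately show ?thesis using that[of "inv c"] f(6) by simp
        qed
        have "D - {z} \<noteq> {}" if h: "D = D\<^sub>1 \<or> D = D\<^sub>2" for D
        proof -
          have "D \<noteq> {}" using h ne by auto
          then obtain d e where "d \<in> D" "e \<in> D" "d \<noteq> e" using two[OF h] by blast
          then show ?thesis by auto
        qed
        then have ne': "D\<^sub>1 - {z} \<noteq> {}" "D\<^sub>2 - {z} \<noteq> {}" by simp_all
        have "\<not> (meets (d, e) (D\<^sub>1 - {z}) \<and> meets (d, e) (D\<^sub>2 - {z}))" if "(d, e) \<in> E" for d e
          using turn[OF that] z(3) unfolding meets_def fst_conv snd_conv by blast
        then have "separated (fst ` E \<union> snd ` E, E) z (D\<^sub>1 - {z}) (D\<^sub>2 - {z})"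
          unfolding separated_def VE using z(3) by auto
        moreover have "z \<in> fst ` E \<union> snd ` E" using z(1) VE by simp
        ultimately have "cutvertex (fst ` E \<union> snd ` E, E) z"
          using ne' unfolding cutvertex_def fst_conv by (intro conjI exI[of _ "D\<^sub>1 - {z}"] exI[of _ "D\<^sub>2 - {z}"])
        then show False using nocut z(2) by blast
      qed
      then show ?thesis
      proof
        assume "D\<^sub>1 = {}"
        then have "(w\<^sub>1, d, e) \<notin> T" for d e unfolding D\<^sub>1_def located_def by blast
        then have "v = w\<^sub>2" if "(v, d, e) \<in> T" for v d e using v12[OF that] that by metis
        then show ?thesis by blast
      next
        assume "D\<^sub>2 = {}"
        then have "(w\<^sub>2, d, e) \<notin> T" for d e unfolding D\<^sub>2_def located_def by blast
        then have "v = w\<^sub>1" if "(v, d, e) \<in> T" for v d e using v12[OF that] that by metis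
        then show ?thesis by blast
      qed
    qed
  qed
qed

end

subsection \<open>Homomorphisms to the group of order two\<close>

text \<open>With exclusive or on \<open>bool\<close>, a homomorphism is a predicate, and a
  homomorphism on \<open>F\<close> is encoded by the subset of the basis where it holds.\<close>

definition parity_group :: "bool monoid" where
  "parity_group = \<lparr>carrier = UNIV, monoid.mult = (\<noteq>), one = False\<rparr>"

lemma parity_group_simps [simp]:
  "carrier parity_group = UNIV" "a \<otimes>\<^bsub>parity_group\<^esub> b = (a \<noteq> b)" "\<one>\<^bsub>parity_group\<^esub> = False"
  by (simp_all add: parity_group_def)

lemma group_parity: "group parity_group"
  by (rule groupI) auto

context based_group begin

lemma hom_eq_on_basis:
  assumes "group M" "h \<in> hom F M" "h' \<in> hom F M" "\<And>x. x \<in> X \<Longrightarrow> h x = h' x" "g \<in> carrier F"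
  shows "h g = h' g"
proof -
  interpret M: group M by fact
  interpret h: group_hom F M h using assms(2) by unfold_locales
  interpret h': group_hom F M h' using assms(3) by unfold_locales
  obtain xs where xs: "set xs \<subseteq> L" "word_prod F xs = g" using word_exists[OF assms(5)] .
  have "h d = h' d" if "d \<in> L" for d using that assms(4) by (auto simp: pm_def)
  then have "map h xs = map h' xs" using xs(1) by auto
  then show ?thesis
    using h.hom_word_prod[of xs] h'.hom_word_prod[of xs] set_L_carrier[OF xs(1)] xs(2) by metis
qed

lemma coset_mult_closed [simp]: "c \<subseteq> carrier F \<Longrightarrow> g \<in> carrier F \<Longrightarrow> c #> g \<subseteq> carrier F"
  by (rule r_coset_subset_G)

lemma coset_mult_cancel:
  assumes "v \<subseteq> carrier F" "c \<subseteq> carrier F" "d \<in> carrier F"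
  shows "v #> d = c #> d \<longleftrightarrow> v = c"
proof
  assume "v #> d = c #> d"
  then have "v #> d #> inv d = c #> d #> inv d" by simp
  then show "v = c" using assms by (simp add: coset_mult_assoc)
qed simp

text \<open>\<open>par c g\<close> is the parity of the number of marked edges on the path in the coset graph that
  starts at \<open>c\<close> and reads a word for \<open>g\<close>; the marked edges are given by \<open>\<kappa>\<close>.\<close>

lemma coset_parity:
  fixes \<kappa> :: "'a set \<Rightarrow> 'a \<Rightarrow> bool"
  shows "\<exists>par. (\<forall>c x. c \<subseteq> carrier F \<longrightarrow> x \<in> X \<longrightarrow> par c x = \<kappa> c x) \<and>
    (\<forall>c g h. c \<subseteq> carrier F \<longrightarrow> g \<in> carrier F \<longrightarrow> h \<in> carrier F \<longrightarrow>
       par c (g \<otimes> h) = (par c g \<noteq> par (c #> g) h))"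
proof -
  \<comment> \<open>A letter moves the coset and switches the bit on marked edges: this is the
    double cover of the coset graph given by \<open>\<kappa>\<close>. Pairs whose set lies outside
    the carrier are left alone to keep the maps bijective.\<close>
  define \<sigma> where "\<sigma> x s = (if fst s \<subseteq> carrier F then (fst s #> x, snd s \<noteq> \<kappa> (fst s) x) else s)"
    for x and s :: "'a set \<times> bool"
  define \<tau> where "\<tau> x s = (if fst s \<subseteq> carrier F then (fst s #> inv x, snd s \<noteq> \<kappa> (fst s #> inv x) x) else s)"
    for x and s :: "'a set \<times> bool"
  have st: "\<tau> x (\<sigma> x s) = s" "\<sigma> x (\<tau> x s) = s" if "x \<in> X" for x s
    using that by (auto simp: \<sigma>_def \<tau>_def coset_mult_assoc prod_eq_iff)
  have "bij (\<sigma> x)" if "x \<in> X" for x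
    by (rule o_bij[of "\<tau> x"]) (simp_all add: fun_eq_iff st[OF that])
  then obtain A where A: "\<forall>x\<in>X. A x = \<sigma> x" "\<forall>s. A \<one> s = s"
    "\<forall>g\<in>carrier F. \<forall>h\<in>carrier F. \<forall>s. A (g \<otimes> h) s = A h (A g s)"
    using action_exists[of \<sigma>] by metis
  \<comment> \<open>The bit that \<open>g\<close> adds depends on the starting coset but not on the
    bit found there.\<close>
  define Q where "Q g \<longleftrightarrow> (\<forall>c t. c \<subseteq> carrier F \<longrightarrow> A g (c, t) = (c #> g, t \<noteq> snd (A g (c, False))))" for g
  have QX: "Q x" if "x \<in> X" for x
    using that A(1) by (auto simp: Q_def \<sigma>_def)
  have Ainv: "A (inv x) s = \<tau> x s" if "x \<in> X" for x s
  proof -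
    have "A (x \<otimes> inv x) (\<tau> x s) = A (inv x) (A x (\<tau> x s))" using A(3) that by (metis X_carrier' inv_closed)
    then show ?thesis using A(1,2) st(2) that by simp
  qed
  have Qinv: "Q (inv x)" if "x \<in> X" for x
    using that Ainv[OF that] by (auto simp: Q_def \<tau>_def)
  have Qmult: "Q (g \<otimes> h)" if "g \<in> carrier F" "h \<in> carrier F" "Q g" "Q h" for g h
    unfolding Q_def
  proof (intro allI impI)
    fix c t assume c: "c \<subseteq> carrier F"
    define a b where "a = snd (A g (c, False))" and "b = snd (A h (c #> g, False))"
    have g: "A g (c, t) = (c #> g, t \<noteq> a)" for t using that(3) c unfolding Q_def a_def by blast
    have h: "A h (c #> g, t) = (c #> g #> h, t \<noteq> b)" for t
      using that(4) coset_mult_closed[OF c that(1)] unfolding Q_def b_def by blast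
    have gh: "A (g \<otimes> h) (c, t) = (c #> g #> h, (t \<noteq> a) \<noteq> b)" for t
    proof -
      have "A (g \<otimes> h) (c, t) = A h (A g (c, t))" using A(3) that(1,2) by blast
      then show ?thesis by (simp only: g h)
    qed
    show "A (g \<otimes> h) (c, t) = (c #> (g \<otimes> h), t \<noteq> snd (A (g \<otimes> h) (c, False)))"
      unfolding gh using c that(1,2) by (cases t) (simp_all add: coset_mult_assoc)
  qed
  have Q: "Q g" if g: "g \<in> carrier F" for g
  proof -
    obtain xs where "set xs \<subseteq> L" "word_prod F xs = g" using word_exists[OF g] .
    then show ?thesis
    proof (induction xs arbitrary: g)
      case Nil
      then show ?case using A(2) by (auto simp: Q_def)
    next
      case (Cons x xs)
      then have "Q (word_prod F xs)" by simp
      moreover have "Q x" using Cons.prems(1) QX Qinv by (auto simp: pm_def)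
      ultimately show ?case using Qmult[of x "word_prod F xs"] Cons.prems by auto
    qed
  qed
  have par: "snd (A (g \<otimes> h) (c, False)) = (snd (A g (c, False)) \<noteq> snd (A h (c #> g, False)))"
    if "c \<subseteq> carrier F" "g \<in> carrier F" "h \<in> carrier F" for c g h
  proof -
    define a b where "a = snd (A g (c, False))" and "b = snd (A h (c #> g, False))"
    have *: "A g (c, False) = (c #> g, False \<noteq> snd (A g (c, False)))"
      using Q[OF that(2)] that(1) unfolding Q_def by blast
    have "A g (c, False) = (c #> g, a)"
      using arg_cong[OF *, of fst] by (simp add: prod_eq_iff a_def)
    then have "A (g \<otimes> h) (c, False) = A h (c #> g, a)" using A(3) that by metis
    also have "\<dots> = (c #> g #> h, a \<noteq> b)"
      using Q[OF that(3)] coset_mult_closed[OF that(1,2)] unfolding Q_def b_def by blast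
    finally show ?thesis by (simp add: a_def b_def)
  qed
  show ?thesis
    by (rule exI[of _ "\<lambda>c g. snd (A g (c, False))"]) (use par A(1) in \<open>auto simp: \<sigma>_def\<close>)
qed

text \<open>Conjugated by \<open>k\<close>, an element of \<open>H\<close> is read along a closed
  path at \<open>H #> k\<close>, and parities of closed paths at one vertex add.\<close>

lemma coset_parity_hom:
  assumes par: "\<And>c g h. c \<subseteq> carrier F \<Longrightarrow> g \<in> carrier F \<Longrightarrow> h \<in> carrier F \<Longrightarrow> par c (g \<otimes> h) = (par c g \<noteq> par (c #> g) h)"
    and H: "subgroup H F" and k: "k \<in> carrier F"
  shows "(\<lambda>h. par (H #> k) (inv k \<otimes> h \<otimes> k)) \<in> hom (F\<lparr>carrier := H\<rparr>) parity_group"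
proof (rule homI; simp)
  fix g h assume gh: "g \<in> H" "h \<in> H"
  note c = subgroup.mem_carrier[OF H]
  have Hs: "H \<subseteq> carrier F" using c by blast
  have e: "inv k \<otimes> (g \<otimes> h) \<otimes> k = (inv k \<otimes> g \<otimes> k) \<otimes> (inv k \<otimes> h \<otimes> k)"
    using gh c k by (simp add: m_assoc)
  have "H #> k #> (inv k \<otimes> g \<otimes> k) = H #> (g \<otimes> k)"
    using gh c k Hs by (simp add: coset_mult_assoc m_assoc)
  also have "\<dots> = H #> k" using gh c k Hs coset_join2[of g H] H by (simp add: coset_mult_assoc[symmetric])
  finally show "par (H #> k) (inv k \<otimes> (g \<otimes> h) \<otimes> k) =
      (par (H #> k) (inv k \<otimes> g \<otimes> k) = (\<not> par (H #> k) (inv k \<otimes> h \<otimes> k)))"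
    unfolding e using par[of "H #> k" "inv k \<otimes> g \<otimes> k" "inv k \<otimes> h \<otimes> k"] gh c k Hs by auto
qed

text \<open>A shortest reduced closed path in the coset graph passes only once through its first edge.\<close>

lemma nontrivial_parity_hom:
  assumes H: "subgroup H F" "H \<noteq> {\<one>}"
  obtains \<phi> h where "\<phi> \<in> hom (F\<lparr>carrier := H\<rparr>) parity_group" "h \<in> H" "\<phi> h"
proof -
  note Hc = subgroup.mem_carrier[OF H(1)]
  have Hs: "H \<subseteq> carrier F" using Hc by blast
  \<comment> \<open>Loops at all cosets compete, so that every closed piece of a shortest loop is
    itself a candidate.\<close>
  define loop where "loop c ws \<longleftrightarrow> (\<exists>k\<in>carrier F. c = H #> k) \<and> ws \<noteq> [] \<and> set ws \<subseteq> L \<and> reduced ws \<and> c #> word_prod F ws = c"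
    for c ws
  obtain h0 where h0: "h0 \<in> H" "h0 \<noteq> \<one>" using H subgroup.one_closed[OF H(1)] by blast
  obtain xs where xs: "set xs \<subseteq> L" "word_prod F xs = h0" using word_exists Hc[OF h0(1)] by blast
  obtain ws0 where ws0: "set ws0 \<subseteq> set xs" "reduced ws0" "word_prod F ws0 = word_prod F xs" using reduced_form[OF xs(1)] .
  have "H = H #> \<one>" using Hs by simp
  then have "loop H ws0" unfolding loop_def using ws0 xs h0 coset_join2[OF Hc[OF h0(1)] H(1) h0(1)] by auto
  then obtain p where "loop (fst p) (snd p)" "\<forall>q. loop (fst q) (snd q) \<longrightarrow> length (snd p) \<le> length (snd q)"
    using ex_has_least_nat[of "\<lambda>p. loop (fst p) (snd p)" "(H, ws0)" "\<lambda>p. length (snd p)"] by auto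
  then obtain c ws where loop: "loop c ws" and min: "\<And>c' ws'. loop c' ws' \<Longrightarrow> length ws \<le> length ws'"
    by (cases p) auto
  obtain k where k: "k \<in> carrier F" "c = H #> k" using loop by (auto simp: loop_def)
  have cs: "c \<subseteq> carrier F" using k Hs by simp
  obtain d us where ws: "ws = d # us" using loop by (cases ws) (auto simp: loop_def)
  have dL: "d \<in> L" and usL: "set us \<subseteq> L" using loop ws by (auto simp: loop_def)
  \<comment> \<open>The edge is marked in both orientations, so that the parities of basis letters
    and of their inverses follow the same rule.\<close>
  define cross where "cross v e \<longleftrightarrow> (v = c \<and> e = d) \<or> (v = c #> d \<and> e = inv d)" for v e
  obtain par where par0: "\<And>v x. v \<subseteq> carrier F \<Longrightarrow> x \<in> X \<Longrightarrow> par v x = cross v x"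
    and par: "\<And>v g h. v \<subseteq> carrier F \<Longrightarrow> g \<in> carrier F \<Longrightarrow> h \<in> carrier F \<Longrightarrow> par v (g \<otimes> h) = (par v g \<noteq> par (v #> g) h)"
    using coset_parity[of cross] by blast
  have par1: "\<not> par v \<one>" if "v \<subseteq> carrier F" for v using par[OF that, of \<one> \<one>] that by simp
  have parL: "par v e = cross v e" if v: "v \<subseteq> carrier F" and e: "e \<in> L" for v e
  proof (cases "e \<in> X")
    case False
    then obtain x where x: "x \<in> X" "e = inv x" using e by (auto simp: pm_def)
    have "par v e = par (v #> e) x" using par[OF v, of e x] par1[OF v] x by auto
    then have "par v e = cross (v #> e) x" using par0[of "v #> e" x] v x by simp
    moreover have "cross (v #> e) x \<longleftrightarrow> cross v e"
    proof -
      have 1: "v #> e = c \<longleftrightarrow> v = c #> x"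
        using v cs x by (auto simp: coset_mult_assoc)
      have "x = inv d \<longleftrightarrow> e = d" using x dL by auto
      then have 2: "v #> e = c #> d \<and> x = inv d \<longleftrightarrow> v = c \<and> e = d"
        using coset_mult_cancel[OF v cs, of d] dL by auto
      have 3: "x = d \<longleftrightarrow> e = inv d" using x dL by (metis L_carrier' X_carrier' inv_inv)
      show ?thesis unfolding cross_def using 1 2 3 by blast
    qed
    ultimately show ?thesis by simp
  qed (use par0 v in auto)
  have none: "\<not> par v (word_prod F es)"
    if "v \<subseteq> carrier F" "set es \<subseteq> L" "\<And>i. i < length es \<Longrightarrow> \<not> cross (v #> word_prod F (take i es)) (es ! i)" for v es
    using that
  proof (induction es arbitrary: v)
    case (Cons e es)
    have e: "e \<in> L" "set es \<subseteq> L" using Cons.prems by auto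
    have "\<not> cross v e" using Cons.prems(3)[of 0] Cons.prems(1) by simp
    moreover have "\<not> par (v #> e) (word_prod F es)"
    proof (rule Cons.IH)
      show "v #> e \<subseteq> carrier F" using Cons.prems e by simp
      fix i assume "i < length es"
      then show "\<not> cross (v #> e #> word_prod F (take i es)) (es ! i)"
        using Cons.prems(3)[of "Suc i"] Cons.prems(1) e set_take_subset[of i es]
        by (simp add: coset_mult_assoc subset_trans)
    qed (use e in auto)
    ultimately show ?case using par[of v e "word_prod F es"] parL Cons.prems(1) e by simp
  qed (use par1 in simp)
  have coset: "\<exists>k\<in>carrier F. c #> word_prod F vs = H #> k" if "set vs \<subseteq> L" for vs
    using that k Hs by (intro bexI[of _ "k \<otimes> word_prod F vs"]) (simp_all add: coset_mult_assoc)
  \<comment> \<open>A second passage through the marked edge would close up a shorter loop, at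
    \<open>c\<close> or at \<open>c #> d\<close>, except for an immediate return, which reducedness
    forbids.\<close>
  have rest: "\<not> par (c #> d) (word_prod F us)"
  proof (rule none)
    show "c #> d \<subseteq> carrier F" using cs dL by simp
    fix i assume i: "i < length us"
    have t: "set (take i us) \<subseteq> L" using usL set_take_subset[of i us] by auto
    have v: "c #> d #> word_prod F (take i us) = c #> word_prod F (d # take i us)"
      using cs dL t by (simp add: coset_mult_assoc)
    have red: "reduced (d # us)" using loop ws by (simp add: loop_def)
    then have redt: "reduced (take (Suc i) (d # us))"
      by (metis append_take_drop_id successively_append_iff)
    show "\<not> cross (c #> d #> word_prod F (take i us)) (us ! i)"
    proof
      assume "cross (c #> d #> word_prod F (take i us)) (us ! i)"
      then consider "c #> word_prod F (d # take i us) = c" | "c #> d #> word_prod F (take i us) = c #> d" "us ! i = inv d"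
        unfolding cross_def v by blast
      then show False
      proof cases
        case 1
        then have "loop c (d # take i us)" unfolding loop_def using k t dL redt by auto
        then show False using min i ws by fastforce
      next
        case 2
        show False
        proof (cases i)
          case 0
          then show False using red 2(2) i by (cases us) auto
        next
          case (Suc j)
          have "reduced (take i us)" using redt by (cases "take i us") (auto simp: successively_Cons)
          then have "loop (c #> d) (take i us)"
            unfolding loop_def using coset[of "[d]"] dL t 2 Suc i by auto
          then show False using min i ws by fastforce
        qed
      qed
    qed
  qed (use usL in auto)
  have "par c (word_prod F ws)"
    using par[of c d "word_prod F us"] rest parL[OF cs dL] cs dL usL ws by (simp add: cross_def)
  define h where "h = k \<otimes> word_prod F ws \<otimes> inv k"
  have wc: "word_prod F ws \<in> carrier F" using dL usL ws by simp
  have "H #> (k \<otimes> word_prod F ws) = H #> k" using loop k wc Hs by (simp add: loop_def coset_mult_assoc)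
  then have "H #> h = H" using k wc Hs unfolding h_def
    by (metis coset_mult_assoc coset_mult_inv2 coset_mult_one inv_closed m_closed)
  then have "h \<in> H" using coset_join1[of H h] H(1) k wc h_def by simp
  moreover have "inv k \<otimes> h \<otimes> k = word_prod F ws" using k wc by (simp add: h_def m_assoc)
  ultimately show ?thesis
    using that[OF coset_parity_hom[OF par H(1) k(1)]] \<open>par c (word_prod F ws)\<close> k by simp
qed

text \<open>For each \<open>j\<close> in \<open>J\<close> fix a homomorphism to the group of order
  two that is nontrivial on \<open>H j\<close>. A subset of \<open>J\<close> says where these are
  used, with trivial maps elsewhere. The glued homomorphisms are distinct, vanish on
  \<open>Z\<close> and are determined by the other letters, so \<open>2 ^ card J\<close> is at most
  \<open>2 ^ card (X - Z)\<close>.\<close>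

lemma factors_count:
  assumes "finite X" "factorization F I H" "finite J" "J \<subseteq> I" "\<And>j. j \<in> J \<Longrightarrow> H j \<noteq> {\<one>}"
    and "Z \<subseteq> X" "\<And>z. z \<in> Z \<Longrightarrow> \<exists>i\<in>I - J. \<exists>k\<in>carrier F. k \<otimes> z \<otimes> inv k \<in> H i"
  shows "card J + card Z \<le> card X"
proof -
  have sub: "subgroup (H i) F" if "i \<in> I" for i using assms(2) that by (simp add: factorization_def)
  have "\<exists>\<phi> h. \<phi> \<in> hom (F\<lparr>carrier := H j\<rparr>) parity_group \<and> h \<in> H j \<and> \<phi> h" if "j \<in> J" for j
    using nontrivial_parity_hom[OF sub assms(5)] that assms(4) by (metis subsetD)
  then obtain \<phi> h where \<phi>: "\<And>j. j \<in> J \<Longrightarrow> \<phi> j \<in> hom (F\<lparr>carrier := H j\<rparr>) parity_group"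
    "\<And>j. j \<in> J \<Longrightarrow> h j \<in> H j" "\<And>j. j \<in> J \<Longrightarrow> \<phi> j (h j)" by metis
  have triv: "(\<lambda>_. False) \<in> hom G parity_group" for G :: "('a, 'b) monoid_scheme"
    by (rule homI) auto
  have "\<exists>\<Phi>. \<Phi> \<in> hom F parity_group \<and> (\<forall>i\<in>I. \<forall>h\<in>H i. \<Phi> h = (if i \<in> S then \<phi> i h else False))" if "S \<subseteq> J" for S
  proof -
    have "(if i \<in> S then \<phi> i else (\<lambda>_. False)) \<in> hom (F\<lparr>carrier := H i\<rparr>) parity_group" if "i \<in> I" for i
      using \<phi>(1) \<open>S \<subseteq> J\<close> triv by auto
    then obtain \<Phi> where "\<Phi> \<in> hom F parity_group" "\<And>i h. i \<in> I \<Longrightarrow> h \<in> H i \<Longrightarrow> \<Phi> h = (if i \<in> S then \<phi> i else (\<lambda>_. False)) h"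
      using factorization_universal[OF group_axioms assms(2) group_parity,
          of "\<lambda>i. if i \<in> S then \<phi> i else (\<lambda>_. False)"] by blast
    then show ?thesis by auto
  qed
  then obtain \<Phi> where \<Phi>: "\<And>S. S \<subseteq> J \<Longrightarrow> \<Phi> S \<in> hom F parity_group"
    "\<And>S i h. S \<subseteq> J \<Longrightarrow> i \<in> I \<Longrightarrow> h \<in> H i \<Longrightarrow> \<Phi> S h = (if i \<in> S then \<phi> i h else False)" by metis
  define f where "f S = {x \<in> X. \<Phi> S x}" for S
  have "f ` Pow J \<subseteq> Pow (X - Z)"
  proof
    fix T assume "T \<in> f ` Pow J"
    then obtain S where S: "S \<subseteq> J" "T = f S" by blast
    interpret group_hom F parity_group "\<Phi> S"
      using \<Phi>(1)[OF S(1)] by (simp add: group_hom_def group_hom_axioms_def group_parity group_axioms)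
    have "\<not> \<Phi> S z" if z: "z \<in> Z" for z
    proof -
      obtain i k where ik: "i \<in> I - J" "k \<in> carrier F" "k \<otimes> z \<otimes> inv k \<in> H i" using assms(7)[OF z] by blast
      have ik': "inv k \<in> carrier F" using ik(2) by simp
      have zc: "z \<in> carrier F" using z assms(6) by auto
      have "i \<in> I" "i \<notin> S" using ik(1) S(1) by auto
      then have "\<not> \<Phi> S (k \<otimes> z \<otimes> inv k)" using \<Phi>(2)[OF S(1) _ ik(3)] by simp
      moreover have "\<Phi> S (k \<otimes> z \<otimes> inv k) = ((\<Phi> S k \<noteq> \<Phi> S z) \<noteq> \<Phi> S (inv k))"
        using ik(2) zc hom_mult by simp
      moreover have "\<Phi> S (k \<otimes> inv k) = (\<Phi> S k \<noteq> \<Phi> S (inv k))"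
        using hom_mult[OF ik(2) ik'] by (simp only: parity_group_simps)
      moreover have "k \<otimes> inv k = \<one>" using ik(2) by simp
      ultimately have "\<Phi> S k = \<Phi> S (inv k)" using hom_one by simp
      moreover note \<open>\<not> \<Phi> S (k \<otimes> z \<otimes> inv k)\<close>
        \<open>\<Phi> S (k \<otimes> z \<otimes> inv k) = ((\<Phi> S k \<noteq> \<Phi> S z) \<noteq> \<Phi> S (inv k))\<close>
      ultimately show ?thesis by auto
    qed
    then show "T \<in> Pow (X - Z)" using S(2) by (auto simp: f_def)
  qed
  moreover have "inj_on f (Pow J)"
  proof (rule inj_onI)
    fix S T assume ST: "S \<in> Pow J" "T \<in> Pow J" "f S = f T"
    have "\<Phi> S x = \<Phi> T x" if "x \<in> X" for x using ST(3) that by (auto simp: f_def)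
    then have eq: "\<Phi> S g = \<Phi> T g" if "g \<in> carrier F" for g
      using hom_eq_on_basis[OF group_parity \<Phi>(1) \<Phi>(1)] ST that by blast
    have "j \<in> S \<longleftrightarrow> j \<in> T" if "j \<in> J" for j
    proof -
      have j: "j \<in> I" "h j \<in> H j" "\<phi> j (h j)" using that assms(4) \<phi> by auto
      then have "h j \<in> carrier F" using sub subgroup.mem_carrier by metis
      then show ?thesis using eq[of "h j"] \<Phi>(2)[of S j "h j"] \<Phi>(2)[of T j "h j"] ST j by (auto split: if_splits)
    qed
    then show "S = T" using ST(1,2) by blast
  qed
  ultimately have "card (Pow J) \<le> card (Pow (X - Z))"
    using assms(1) by (intro card_inj_on_le[of f]) auto
  then have "card J \<le> card (X - Z)" using assms(1,3) by (simp add: card_Pow)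
  moreover have "card (X - Z) + card Z = card X"
    using assms(1,6) by (simp add: card_Diff_subset finite_subset card_mono)
  ultimately show ?thesis by linarith
qed

lemma finite_factors:
  assumes "finite X" "factorization F I H" "\<And>i. i \<in> I \<Longrightarrow> H i \<noteq> {\<one>}"
  shows "finite I"
proof (rule ccontr)
  assume "infinite I"
  then obtain J where J: "finite J" "card J = Suc (card X)" "J \<subseteq> I"
    using infinite_arbitrarily_large by blast
  have "card J + card ({} :: 'a set) \<le> card X"
    by (rule factors_count[OF assms(1,2) J(1,3)]) (use J assms(3) in auto)
  then show False using J(2) by simp
qed

text \<open>The retraction onto \<open>H i\<close> that kills all other factors fixes
  \<open>g\<close> and also sends it to \<open>\<one>\<close>.\<close>

lemma factors_Int:
  assumes "factorization F I H" "i \<in> I" "j \<in> I" "i \<noteq> j" "g \<in> H i" "g \<in> H j"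
  shows "g = \<one>"
proof -
  have sub: "subgroup (H i) F" if "i \<in> I" for i using assms(1) that by (simp add: factorization_def)
  define \<psi> where "\<psi> l h = (if l = i then h else \<one>)" for l h
  have "\<psi> l \<in> hom (F\<lparr>carrier := H l\<rparr>) F" if "l \<in> I" for l
    using subgroup.mem_carrier[OF sub[OF that]] by (auto simp: hom_def \<psi>_def)
  then obtain \<Phi> where \<Phi>: "\<And>l h. l \<in> I \<Longrightarrow> h \<in> H l \<Longrightarrow> \<Phi> h = \<psi> l h"
    using factorization_universal[OF group_axioms assms(1) group_axioms, of \<psi>] by metis
  show ?thesis using \<Phi>[OF assms(2,5)] \<Phi>[OF assms(3,6)] assms(4) by (simp add: \<psi>_def)
qed

end

subsection \<open>The wedge of coset graphs of a factorization\<close>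

lemma (in based_group) card_L: assumes "finite X" shows "card L = 2 * card X"
proof -
  have "inj_on (m_inv F) X" by (rule inj_onI) (metis X_carrier' inv_inv)
  moreover have "X \<inter> m_inv F ` X = {}" using inv_notin_X by auto
  ultimately show ?thesis using assms by (simp add: pm_def card_Un_disjoint card_image)
qed

text \<open>The vertices of the wedge are the cosets of the factors, where the cosets \<open>H i\<close> themselves are
  all identified with the base point \<open>None\<close>. Only the finitely many edges used by the words in \<open>W i\<close>,
  read from the base point, are taken.\<close>

locale coset_wedge = based_group F X for F :: "('a, 'b) monoid_scheme" (structure) and X +
  fixes I :: "'i set" and H :: "'i \<Rightarrow> 'a set" and W :: "'i \<Rightarrow> 'a list set"
  assumes finite_X: "finite X" and fact: "factorization F I H" and finite_I: "finite I"
    and finite_W: "\<And>i. i \<in> I \<Longrightarrow> finite (W i)" and W_letters: "\<And>i w. i \<in> I \<Longrightarrow> w \<in> W i \<Longrightarrow> set w \<subseteq> L"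
    and W_generate: "\<And>d. d \<in> L \<Longrightarrow> \<exists>ws. word_prod F (map snd ws) = d \<and>
      (\<forall>(i, h)\<in>set ws. i \<in> I \<and> h \<in> H i \<and> (\<exists>w\<in>W i. word_prod F w = h))"
begin

lemma H_subgroup: "i \<in> I \<Longrightarrow> subgroup (H i) F"
  using fact by (simp add: factorization_def)

lemma H_carrier: "i \<in> I \<Longrightarrow> H i \<subseteq> carrier F"
  using H_subgroup subgroup.subset by blast

definition vt :: "'i \<Rightarrow> 'a set \<Rightarrow> ('i \<times> 'a set) option" where
  "vt i c = (if c = H i then None else Some (i, c))"

definition pos :: "'i \<Rightarrow> 'a list \<Rightarrow> ('i \<times> 'a set) option" where
  "pos i u = vt i (H i #> word_prod F u)"

definition wverts :: "('i \<times> 'a set) option set" where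
  "wverts = insert None {pos i u | i u v. i \<in> I \<and> u @ v \<in> W i}"

definition half_edges :: "(('i \<times> 'a set) option \<times> 'a \<times> ('i \<times> 'a set) option) set" where
  "half_edges = {(pos i u, d, pos i (u @ [d])) | i u d v. i \<in> I \<and> u @ d # v \<in> W i}"

definition wedges :: "(('i \<times> 'a set) option \<times> 'a \<times> ('i \<times> 'a set) option) set" where
  "wedges = half_edges \<union> (\<lambda>(v, d, w). (w, inv d, v)) ` half_edges"

lemma vt_eq: "vt i c = vt j c' \<Longrightarrow> (c = H i \<and> c' = H j) \<or> (i = j \<and> c = c')"
  by (auto simp: vt_def split: if_splits)

lemma pos_Nil: "i \<in> I \<Longrightarrow> pos i [] = None"
  using H_carrier by (simp add: pos_def vt_def)

lemma W_letters_append: "i \<in> I \<Longrightarrow> u @ v \<in> W i \<Longrightarrow> set u \<subseteq> L \<and> set v \<subseteq> L"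
  using W_letters by fastforce

text \<open>Each edge comes from the coset graph of one factor, in either orientation; at the base
  point the vertex alone does not reveal which.\<close>

lemma wedges_coset:
  assumes "(v, d, w) \<in> wedges"
  shows "d \<in> L \<and> (\<exists>i\<in>I. \<exists>g\<in>carrier F. v = vt i (H i #> g) \<and> w = vt i (H i #> (g \<otimes> d)))"
proof -
  have half: "e \<in> L \<and> (\<exists>i\<in>I. \<exists>g\<in>carrier F. p = vt i (H i #> g) \<and> q = vt i (H i #> (g \<otimes> e)))"
    if h: "(p, e, q) \<in> half_edges" for p e q
  proof -
    obtain i u z where i: "i \<in> I" "u @ e # z \<in> W i" "p = pos i u" "q = pos i (u @ [e])"
      using h unfolding half_edges_def by blast
    have s: "set u \<subseteq> L" "e \<in> L" using W_letters_append[OF i(1,2)] by auto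
    then have "word_prod F (u @ [e]) = word_prod F u \<otimes> e" by (simp add: word_prod_append)
    then show ?thesis using i s unfolding pos_def
      by (intro conjI bexI[of _ i] bexI[of _ "word_prod F u"]) auto
  qed
  from assms consider "(v, d, w) \<in> half_edges" | e where "(w, e, v) \<in> half_edges" "d = inv e"
    unfolding wedges_def by auto
  then show ?thesis
  proof cases
    case 1 then show ?thesis by (rule half)
  next
    case 2
    obtain i g where i: "e \<in> L" "i \<in> I" "g \<in> carrier F" "w = vt i (H i #> g)" "v = vt i (H i #> (g \<otimes> e))"
      using half[OF 2(1)] by blast
    then have "g \<otimes> e \<otimes> d = g" using 2(2) by (simp add: m_assoc)
    then show ?thesis using i 2(2) by (intro conjI bexI[of _ i] bexI[of _ "g \<otimes> e"]) auto
  qed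
qed

lemma pos_in_wverts: "i \<in> I \<Longrightarrow> u @ v \<in> W i \<Longrightarrow> pos i u \<in> wverts"
  unfolding wverts_def by blast

lemma pos_edge: "i \<in> I \<Longrightarrow> u @ d # v \<in> W i \<Longrightarrow> (pos i u, d, pos i (u @ [d])) \<in> wedges"
  unfolding wedges_def half_edges_def by blast

lemma wedges_sym: assumes "(v, d, w) \<in> wedges" shows "(w, inv d, v) \<in> wedges"
proof -
  from assms consider "(v, d, w) \<in> half_edges" | e where "(w, e, v) \<in> half_edges" "d = inv e"
    unfolding wedges_def by auto
  then show ?thesis
  proof cases
    case 1 then show ?thesis unfolding wedges_def by force
  next
    case 2
    then have "(w, e, v) \<in> wedges" by (simp add: wedges_def)
    then have "e \<in> L" using wedges_coset by blast
    then show ?thesis using 2 by (simp add: wedges_def)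
  qed
qed

lemma walk_pos:
  assumes "i \<in> I" "u @ v @ z \<in> W i"
  shows "walk wedges (pos i u) v (pos i (u @ v))"
  using assms(2)
proof (induction v arbitrary: u)
  case (Cons d v)
  have "(pos i u, d, pos i (u @ [d])) \<in> wedges" using pos_edge[OF assms(1), of u d "v @ z"] Cons.prems by simp
  moreover have "walk wedges (pos i (u @ [d])) v (pos i ((u @ [d]) @ v))" using Cons.IH[of "u @ [d]"] Cons.prems by simp
  ultimately show ?case by auto
qed simp

lemma finite_wverts: "finite wverts"
proof -
  have "{pos i u | i u v. i \<in> I \<and> u @ v \<in> W i} \<subseteq> (\<Union>i\<in>I. \<Union>w\<in>W i. (\<lambda>k. pos i (take k w)) ` {..length w})"
  proof
    fix p assume "p \<in> {pos i u | i u v. i \<in> I \<and> u @ v \<in> W i}"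
    then obtain i u v where i: "i \<in> I" "u @ v \<in> W i" "p = pos i u" by blast
    then have "p = pos i (take (length u) (u @ v))" "length u \<in> {..length (u @ v)}" by auto
    then show "p \<in> (\<Union>i\<in>I. \<Union>w\<in>W i. (\<lambda>k. pos i (take k w)) ` {..length w})" using i(1,2) by blast
  qed
  moreover have "finite (\<Union>i\<in>I. \<Union>w\<in>W i. (\<lambda>k. pos i (take k w)) ` {..length w})"
    using finite_I finite_W by blast
  ultimately show ?thesis unfolding wverts_def using finite_subset by auto
qed

lemma wedges_subset: "wedges \<subseteq> wverts \<times> L \<times> wverts"
proof -
  have half: "half_edges \<subseteq> wverts \<times> wedges_L \<times> wverts" if L: "\<And>v d w. (v, d, w) \<in> half_edges \<Longrightarrow> d \<in> wedges_L" for wedges_L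
  proof
    fix e assume e: "e \<in> half_edges"
    then obtain i u d v where i: "i \<in> I" "u @ d # v \<in> W i" "e = (pos i u, d, pos i (u @ [d]))"
      unfolding half_edges_def by blast
    then show "e \<in> wverts \<times> wedges_L \<times> wverts"
      using pos_in_wverts[of i u "d # v"] pos_in_wverts[of i "u @ [d]" v] L e by auto
  qed
  have "half_edges \<subseteq> wverts \<times> UNIV \<times> wverts" by (rule half) simp
  then have "wedges \<subseteq> wverts \<times> UNIV \<times> wverts" unfolding wedges_def by auto
  then show ?thesis using wedges_coset by auto
qed

text \<open>A letter is a product of factor elements, and each of these labels a closed walk at the
  base point because \<open>H i #> h = H i\<close>.\<close>

lemma labelled_graph_wedge: "labelled_graph wverts wedges None"
  unfolding labelled_graph_def
proof (intro conjI allI impI ballI)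
  show "None \<in> wverts" by (simp add: wverts_def)
  show "\<exists>ds. walk wedges None ds v" if v: "v \<in> wverts" for v
  proof (cases "v = None")
    case True
    then show ?thesis by (intro exI[of _ "[]"]) simp
  next
    case False
    then obtain i u z where i: "i \<in> I" "u @ z \<in> W i" "v = pos i u" using v unfolding wverts_def by blast
    then show ?thesis using walk_pos[of i "[]" u z] pos_Nil[OF i(1)] by auto
  qed
  fix d assume "d \<in> L"
  then obtain ws where ws: "word_prod F (map snd ws) = d"
    "\<forall>(i, h)\<in>set ws. i \<in> I \<and> h \<in> H i \<and> (\<exists>w\<in>W i. word_prod F w = h)" using W_generate by blast
  have "\<exists>ds. set ds \<subseteq> L \<and> walk wedges None ds None \<and> word_prod F ds = word_prod F (map snd ws)"
    using ws(2)
  proof (induction ws)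
    case Nil
    show ?case by (intro exI[of _ "[]"]) simp
  next
    case (Cons a ws)
    obtain i h where a: "a = (i, h)" by (cases a)
    then obtain w where w: "i \<in> I" "h \<in> H i" "w \<in> W i" "word_prod F w = h" using Cons.prems by auto
    obtain ds where ds: "set ds \<subseteq> L" "walk wedges None ds None" "word_prod F ds = word_prod F (map snd ws)"
      using Cons by auto
    have wL: "set w \<subseteq> L" using W_letters w by blast
    have "H i #> h = H i" using coset_join2[OF _ H_subgroup[OF w(1)] w(2)] w H_carrier by blast
    then have "pos i w = None" using w(4) by (simp add: pos_def vt_def)
    then have "walk wedges None w None" using walk_pos[of i "[]" w "[]"] w pos_Nil by simp
    then have "walk wedges None (w @ ds) None" using ds(2) by (auto simp: walk_append)
    then show ?case using ds wL a w by (intro exI[of _ "w @ ds"]) (simp add: word_prod_append)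
  qed
  then show "\<exists>ds. set ds \<subseteq> L \<and> walk wedges None ds None \<and> word_prod F ds = d" using ws(1) by simp
qed (use finite_wverts wedges_subset wedges_sym in auto)

text \<open>A set \<open>f\<close> of edges determines homomorphisms from the factors to the group of order two, hence one
  from \<open>F\<close>; it can be recovered from the values of the latter on \<open>X\<close> and from the parities along one
  chosen path to each vertex.\<close>

lemma wedge_card: "card wedges + 2 \<le> 2 * card wverts + card L"
proof -
  \<comment> \<open>One orientation of each edge; the other is obtained by reversal.\<close>
  define E where "E = {e \<in> wedges. fst (snd e) \<in> X}"
  have finW: "finite wedges" using finite_labelled_graph(1)[OF finite_X labelled_graph_wedge] .
  then have finE: "finite E" by (simp add: E_def)
  have "wedges \<subseteq> E \<union> (\<lambda>(v, d, w). (w, inv d, v)) ` E"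
  proof
    fix e assume e: "e \<in> wedges"
    obtain v d w where e': "e = (v, d, w)" by (cases e)
    have dL: "d \<in> L" using wedges_coset e e' by blast
    show "e \<in> E \<union> (\<lambda>(v, d, w). (w, inv d, v)) ` E"
    proof (cases "d \<in> X")
      case False
      then have "inv d \<in> X" using dL by (auto simp: pm_def)
      then have "(w, inv d, v) \<in> E" using wedges_sym e e' by (simp add: E_def)
      then have "(\<lambda>(v, d, w). (w, inv d, v)) (w, inv d, v) \<in> (\<lambda>(v, d, w). (w, inv d, v)) ` E" by blast
      then show ?thesis using e' dL by simp
    qed (use e e' in \<open>simp add: E_def\<close>)
  qed
  then have "card wedges \<le> card (E \<union> (\<lambda>(v, d, w). (w, inv d, v)) ` E)"
    using finE by (intro card_mono) auto
  also have "\<dots> \<le> card E + card ((\<lambda>(v, d, w). (w, inv d, v)) ` E)" by (rule card_Un_le)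
  also have "\<dots> \<le> 2 * card E" using card_image_le[OF finE] by simp
  finally have cW: "card wedges \<le> 2 * card E" .

  define P where "P f i par \<longleftrightarrow> (\<forall>c x. c \<subseteq> carrier F \<longrightarrow> x \<in> X \<longrightarrow> par c x = ((vt i c, x, vt i (c #> x)) \<in> f)) \<and>
    (\<forall>c g h. c \<subseteq> carrier F \<longrightarrow> g \<in> carrier F \<longrightarrow> h \<in> carrier F \<longrightarrow>
       par c (g \<otimes> h) = (par c g \<noteq> par (c #> g) h))" for f i par
  define par where "par f i = (SOME p. P f i p)" for f i
  have "\<exists>p. P f i p" for f i unfolding P_def by (rule coset_parity)
  then have "P f i (par f i)" for f i unfolding par_def by (rule someI_ex)
  then have par: "\<And>f i c x. c \<subseteq> carrier F \<Longrightarrow> x \<in> X \<Longrightarrow> par f i c x = ((vt i c, x, vt i (c #> x)) \<in> f)"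
    "\<And>f i c g h. c \<subseteq> carrier F \<Longrightarrow> g \<in> carrier F \<Longrightarrow> h \<in> carrier F \<Longrightarrow>
       par f i c (g \<otimes> h) = (par f i c g \<noteq> par f i (c #> g) h)" unfolding P_def by blast+
  have par1: "\<not> par f i c \<one>" if "c \<subseteq> carrier F" for f i c using par(2)[OF that, of \<one> \<one>] that by simp
  have "par f i (H i) \<in> hom (F\<lparr>carrier := H i\<rparr>) parity_group" if i: "i \<in> I" for f i
  proof (rule homI; simp)
    fix g h assume "g \<in> H i" "h \<in> H i"
    then show "par f i (H i) (g \<otimes> h) = (par f i (H i) g = (\<not> par f i (H i) h))"
      using par(2)[OF H_carrier[OF i], of g h f i] coset_join2[OF _ H_subgroup[OF i], of g] H_carrier[OF i] by auto
  qed
  then have "\<exists>\<Phi>. \<Phi> \<in> hom F parity_group \<and> (\<forall>i\<in>I. \<forall>h\<in>H i. \<Phi> h = par f i (H i) h)" for f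
    using factorization_universal[OF group_axioms fact group_parity, of "\<lambda>i. par f i (H i)"] by metis
  then obtain \<Phi> where \<Phi>: "\<And>f. \<Phi> f \<in> hom F parity_group" "\<And>f i h. i \<in> I \<Longrightarrow> h \<in> H i \<Longrightarrow> \<Phi> f h = par f i (H i) h"
    by metis

  \<comment> \<open>A representative of the coset at a vertex stands for a path from the base point.
    At the base point it is \<open>\<one>\<close>, whichever factor is considered.\<close>
  define rep where "rep i v = (case v of None \<Rightarrow> \<one> | Some (j, c) \<Rightarrow> SOME g. g \<in> carrier F \<and> H j #> g = c)" for i :: 'i and v
  have rep: "rep i (vt i (H i #> g)) \<in> carrier F \<and> H i #> rep i (vt i (H i #> g)) = H i #> g"
    if "i \<in> I" "g \<in> carrier F" for i g
  proof (cases "H i #> g = H i")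
    case True
    then show ?thesis using H_carrier[OF that(1)] by (simp add: rep_def vt_def)
  next
    case False
    have "(SOME g'. g' \<in> carrier F \<and> H i #> g' = H i #> g) \<in> carrier F \<and>
      H i #> (SOME g'. g' \<in> carrier F \<and> H i #> g' = H i #> g) = H i #> g"
      by (rule someI[of _ g]) (use that in simp)
    then show ?thesis using False by (simp add: rep_def vt_def)
  qed
  have rep_None: "rep i None = \<one>" for i by (simp add: rep_def)
  define q where "q f v = (case v of None \<Rightarrow> False | Some (i, c) \<Rightarrow> par f i (H i) (rep i v))" for f v
  have q: "q f (vt i c) = par f i (H i) (rep i (vt i c))" if "i \<in> I" for f i c
    using par1[OF H_carrier[OF that]] by (simp add: q_def vt_def rep_None)
  \<comment> \<open>The path to \<open>v\<close>, the edge and the path back from \<open>w\<close>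
    form a loop in the coset graph of \<open>H i\<close>, whose parity is a value of
    \<open>\<Phi> f\<close>. Removing the parities of the two paths tells whether the edge lies in
    \<open>f\<close>.\<close>
  have edge: "(v, x, w) \<in> f \<longleftrightarrow> (\<Phi> f (rep i v \<otimes> x \<otimes> inv (rep i w)) \<noteq> q f v) \<noteq> q f w"
    if i: "i \<in> I" "g \<in> carrier F" "x \<in> X" "v = vt i (H i #> g)" "w = vt i (H i #> (g \<otimes> x))" for v x w f i g
  proof -
    have xc: "x \<in> carrier F" "g \<otimes> x \<in> carrier F" using i by auto
    define a b where "a = rep i v" and "b = rep i w"
    have a: "a \<in> carrier F" "H i #> a = H i #> g" using rep[OF i(1,2)] i(4) by (auto simp: a_def)
    have b: "b \<in> carrier F" "H i #> b = H i #> (g \<otimes> x)" using rep[OF i(1) xc(2)] i(5) by (auto simp: b_def)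
    have Hc: "H i \<subseteq> carrier F" using H_carrier i by blast
    have "H i #> (a \<otimes> x) = H i #> b" using a b xc i Hc by (simp add: coset_mult_assoc[symmetric])
    then have "H i #> (a \<otimes> x \<otimes> inv b) = H i" using a b xc Hc by (intro coset_mult_inv2) auto
    then have h: "a \<otimes> x \<otimes> inv b \<in> H i"
      by (rule coset_join1[OF _ _ H_subgroup[OF i(1)]]) (use a b xc in auto)
    have "par f i (H i) (a \<otimes> x \<otimes> inv b \<otimes> b) = (par f i (H i) (a \<otimes> x \<otimes> inv b) \<noteq> par f i (H i #> (a \<otimes> x \<otimes> inv b)) b)"
      using a b xc Hc by (intro par(2)) auto
    then have 1: "par f i (H i) (a \<otimes> x) = (\<Phi> f (a \<otimes> x \<otimes> inv b) \<noteq> par f i (H i) b)"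
      using \<open>H i #> (a \<otimes> x \<otimes> inv b) = H i\<close> \<Phi>(2)[OF i(1) h, of f] a b xc by (simp add: m_assoc)
    have 2: "par f i (H i) (a \<otimes> x) = (par f i (H i) a \<noteq> par f i (H i #> a) x)"
      using a xc Hc by (intro par(2)) auto
    have "par f i (H i #> a) x = ((vt i (H i #> a), x, vt i (H i #> a #> x)) \<in> f)"
      using par(1)[of "H i #> a" x f i] a i Hc by simp
    also have "\<dots> \<longleftrightarrow> (v, x, w) \<in> f"
      using i a xc Hc by (simp add: coset_mult_assoc)
    finally have 3: "par f i (H i #> a) x \<longleftrightarrow> (v, x, w) \<in> f" .
    have 4: "q f v = par f i (H i) a" "q f w = par f i (H i) b" using q[OF i(1)] i(4,5) by (auto simp: a_def b_def)
    show ?thesis unfolding a_def[symmetric] b_def[symmetric] 4 using 1 2 3 by blast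
  qed
  \<comment> \<open>One bit per letter and one per vertex other than the base point, where
    \<open>q\<close> is always \<open>False\<close>.\<close>
  define code where "code f = ({x \<in> X. \<Phi> f x}, {v \<in> wverts - {None}. q f v})" for f
  have "inj_on code (Pow E)"
  proof (rule inj_onI)
    fix f f' assume f: "f \<in> Pow E" "f' \<in> Pow E" "code f = code f'"
    have "\<Phi> f x = \<Phi> f' x" if "x \<in> X" for x using f(3) that by (auto simp: code_def)
    then have eq\<Phi>: "\<Phi> f g = \<Phi> f' g" if "g \<in> carrier F" for g
      using hom_eq_on_basis[OF group_parity \<Phi>(1) \<Phi>(1)] that by blast
    have eqq: "q f v = q f' v" if "v \<in> wverts" for v
    proof (cases "v = None")
      case False
      have "{v \<in> wverts - {None}. q f v} = {v \<in> wverts - {None}. q f' v}" using f(3) by (simp add: code_def)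
      then show ?thesis using that False by blast
    qed (simp add: q_def)
    have "e \<in> f \<longleftrightarrow> e \<in> f'" if e: "e \<in> E" for e
    proof -
      obtain v x w where e': "e = (v, x, w)" by (cases e)
      then have vw: "(v, x, w) \<in> wedges" "x \<in> X" using e by (auto simp: E_def)
      then have "v \<in> wverts" "w \<in> wverts" using wedges_subset by auto
      obtain i g where i: "i \<in> I" "g \<in> carrier F" "v = vt i (H i #> g)" "w = vt i (H i #> (g \<otimes> x))"
        using wedges_coset[OF vw(1)] by blast
      have "rep i v \<in> carrier F" "rep i w \<in> carrier F" using rep[OF i(1)] i vw(2) by auto
      then have "\<Phi> f (rep i v \<otimes> x \<otimes> inv (rep i w)) = \<Phi> f' (rep i v \<otimes> x \<otimes> inv (rep i w))"
        using vw(2) by (intro eq\<Phi>) auto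
      then show ?thesis
        unfolding e' edge[OF i(1,2) vw(2) i(3,4)] using eqq \<open>v \<in> wverts\<close> \<open>w \<in> wverts\<close> by simp
    qed
    then show "f = f'" using f(1,2) by blast
  qed
  moreover have "code ` Pow E \<subseteq> Pow X \<times> Pow (wverts - {None})" by (auto simp: code_def)
  ultimately have "card (Pow E) \<le> card (Pow X \<times> Pow (wverts - {None}))"
    using finite_X finite_wverts by (intro card_inj_on_le) auto
  then have "2 ^ card E \<le> (2 :: nat) ^ (card X + card (wverts - {None}))"
    using finE finite_X finite_wverts by (simp add: card_Pow card_cartesian_product power_add)
  then have "card E \<le> card X + card (wverts - {None})" by simp
  moreover have "card (wverts - {None}) + 1 = card wverts"
    using card_Suc_Diff1[OF finite_wverts, of None] by (simp add: wverts_def)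
  ultimately show ?thesis using cW card_L[OF finite_X] by linarith
qed

end

subsection \<open>The factorization given by a partition of a basis\<close>

context based_group begin

lemma generate_signed_word:
  assumes "g \<in> generate F Y" and that: "Y \<subseteq> X"
  shows "\<exists>s\<in>lists (Y \<times> UNIV). word_prod F (map (signed_letter F) s) = g"
  using assms(1)
proof induction
  case one
  show ?case by (intro bexI[of _ "[]"]) auto
next
  case (incl h)
  then have "h \<in> carrier F" using that by auto
  then show ?case using incl by (intro bexI[of _ "[(h, True)]"]) (auto simp: signed_letter_def)
next
  case (inv h)
  then have "h \<in> carrier F" using that by auto
  then show ?case using inv by (intro bexI[of _ "[(h, False)]"]) (auto simp: signed_letter_def)
next
  case (eng h1 h2)
  then obtain s t where st: "s \<in> lists (Y \<times> UNIV)" "word_prod F (map (signed_letter F) s) = h1"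
    "t \<in> lists (Y \<times> UNIV)" "word_prod F (map (signed_letter F) t) = h2" by blast
  have "set (map (signed_letter F) s) \<subseteq> carrier F" "set (map (signed_letter F) t) \<subseteq> carrier F"
    using st(1,3) that by (fastforce simp: signed_letter_def)+
  then have "word_prod F (map (signed_letter F) (s @ t)) = h1 \<otimes> h2" using st by (simp add: word_prod_append)
  then show ?case using st(1,3) by (intro bexI[of _ "s @ t"]) auto
qed

text \<open>Every word over the factors is congruent to one whose syllables are single signed
  letters. For such words a free cancellation takes place inside one factor, so equal products give
  congruent words by freeness of the basis.\<close>

lemma partition_factorization:
  assumes P: "partition_on X P"
  shows "factorization F P (generate F)"
proof -
  have YX: "Y \<subseteq> X" if "Y \<in> P" for Y using P that by (auto simp: partition_on_def)
  have sub: "subgroup (generate F Y) F" if "Y \<in> P" for Y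
    using YX[OF that] X_carrier by (intro generate_is_subgroup) auto
  interpret fp: presentation F "fp_alphabet P (generate F)" "fp_rels F P (generate F)" snd
    by (rule fp_presentation[OF group_axioms sub])
  let ?B = "fp_alphabet P (generate F)" and ?T = "fp_rels F P (generate F)"
  have "\<exists>Y. Y \<in> P \<and> x \<in> Y" if "x \<in> X" for x using P that by (auto simp: partition_on_def)
  then obtain part where part: "\<And>x. x \<in> X \<Longrightarrow> part x \<in> P \<and> x \<in> part x" by metis
  have part_eq: "part x = Y" if "Y \<in> P" "x \<in> Y" for x Y
    using part[of x] YX[OF that(1)] that P by (auto simp: partition_on_def pairwise_def disjnt_def)
  \<comment> \<open>A letter belongs to exactly one part, so it can be read as an element of a
    definite factor.\<close>
  define m where "m a = (part (fst a), signed_letter F a)" for a :: "'a \<times> bool"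
  have lg: "signed_letter F (x, b) \<in> generate F Y" if "x \<in> Y" for x b Y
    using that by (auto simp: signed_letter_def generate.incl generate.inv)
  have mB: "m a \<in> ?B" if "a \<in> X \<times> UNIV" for a
    using that part lg[of "fst a" "part (fst a)" "snd a"] by (auto simp: m_def)
  have joinY: "([(Y, a), (Y, b)], [(Y, a \<otimes> b)]) \<in> word_cong ?B ?T"
    if "Y \<in> P" "a \<in> generate F Y" "b \<in> generate F Y" for Y a b
    by (rule word_cong_rel) (use that generate.eng[of a F Y b] in auto)
  have oneY: "([(Y, \<one>)], []) \<in> word_cong ?B ?T" if "Y \<in> P" for Y
    by (rule word_cong_rel) (use that generate.one[of F Y] in auto)
  have letter: "word_prod F (map (signed_letter F) s) \<in> generate F Y \<and>
      ([(Y, word_prod F (map (signed_letter F) s))], map m s) \<in> word_cong ?B ?T"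
    if Y: "Y \<in> P" and s: "s \<in> lists (Y \<times> UNIV)" for Y s
    using s
  proof (induction s)
    case Nil
    then show ?case using oneY[OF Y] generate.one[of F Y] by simp
  next
    case (Cons a s)
    obtain x b where a: "a = (x, b)" by (cases a)
    have x: "x \<in> Y" using Cons a by auto
    let ?g = "word_prod F (map (signed_letter F) s)"
    have g: "?g \<in> generate F Y" "([(Y, ?g)], map m s) \<in> word_cong ?B ?T" using Cons by auto
    have m: "m a = (Y, signed_letter F a)" using part_eq[OF Y x] a by (simp add: m_def)
    have "([(Y, signed_letter F a \<otimes> ?g)], [(Y, signed_letter F a), (Y, ?g)]) \<in> word_cong ?B ?T"
      using word_cong_sym[OF joinY[OF Y lg[OF x] g(1)]] a by simp
    moreover have "([(Y, signed_letter F a)] @ [(Y, ?g)], [(Y, signed_letter F a)] @ map m s) \<in> word_cong ?B ?T"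
      by (rule word_cong_cong[OF word_cong_refl g(2)]) (use Y lg[OF x] a in auto)
    ultimately show ?case
      using word_cong_trans generate.eng[OF lg[OF x] g(1)] a m by fastforce
  qed
  have expand: "\<exists>s\<in>lists (X \<times> UNIV). word_prod F (map (signed_letter F) s) = word_prod F (map snd w) \<and>
      (w, map m s) \<in> word_cong ?B ?T" if "w \<in> lists ?B" for w
    using that
  proof (induction w)
    case Nil
    show ?case by (intro bexI[of _ "[]"]) (auto intro: word_cong_refl)
  next
    case (Cons a w)
    obtain Y g where a: "a = (Y, g)" by (cases a)
    have Y: "Y \<in> P" "g \<in> generate F Y" using Cons a by auto
    obtain s where s: "s \<in> lists (Y \<times> UNIV)" "word_prod F (map (signed_letter F) s) = g"
      using generate_signed_word[OF Y(2) YX[OF Y(1)]] by blast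
    obtain t where t: "t \<in> lists (X \<times> UNIV)" "word_prod F (map (signed_letter F) t) = word_prod F (map snd w)"
      "(w, map m t) \<in> word_cong ?B ?T" using Cons by auto
    have s': "s \<in> lists (X \<times> UNIV)" using s(1) YX[OF Y(1)] by auto
    have "([a] @ w, map m s @ map m t) \<in> word_cong ?B ?T"
      using letter[OF Y(1) s(1)] t(3) s(2) a by (intro word_cong_cong) auto
    moreover have "set (map (signed_letter F) s) \<subseteq> carrier F" "set (map (signed_letter F) t) \<subseteq> carrier F"
      using s' t(1) by (fastforce simp: signed_letter_def)+
    ultimately show ?case using s' t(1,2) s(2) a
      by (intro bexI[of _ "s @ t"]) (auto simp: word_prod_append)
  qed
  have B: "\<forall>g\<in>carrier F. \<exists>w\<in>lists (X \<times> UNIV). word_prod F (map (signed_letter F) w) = g"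
    "\<And>u v. u \<in> lists (X \<times> UNIV) \<Longrightarrow> v \<in> lists (X \<times> UNIV) \<Longrightarrow>
       word_prod F (map (signed_letter F) u) = word_prod F (map (signed_letter F) v) \<Longrightarrow>
       (u, v) \<in> word_cong (X \<times> UNIV) (free_rels X)"
    using basis unfolding free_basis_iff[OF group_axioms] by blast+
  show ?thesis
    unfolding factorization_iff[OF group_axioms]
  proof (intro conjI ballI impI)
    fix g assume "g \<in> carrier F"
    then obtain w where w: "w \<in> lists (X \<times> UNIV)" "word_prod F (map (signed_letter F) w) = g" using B(1) by blast
    have "set (map m w) \<subseteq> ?B"
      unfolding set_map using w(1) mB by (intro image_subsetI) (metis in_lists_iff_subset subsetD)
    then have "map m w \<in> lists ?B" by simp
    moreover have "map snd (map m w) = map (signed_letter F) w" by (simp add: m_def)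
    ultimately show "\<exists>w\<in>lists ?B. word_prod F (map snd w) = g" using w(2) by metis
  next
    fix u v assume uv: "u \<in> lists ?B" "v \<in> lists ?B" "word_prod F (map snd u) = word_prod F (map snd v)"
    obtain s where s: "s \<in> lists (X \<times> UNIV)" "word_prod F (map (signed_letter F) s) = word_prod F (map snd u)"
      "(u, map m s) \<in> word_cong ?B ?T" using expand[OF uv(1)] by blast
    obtain t where t: "t \<in> lists (X \<times> UNIV)" "word_prod F (map (signed_letter F) t) = word_prod F (map snd v)"
      "(v, map m t) \<in> word_cong ?B ?T" using expand[OF uv(2)] by blast
    have st: "(s, t) \<in> word_cong (X \<times> UNIV) (free_rels X)"
      by (rule B(2)[OF s(1) t(1)]) (simp add: s(2) t(2) uv(3))
    have mid: "(map m s, map m t) \<in> word_cong ?B ?T"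
    proof (rule word_cong_map[OF mB _ st])
      fix l r assume "(l, r) \<in> free_rels X"
      then obtain x b where x: "l = [(x, b), (x, \<not> b)]" "r = []" "x \<in> X" by auto
      have p: "part x \<in> P" "x \<in> part x" using part[OF x(3)] by auto
      have "signed_letter F (x, b) \<otimes> signed_letter F (x, \<not> b) = \<one>" using x(3) by (simp add: signed_letter_def)
      then have "([(part x, signed_letter F (x, b)), (part x, signed_letter F (x, \<not> b))], [(part x, \<one>)]) \<in> word_cong ?B ?T"
        using joinY[OF p(1) lg[OF p(2), of b] lg[OF p(2), of "\<not> b"]] by simp
      then show "(map m l, map m r) \<in> word_cong ?B ?T"
        using word_cong_trans[OF _ oneY[OF p(1)]] x by (simp add: m_def)
    qed
    show "(u, v) \<in> word_cong ?B ?T"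
      by (rule word_cong_trans[OF word_cong_trans[OF s(3) mid] word_cong_sym[OF t(3)]])
  qed (use sub in auto)
qed

lemma support_partition_allocating:
  assumes R: "R \<subseteq> elts_and_classes F (carrier F - {\<one>})"
  shows "allocating F R (support_partition F X R) (generate F)"
  unfolding allocating_def
proof (intro conjI ballI subsetI)
  let ?P = "support_partition F X R"
  note fin = support_partition_finest[OF R]
  show "factorization F ?P (generate F)" using partition_factorization[OF fin(1)] .
  show "generate F Y \<noteq> {\<one>}" if Y: "Y \<in> ?P" for Y
  proof -
    obtain x where "x \<in> Y" "x \<in> X" using part_subset[OF R Y] by blast
    then show ?thesis using one_notin_X generate.incl[of x Y F] by auto
  qed
  fix r assume r: "r \<in> R"
  then obtain Y where Y: "Y \<in> ?P" "support F X r \<subseteq> Y" using fin(2) by (auto simp: includes_supports_def)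
  note YX = part_subset(1)[OF R Y(1)]
  have rn: "nontriv r" using r R by blast
  obtain xs where xs: "normal_word F X r xs" using normal_word_exists[OF rn] .
  have "set xs \<subseteq> pm F Y" using normal_word_letters[OF xs] pm_mono[OF Y(2)] by blast
  then have g: "word_prod F xs \<in> generate F Y" using generate_iff_word[of Y] YX X_carrier by blast
  from rn have "r \<in> elts_and_classes F (generate F Y)"
  proof (cases rule: nontriv_cases)
    case (Elt g')
    then show ?thesis using xs g by (auto simp: elts_and_classes_def normal_word_iff)
  next
    case (Cls g')
    then have "conj_class F (word_prod F xs) = conj_class F g'"
      using xs by (intro conj_class_eq) (auto simp: normal_word_iff)
    then show ?thesis using Cls g by (auto simp: elts_and_classes_def)
  qed
  then show "r \<in> (\<Union>Y\<in>?P. elts_and_classes F (generate F Y))" using Y(1) by blast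
qed

end

text \<open>In a refinement of the same size each factor has exactly one part.\<close>

lemma maximal_atomic:
  fixes F :: "('a, 'b) monoid_scheme" and I :: "'i set" and H :: "'i \<Rightarrow> 'a set"
  assumes "group F" "allocating F R I H" "finite I"
    and max: "\<And>(J :: 'j set) K. allocating F R J K \<Longrightarrow> finite J \<and> card J \<le> card I"
  shows "atomic TYPE('j) F R I H"
  unfolding atomic_def
proof (rule notI, elim exE conjE)
  fix J :: "'j set" and p K
  assume pr: "proper_refinement F I H J p K" and al: "allocating F R J K"
  interpret group F by fact
  have ref: "p ` J \<subseteq> I" "\<And>i. i \<in> I \<Longrightarrow> factorization (F\<lparr>carrier := H i\<rparr>) {j \<in> J. p j = i} K"
    using pr by (auto simp: proper_refinement_def refinement_def)
  have sub: "subgroup (H i) F" if "i \<in> I" for i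
    using assms(2) that by (auto simp: allocating_def factorization_def)
  have words: "\<exists>w\<in>lists (fp_alphabet {j \<in> J. p j = i} K). word_prod F (map snd w) = g"
    and Ksub: "\<And>j. j \<in> J \<Longrightarrow> p j = i \<Longrightarrow> subgroup (K j) (F\<lparr>carrier := H i\<rparr>)"
    if i: "i \<in> I" and g: "g \<in> H i" for i g
  proof -
    have gr: "group (F\<lparr>carrier := H i\<rparr>)" using subgroup_imp_group[OF sub[OF i]] .
    show "\<exists>w\<in>lists (fp_alphabet {j \<in> J. p j = i} K). word_prod F (map snd w) = g"
      "\<And>j. j \<in> J \<Longrightarrow> p j = i \<Longrightarrow> subgroup (K j) (F\<lparr>carrier := H i\<rparr>)"
      using ref(2)[OF i] g unfolding factorization_iff[OF gr] word_prod_consistent by auto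
  qed
  \<comment> \<open>A factor without parts would consist of the empty product alone, which an
    allocating factorization excludes.\<close>
  have "I \<subseteq> p ` J"
  proof
    fix i assume i: "i \<in> I"
    show "i \<in> p ` J"
    proof (rule ccontr)
      assume "i \<notin> p ` J"
      then have e: "{j \<in> J. p j = i} = {}" by auto
      have "g = \<one>\<^bsub>F\<^esub>" if g: "g \<in> H i" for g
      proof -
        obtain w where w: "w \<in> lists (fp_alphabet {j \<in> J. p j = i} K)" "word_prod F (map snd w) = g"
          using words[OF i g] by blast
        then have "w = []" unfolding e by simp
        then show ?thesis using w(2) by simp
      qed
      then have "H i \<subseteq> {\<one>\<^bsub>F\<^esub>}" by blast
      then have "H i = {\<one>\<^bsub>F\<^esub>}" using subgroup.one_closed[OF sub[OF i]] by blast
      then show False using assms(2) i by (auto simp: allocating_def)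
    qed
  qed
  then have pJ: "p ` J = I" using ref(1) by blast
  have J: "finite J" "card J \<le> card I" using max[OF al] by auto
  then have "card (p ` J) = card J" using card_image_le[OF J(1), of p] pJ by simp
  then have inj: "inj_on p J" by (rule eq_card_imp_inj_on[OF J(1)])
  have "K j = H (p j)" if j: "j \<in> J" for j
  proof
    have i: "p j \<in> I" using pJ j by blast
    have one: "\<one>\<^bsub>F\<^esub> \<in> H (p j)" using subgroup.one_closed[OF sub[OF i]] .
    have s: "subgroup (K j) (F\<lparr>carrier := H (p j)\<rparr>)" using Ksub[OF i one j] by simp
    then show "K j \<subseteq> H (p j)" using subgroup.subset by fastforce
    have "{j' \<in> J. p j' = p j} = {j}" using inj j by (auto simp: inj_on_def)
    then have w: "\<exists>w\<in>lists ({j} \<times> K j). word_prod F (map snd w) = g" if "g \<in> H (p j)" for g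
      using words[OF i that] by (simp add: Sigma_def)
    have "word_prod F (map snd w) \<in> K j" if "w \<in> lists ({j} \<times> K j)" for w
      using that
    proof (induction w)
      case Nil
      then show ?case using subgroup.one_closed[OF s] by simp
    next
      case (Cons a w)
      then show ?case using subgroup.m_closed[OF s, of "snd a"] by auto
    qed
    then show "H (p j) \<subseteq> K j" using w by blast
  qed
  then show False using pr inj pJ by (auto simp: proper_refinement_def bij_betw_def)
qed

subsection \<open>Maximality of the output\<close>

context based_group begin

text \<open>Finitely many letters of \<open>X\<close> suffice to write down
  \<open>X\<^sub>0\<close>. The exponent sum of a further letter would vanish on
  \<open>X\<^sub>0\<close>, hence on all of \<open>F\<close>, and so on that letter itself.\<close>

lemma finite_basis:
  assumes "finite X\<^sub>0" "free_basis F X\<^sub>0"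
  shows "finite X"
proof -
  interpret B: based_group F X\<^sub>0 using assms(2) by unfold_locales
  have "\<exists>xs. set xs \<subseteq> L \<and> word_prod F xs = y" if y: "y \<in> X\<^sub>0" for y
    using word_exists[of y] y by auto
  then obtain w where w: "\<And>y. y \<in> X\<^sub>0 \<Longrightarrow> set (w y) \<subseteq> L \<and> word_prod F (w y) = y" by metis
  define Z where "Z = (\<Union>y\<in>X\<^sub>0. set (w y) \<union> m_inv F ` set (w y))"
  have "X \<subseteq> Z"
  proof
    fix x assume x: "x \<in> X"
    show "x \<in> Z"
    proof (rule ccontr)
      assume "x \<notin> Z"
      obtain \<epsilon> :: "'a \<Rightarrow> int" where e: "\<epsilon> x = 1" "\<And>y. y \<in> X \<Longrightarrow> y \<noteq> x \<Longrightarrow> \<epsilon> y = 0" "\<epsilon> \<one> = 0"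
        "\<And>g h. g \<in> carrier F \<Longrightarrow> h \<in> carrier F \<Longrightarrow> \<epsilon> (g \<otimes> h) = \<epsilon> g + \<epsilon> h"
        "\<And>g. g \<in> carrier F \<Longrightarrow> \<epsilon> (inv g) = - \<epsilon> g"
        by (rule counting[OF x]) blast
      have words: "\<epsilon> (word_prod F ds) = 0" if "set ds \<subseteq> carrier F" "\<And>d. d \<in> set ds \<Longrightarrow> \<epsilon> d = 0" for ds
        using that by (induction ds) (use e in auto)
      have y0: "\<epsilon> y = 0" if y: "y \<in> X\<^sub>0" for y
      proof -
        have "\<epsilon> d = 0" if d: "d \<in> set (w y)" for d
        proof -
          have dL: "d \<in> L" using w[OF y] d by auto
          have dZ: "d \<in> Z" "inv d \<in> Z" using d y unfolding Z_def by blast+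
          show ?thesis
          proof (cases "d \<in> X")
            case True
            then show ?thesis using e(2)[of d] dZ \<open>x \<notin> Z\<close> by metis
          next
            case False
            then have "inv d \<in> X" using dL by (auto simp: pm_def)
            then have "\<epsilon> (inv d) = 0" using e(2)[of "inv d"] dZ \<open>x \<notin> Z\<close> by metis
            then show ?thesis using e(5)[of d] dL by simp
          qed
        qed
        then have "\<epsilon> (word_prod F (w y)) = 0" using w[OF y] by (intro words) auto
        then show ?thesis using w[OF y] by simp
      qed
      obtain ds where ds: "set ds \<subseteq> B.L" "word_prod F ds = x" using B.word_exists[of x] x by auto
      have "\<epsilon> d = 0" if "d \<in> set ds" for d
      proof -
        have "d \<in> X\<^sub>0 \<or> (\<exists>y\<in>X\<^sub>0. d = inv y)" using ds(1) that by (auto simp: pm_def)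
        then show ?thesis using y0 e(5) by fastforce
      qed
      then have "\<epsilon> x = 0" using words[of ds] ds by auto
      then show False using e(1) by simp
    qed
  qed
  moreover have "finite Z" using assms(1) by (simp add: Z_def)
  ultimately show ?thesis by (rule finite_subset)
qed

text \<open>A normal word of an element or class allocated to \<open>H i\<close> labels a closed path in the coset graph
  of \<open>H i\<close>, starting at \<open>H i\<close> itself in the case of an element.\<close>

lemma closed_path_exists:
  assumes "subgroup H F" "r \<in> elts_and_classes F H" "normal_word F X r xs"
  shows "\<exists>\<kappa>. set \<kappa> \<subseteq> L \<and> H #> word_prod F \<kappa> #> word_prod F xs = H #> word_prod F \<kappa> \<and>
    ((\<exists>g. r = Elt g) \<longrightarrow> \<kappa> = [])"
proof -
  have Hc: "H \<subseteq> carrier F" using assms(1) by (rule subgroup.subset)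
  consider g where "r = Elt g" "g \<in> H" | h where "r = Cls (conj_class F h)" "h \<in> H"
    using assms(2) by (auto simp: elts_and_classes_def)
  then show ?thesis
  proof cases
    case 1
    then have "H #> word_prod F xs = H"
      using assms(3) coset_join2[OF _ assms(1)] Hc by (auto simp: normal_word_iff)
    then show ?thesis using Hc by (intro exI[of _ "[]"]) simp
  next
    case 2
    then obtain k where k: "k \<in> carrier F" "word_prod F xs = k \<otimes> h \<otimes> inv k"
      using assms(3) by (auto simp: normal_word_iff conj_class_def)
    have h: "h \<in> carrier F" using 2 Hc by blast
    obtain \<kappa> where \<kappa>: "set \<kappa> \<subseteq> L" "word_prod F \<kappa> = inv k" using word_exists[of "inv k"] k(1) by auto
    have "H #> inv k #> (k \<otimes> h \<otimes> inv k) = H #> (h \<otimes> inv k)"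
      using Hc k(1) h by (simp add: coset_mult_assoc m_assoc)
    also have "\<dots> = H #> inv k"
      using Hc k(1) h coset_join2[OF h assms(1) 2(2)] by (simp add: coset_mult_assoc[symmetric])
    finally show ?thesis using \<kappa> k(2) 2(1) by (intro exI[of _ \<kappa>]) auto
  qed
qed

text \<open>Two comparisons are added up: factors assigned by \<open>a\<close> to some
  \<open>r\<close> against parts that contain a support, and the remaining factors against the
  remaining parts, which include a singleton for every letter outside the supports.\<close>

lemma factorization_size:
  fixes I :: "'i set"
  assumes "finite X" "finite R" and R: "R \<subseteq> elts_and_classes F (carrier F - {\<one>})"
    and out: "reducible_parts F R X = {}" and al: "allocating F R I H"
  shows "finite I \<and> card I \<le> card (support_partition F X R)"
proof -
  let ?P = "support_partition F X R"
  have fact: "factorization F I H" and ne: "\<And>i. i \<in> I \<Longrightarrow> H i \<noteq> {\<one>}"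
    and sub: "\<And>i. i \<in> I \<Longrightarrow> subgroup (H i) F"
    using al by (auto simp: allocating_def factorization_def)
  have finI: "finite I" using finite_factors[OF assms(1) fact ne] .
  have "\<forall>r\<in>R. \<exists>i. i \<in> I \<and> r \<in> elts_and_classes F (H i)" using al by (auto simp: allocating_def)
  then obtain a where a: "\<And>r. r \<in> R \<Longrightarrow> a r \<in> I" "\<And>r. r \<in> R \<Longrightarrow> r \<in> elts_and_classes F (H (a r))" by metis
  have rn: "nontriv r" if "r \<in> R" for r using that R by blast
  have "\<exists>\<kappa>. set \<kappa> \<subseteq> L \<and> H (a r) #> word_prod F \<kappa> #> word_prod F xs = H (a r) #> word_prod F \<kappa> \<and>
    ((\<exists>g. r = Elt g) \<longrightarrow> \<kappa> = [])" if "r \<in> R" "normal_word F X r xs" for r xs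
    using closed_path_exists[OF sub[OF a(1)] a(2)] that by blast
  then obtain \<kappa> where \<kappa>: "\<And>r xs. r \<in> R \<Longrightarrow> normal_word F X r xs \<Longrightarrow> set (\<kappa> r xs) \<subseteq> L"
    "\<And>r xs. r \<in> R \<Longrightarrow> normal_word F X r xs \<Longrightarrow>
       H (a r) #> word_prod F (\<kappa> r xs) #> word_prod F xs = H (a r) #> word_prod F (\<kappa> r xs)"
    "\<And>r xs g. r \<in> R \<Longrightarrow> normal_word F X r xs \<Longrightarrow> r = Elt g \<Longrightarrow> \<kappa> r xs = []"
    by metis
  have "\<exists>ws. set ws \<subseteq> fp_alphabet I H \<and> word_prod F (map snd ws) = d" if d: "d \<in> L" for d
  proof -
    obtain ws where "ws \<in> lists (fp_alphabet I H)" "word_prod F (map snd ws) = d"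
      using fact L_carrier'[OF d] unfolding factorization_iff[OF group_axioms] by metis
    then show ?thesis by auto
  qed
  then obtain gw where gw: "\<And>d. d \<in> L \<Longrightarrow> set (gw d) \<subseteq> fp_alphabet I H" "\<And>d. d \<in> L \<Longrightarrow> word_prod F (map snd (gw d)) = d"
    by metis
  have "\<exists>w. set w \<subseteq> L \<and> word_prod F w = g" if "g \<in> carrier F" for g using word_exists[OF that] by metis
  then obtain \<omega> where \<omega>: "\<And>g. g \<in> carrier F \<Longrightarrow> set (\<omega> g) \<subseteq> L" "\<And>g. g \<in> carrier F \<Longrightarrow> word_prod F (\<omega> g) = g" by metis
  \<comment> \<open>The first words put the path of each normal word into the wedge. The others
    spell the factor elements whose products give the letters, which makes the wedge carry
    \<open>F\<close>.\<close>
  define W where "W i = (\<Union>r\<in>R. (\<lambda>xs. \<kappa> r xs @ xs) ` {xs. a r = i \<and> normal_word F X r xs}) \<union>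
    (\<Union>d\<in>L. \<omega> ` snd ` {p \<in> set (gw d). fst p = i})" for i
  have W_r: "\<kappa> r xs @ xs \<in> W (a r)" if "r \<in> R" "normal_word F X r xs" for r xs
    using that unfolding W_def by blast
  have finL: "finite L" using assms(1) by (simp add: pm_def)
  interpret wg: coset_wedge F X I H W
  proof unfold_locales
    show "finite (W i)" if "i \<in> I" for i
    proof -
      have "finite {xs. a r = i \<and> normal_word F X r xs}" if "r \<in> R" for r
        using finite_normal_words[OF assms(1) rn[OF that]] by (rule rev_finite_subset) auto
      then show ?thesis unfolding W_def using assms(2) finL by auto
    qed
    show "set w \<subseteq> L" if i: "i \<in> I" and w: "w \<in> W i" for i w
    proof -
      from w consider r xs where "r \<in> R" "normal_word F X r xs" "w = \<kappa> r xs @ xs"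
        | d h where "d \<in> L" "(i, h) \<in> set (gw d)" "w = \<omega> h" unfolding W_def by auto
      then show ?thesis
      proof cases
        case 1 then show ?thesis using \<kappa>(1) by (auto simp: normal_word_iff)
      next
        case 2
        then have "h \<in> H i" using gw(1) by blast
        then show ?thesis using \<omega>(1) 2(3) subgroup.mem_carrier[OF sub[OF i]] by blast
      qed
    qed
    show "\<exists>ws. word_prod F (map snd ws) = d \<and> (\<forall>(i, h)\<in>set ws. i \<in> I \<and> h \<in> H i \<and> (\<exists>w\<in>W i. word_prod F w = h))"
      if d: "d \<in> L" for d
    proof (intro exI[of _ "gw d"] conjI ballI)
      show "word_prod F (map snd (gw d)) = d" using gw(2)[OF d] .
      fix p assume p: "p \<in> set (gw d)"
      obtain i h where ih: "p = (i, h)" by (cases p)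
      then have i: "i \<in> I" "h \<in> H i" using p gw(1)[OF d] by auto
      have "\<omega> h \<in> W i" unfolding W_def using p ih d by force
      then show "case p of (i, h) \<Rightarrow> i \<in> I \<and> h \<in> H i \<and> (\<exists>w\<in>W i. word_prod F w = h)"
        using ih i \<omega>(2)[of h] subgroup.mem_carrier[OF sub[OF i(1)] i(2)] by auto
    qed
  qed (use assms(1) fact finI in auto)

  have loc: "\<exists>w. \<forall>r xs j. r \<in> R \<longrightarrow> support F X r \<subseteq> Y \<longrightarrow> normal_word F X r xs \<longrightarrow> j \<le> length xs \<longrightarrow>
      wg.pos (a r) (\<kappa> r xs @ take j xs) = w" if Y: "Y \<in> ?P" for Y
  proof -
    note YX = part_subset(1)[OF R Y]
    \<comment> \<open>The \<open>j\<close>th turn of a normal word is placed at the vertex reached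
      after the connecting word \<open>\<kappa> r xs\<close> and the first \<open>j\<close>
      letters.\<close>
    define T where "T = {(wg.pos (a r) (\<kappa> r xs @ take j xs), inv (extended F r xs ! j), extended F r xs ! Suc j) | r xs j.
      r \<in> R \<and> support F X r \<subseteq> Y \<and> normal_word F X r xs \<and> j \<le> length xs}"
    have TI: "(wg.pos (a r) (\<kappa> r xs @ take j xs), inv (extended F r xs ! j), extended F r xs ! Suc j) \<in> T"
      if "r \<in> R" "support F X r \<subseteq> Y" "normal_word F X r xs" "j \<le> length xs" for r xs j
      using that unfolding T_def by blast
    have closed: "wg.pos (a r) (\<kappa> r xs @ xs) = wg.pos (a r) (\<kappa> r xs)" if rx: "r \<in> R" "normal_word F X r xs" for r xs
    proof -
      have "set xs \<subseteq> L" using rx by (auto simp: normal_word_iff)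
      then show ?thesis unfolding wg.pos_def using \<kappa>(1,2)[OF rx] wg.H_carrier[OF a(1)[OF rx(1)]]
        by (simp add: word_prod_append coset_mult_assoc)
    qed
    have ET: "part_turns R Y = {(d, e). \<exists>v. (v, d, e) \<in> T}"
      unfolding part_turns_def turns_def T_def by blast
    have "\<exists>w. \<forall>v d e. (v, d, e) \<in> T \<longrightarrow> v = w"
    proof (rule turns_at_one_vertex[OF assms(1) wg.labelled_graph_wedge wg.wedge_card _ _ _ ET])
      show "d \<noteq> e \<and> v \<in> wg.wverts" if t: "(v, d, e) \<in> T" for v d e
      proof -
        obtain r xs j where r: "r \<in> R" "normal_word F X r xs" "j \<le> length xs" "v = wg.pos (a r) (\<kappa> r xs @ take j xs)"
          "(d, e) \<in> turns F X r" using t unfolding T_def turns_def by blast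
        have "(\<kappa> r xs @ take j xs) @ drop j xs \<in> W (a r)" using W_r r by simp
        then have "v \<in> wg.wverts" using wg.pos_in_wverts[OF a(1)[OF r(1)]] r(4) by blast
        then show ?thesis using turns_neq[OF r(5)] by blast
      qed
      \<comment> \<open>A direction at the \<open>j\<close>th vertex of the path is the next letter or the inverse of the previous
        letter; at the two ends of the path these are \<open>1\<close> for an element, and cyclic for a class.\<close>
      have dir: "(\<exists>i<length xs. d = xs ! i \<and> v = wg.pos (a r) (\<kappa> r xs @ take i xs)) \<or>
          (\<exists>i<length xs. d = inv (xs ! i) \<and> v = wg.pos (a r) (\<kappa> r xs @ take (Suc i) xs)) \<or>
          (d = \<one> \<and> v = None)"
        if r: "r \<in> R" "normal_word F X r xs" "j \<le> length xs" and v: "v = wg.pos (a r) (\<kappa> r xs @ take j xs)"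
          and d: "d = extended F r xs ! Suc j \<or> d = inv (extended F r xs ! j)" for r xs j v d
      proof -
        have xs: "xs \<noteq> []" using r(2) by (auto simp: normal_word_iff)
        from d show ?thesis
        proof
          assume d: "d = extended F r xs ! Suc j"
          show ?thesis
          proof (cases "j < length xs")
            case True
            then show ?thesis using d v extended_Suc[OF True, of F r] by auto
          next
            case False
            then have j: "j = length xs" using r(3) by simp
            then have v': "v = wg.pos (a r) (\<kappa> r xs)" using v closed[OF r(1,2)] by simp
            show ?thesis
            proof (cases r)
              case (Elt g)
              then have "d = \<one>" using d j by (simp add: nth_append)
              moreover have "v = None" using v' \<kappa>(3)[OF r(1,2) Elt] wg.pos_Nil[OF a(1)[OF r(1)]] by simp
              ultimately show ?thesis by blast
            next
              case (Cls C)
              then have "d = xs ! 0" using d j xs by (simp add: nth_append hd_conv_nth)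
              then show ?thesis using v' xs by (intro disjI1 exI[of _ 0]) simp
            qed
          qed
        next
          assume d: "d = inv (extended F r xs ! j)"
          show ?thesis
          proof (cases j)
            case (Suc i)
            then have "i < length xs" using r(3) by simp
            then show ?thesis using d v Suc extended_Suc[of i xs F r] by auto
          next
            case 0
            then have v': "v = wg.pos (a r) (\<kappa> r xs)" using v by simp
            show ?thesis
            proof (cases r)
              case (Elt g)
              then have "d = \<one>" using d 0 by simp
              moreover have "v = None" using v' \<kappa>(3)[OF r(1,2) Elt] wg.pos_Nil[OF a(1)[OF r(1)]] by simp
              ultimately show ?thesis by blast
            next
              case (Cls C)
              then have "d = inv (xs ! (length xs - 1))" using d 0 xs by (simp add: last_conv_nth)
              moreover have "v = wg.pos (a r) (\<kappa> r xs @ take (Suc (length xs - 1)) xs)"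
                using v' closed[OF r(1,2)] xs by simp
              ultimately show ?thesis using xs by (intro disjI2 disjI1 exI[of _ "length xs - 1"]) simp
            qed
          qed
        qed
      qed
      have located: "\<exists>r xs j. r \<in> R \<and> support F X r \<subseteq> Y \<and> normal_word F X r xs \<and> j \<le> length xs \<and>
          v = wg.pos (a r) (\<kappa> r xs @ take j xs) \<and> (d = extended F r xs ! Suc j \<or> d = inv (extended F r xs ! j))"
        if "located T v d" for v d
        using that unfolding located_def T_def by blast
      show "v = None" if l: "located T v \<one>" for v
      proof -
        obtain r xs j where r: "r \<in> R" "normal_word F X r xs" "j \<le> length xs"
          "v = wg.pos (a r) (\<kappa> r xs @ take j xs)" "\<one> = extended F r xs ! Suc j \<or> \<one> = inv (extended F r xs ! j)"
          using located[OF l] by blast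
        have "xs ! i \<noteq> \<one> \<and> inv (xs ! i) \<noteq> \<one>" if "i < length xs" for i
        proof -
          have "xs ! i \<in> L" using r(2) that by (auto simp: normal_word_iff)
          then show ?thesis using one_notin_L inv_L by metis
        qed
        then show ?thesis using dir[OF r] by metis
      qed
      show "d \<in> L \<and> (\<exists>w d'. (v, d, w) \<in> wg.wedges \<and> located T w d')" if l: "located T v d" and d1: "d \<noteq> \<one>" for v d
      proof -
        obtain r xs j where r: "r \<in> R" "normal_word F X r xs" "j \<le> length xs"
          "v = wg.pos (a r) (\<kappa> r xs @ take j xs)" "d = extended F r xs ! Suc j \<or> d = inv (extended F r xs ! j)"
          and Yr: "support F X r \<subseteq> Y"
          using located[OF l] by blast
        have at: "\<exists>d'. located T (wg.pos (a r) (\<kappa> r xs @ take i xs)) d'" if "i \<le> length xs" for i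
          using TI[OF r(1) Yr r(2) that] unfolding located_def by blast
        have edge: "(wg.pos (a r) (\<kappa> r xs @ take i xs), xs ! i, wg.pos (a r) (\<kappa> r xs @ take (Suc i) xs)) \<in> wg.wedges"
          if i: "i < length xs" for i
        proof -
          have "(\<kappa> r xs @ take i xs) @ xs ! i # drop (Suc i) xs \<in> W (a r)"
            using W_r[OF r(1,2)] i by (simp add: Cons_nth_drop_Suc)
          from wg.pos_edge[OF a(1)[OF r(1)] this] show ?thesis using i by (simp add: take_Suc_conv_app_nth)
        qed
        from dir[OF r] d1 consider i where "i < length xs" "d = xs ! i" "v = wg.pos (a r) (\<kappa> r xs @ take i xs)"
          | i where "i < length xs" "d = inv (xs ! i)" "v = wg.pos (a r) (\<kappa> r xs @ take (Suc i) xs)"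
          by blast
        then obtain w d' where "(v, d, w) \<in> wg.wedges" "located T w d'"
        proof cases
          case 1
          then show ?thesis using that edge[OF 1(1)] at[of "Suc i"] by auto
        next
          case 2
          then show ?thesis using that wg.wedges_sym[OF edge[OF 2(1)]] at[of i] by auto
        qed
        then show ?thesis using wg.wedges_subset by blast
      qed
      \<comment> \<open>A vertex of this graph that is a letter of \<open>X\<close> or an inverse of
        one comes from the part \<open>Y\<close>, so it would be a cutvertex of the kind that the
        algorithm looks for.\<close>
      show "\<not> cutvertex (fst ` part_turns R Y \<union> snd ` part_turns R Y, part_turns R Y) c" if c: "c \<in> L" for c
      proof
        assume cut: "cutvertex (fst ` part_turns R Y \<union> snd ` part_turns R Y, part_turns R Y) c"
        then have "c \<in> fst ` part_turns R Y \<union> snd ` part_turns R Y" by (simp add: cutvertex_def)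
        then have "c \<in> pm0 F Y" using turns_letters[OF _ _ YX] unfolding part_turns_def by fastforce
        then have "c \<in> pm F Y" using c one_notin_L by (auto simp: pm0_def)
        then have "has_basis_cutvertex F Y (restricted F R Y X)"
          using cut unfolding has_basis_cutvertex_def whitehead_graph_restricted[OF YX] by blast
        then show False using Y out by (auto simp: reducible_parts_def)
      qed
    qed
    then obtain w where w: "\<And>v d e. (v, d, e) \<in> T \<Longrightarrow> v = w" by blast
    show ?thesis using w[OF TI] by blast
  qed
  then obtain p where p: "\<And>Y r xs j. Y \<in> ?P \<Longrightarrow> r \<in> R \<Longrightarrow> support F X r \<subseteq> Y \<Longrightarrow> normal_word F X r xs \<Longrightarrow>
      j \<le> length xs \<Longrightarrow> wg.pos (a r) (\<kappa> r xs @ take j xs) = p Y" by metis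

  \<comment> \<open>All positions along the word are one vertex, so a letter \<open>x\<close> of it
    labels a loop at some coset \<open>H (a r) #> g\<close>. Away from the base point this vertex
    determines the factor. The base point belongs to all factors, but there \<open>x\<close> lies in
    \<open>H (a r)\<close> itself.\<close>
  have letter: "(\<exists>k\<in>carrier F. k \<otimes> z \<otimes> inv k \<in> H (a r)) \<and> (p Y = None \<longrightarrow> z \<in> H (a r)) \<and>
      (\<forall>i c. p Y = Some (i, c) \<longrightarrow> a r = i)"
    if Y: "Y \<in> ?P" and r: "r \<in> R" "support F X r \<subseteq> Y" and z: "z \<in> support F X r" for Y r z
  proof -
    obtain xs where xs: "normal_word F X r xs" "z \<in> X" "z \<in> set xs \<or> inv z \<in> set xs" using z by (rule supportE)
    then obtain j where j: "j < length xs" "xs ! j = z \<or> xs ! j = inv z" by (metis in_set_conv_nth)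
    define x where "x = xs ! j"
    have ai: "a r \<in> I" using a(1) r(1) by blast
    note Hs = sub[OF ai] and Hc = wg.H_carrier[OF ai]
    have zc: "z \<in> carrier F" using xs(2) by simp
    have xL: "set xs \<subseteq> L" using xs(1) by (auto simp: normal_word_iff)
    define g where "g = word_prod F (\<kappa> r xs @ take j xs)"
    have sL: "set (\<kappa> r xs @ take j xs) \<subseteq> L" using \<kappa>(1)[OF r(1) xs(1)] xL set_take_subset[of j xs] by auto
    then have gc: "g \<in> carrier F" by (simp only: g_def word_prod_closed set_L_carrier)
    have "x \<in> set xs" using j(1) x_def by simp
    then have xc: "x \<in> carrier F" using xL by auto
    have "word_prod F (\<kappa> r xs @ take (Suc j) xs) = word_prod F ((\<kappa> r xs @ take j xs) @ [x])"
      using j(1) by (simp add: take_Suc_conv_app_nth x_def)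
    also have "\<dots> = g \<otimes> x" unfolding g_def using set_L_carrier[OF sL] xc by (subst word_prod_append) auto
    finally have g': "word_prod F (\<kappa> r xs @ take (Suc j) xs) = g \<otimes> x" .
    have v: "wg.vt (a r) (H (a r) #> g) = p Y" "wg.vt (a r) (H (a r) #> (g \<otimes> x)) = p Y"
      using p[OF Y r xs(1), of j] p[OF Y r xs(1), of "Suc j"] j(1) unfolding wg.pos_def g' g_def by auto
    then have eq: "H (a r) #> (g \<otimes> x) = H (a r) #> g" using wg.vt_eq by metis
    have "H (a r) #> (g \<otimes> x \<otimes> inv g) = H (a r)"
      using eq gc xc Hc by (intro coset_mult_inv2) auto
    then have gx: "g \<otimes> x \<otimes> inv g \<in> H (a r)"
      by (rule coset_join1[OF _ _ Hs]) (use gc xc in auto)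
    have inv': "z = x \<or> z = inv x" using j(2) x_def zc by auto
    have "g \<otimes> inv x \<otimes> inv g = inv (g \<otimes> x \<otimes> inv g)" using gc xc by (simp add: inv_mult_group m_assoc)
    then have "g \<otimes> inv x \<otimes> inv g \<in> H (a r)" using subgroup.m_inv_closed[OF Hs gx] by simp
    then have 1: "g \<otimes> z \<otimes> inv g \<in> H (a r)" using gx inv' by auto
    have 2: "z \<in> H (a r)" if "p Y = None"
    proof -
      have "H (a r) #> g = H (a r)" using v(1) that by (simp add: wg.vt_def split: if_splits)
      then have "H (a r) #> x = H (a r)" using eq gc xc Hc by (simp add: coset_mult_assoc[symmetric])
      then have "x \<in> H (a r)" by (rule coset_join1[OF _ xc Hs])
      then show ?thesis using inv' subgroup.m_inv_closed[OF Hs] by auto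
    qed
    have 3: "a r = i" if "p Y = Some (i, c)" for i c using v(1) that by (simp add: wg.vt_def split: if_splits)
    show ?thesis using 1 2 3 gc by blast
  qed

  note fin = support_partition_finest[OF R]
  have finP: "finite ?P" using fin(1) assms(1) finite_elements by blast
  have part_of: "\<exists>Y. Y \<in> ?P \<and> support F X r \<subseteq> Y" if "r \<in> R" for r
    using fin(2) that by (auto simp: includes_supports_def)
  define J where "J = I - a ` R"
  define Z where "Z = (\<Union>r\<in>R. support F X r)"
  have ZX: "Z \<subseteq> X" using support_subset by (auto simp: Z_def)
  have JZ: "card J + card Z \<le> card X"
  proof (rule factors_count[OF assms(1) fact _ _ _ ZX])
    show "\<exists>i\<in>I - J. \<exists>k\<in>carrier F. k \<otimes> z \<otimes> inv k \<in> H i" if z: "z \<in> Z" for z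
    proof -
      obtain r where r: "r \<in> R" "z \<in> support F X r" using z by (auto simp: Z_def)
      obtain Y where "Y \<in> ?P" "support F X r \<subseteq> Y" using part_of[OF r(1)] by blast
      then have "\<exists>k\<in>carrier F. k \<otimes> z \<otimes> inv k \<in> H (a r)" using letter r by blast
      moreover have "a r \<in> I - J" using a(1) r(1) by (auto simp: J_def)
      ultimately show ?thesis by blast
    qed
  qed (use finI ne in \<open>auto simp: J_def\<close>)
  define PS where "PS = {Y \<in> ?P. \<exists>r\<in>R. support F X r \<subseteq> Y}"
  have PSf: "finite PS" using finP by (simp add: PS_def)
  \<comment> \<open>A letter outside all supports can be split off from its part, hence is a part by
    itself.\<close>
  have "card (X - Z) \<le> card (?P - PS)"
  proof (rule card_inj_on_le[of "\<lambda>x. {x}"])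
    show "(\<lambda>x. {x}) ` (X - Z) \<subseteq> ?P - PS"
    proof
      fix S assume "S \<in> (\<lambda>x. {x}) ` (X - Z)"
      then obtain x where x: "x \<in> X" "x \<notin> Z" "S = {x}" by blast
      then obtain Y where Y: "Y \<in> ?P" "x \<in> Y" using fin(1) by (auto simp: partition_on_def)
      have "{x} = {} \<or> Y - {x} = {}"
        by (rule support_partition_split[OF R Y(1)]) (use x Y in \<open>auto simp: Z_def\<close>)
      then have "Y = {x}" using Y(2) by blast
      moreover have "{x} \<notin> PS" using x(2) support_nonempty[OF rn] by (fastforce simp: PS_def Z_def)
      ultimately show "S \<in> ?P - PS" using Y(1) x(3) by simp
    qed
  qed (use finP in auto)
  moreover have "card (I - J) \<le> card PS"
  proof -
    have "\<exists>Y. Y \<in> PS \<and> (\<exists>r\<in>R. a r = i \<and> support F X r \<subseteq> Y)" if i: "i \<in> I - J" for i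
    proof -
      obtain r where r: "r \<in> R" "a r = i" using i by (auto simp: J_def)
      then show ?thesis using part_of[OF r(1)] by (auto simp: PS_def)
    qed
    then obtain y where y: "\<And>i. i \<in> I - J \<Longrightarrow> y i \<in> PS"
      "\<And>i. i \<in> I - J \<Longrightarrow> \<exists>r\<in>R. a r = i \<and> support F X r \<subseteq> y i" by metis
    have "inj_on y (I - J)"
    proof (rule inj_onI, rule ccontr)
      fix i i' assume i: "i \<in> I - J" "i' \<in> I - J" "y i = y i'" "i \<noteq> i'"
      define Y where "Y = y i"
      have Y: "Y \<in> ?P" using y(1)[OF i(1)] by (simp add: Y_def PS_def)
      obtain r where r: "r \<in> R" "a r = i" "support F X r \<subseteq> Y" using y(2)[OF i(1)] by (auto simp: Y_def)
      obtain r' where r': "r' \<in> R" "a r' = i'" "support F X r' \<subseteq> Y" using y(2)[OF i(2)] i(3) by (auto simp: Y_def)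
      \<comment> \<open>The letters of the part that are used by the factor \<open>i\<close>. None
        of them is used by another factor: away from the base point \<open>p Y\<close> determines
        the factor, and at the base point the letter would lie in two factors. So the part would
        split.\<close>
      define Yi where "Yi = {z \<in> Y. \<exists>s\<in>R. a s = i \<and> support F X s \<subseteq> Y \<and> z \<in> support F X s}"
      have disj: "support F X s \<inter> Yi = {}" if s: "s \<in> R" "support F X s \<subseteq> Y" "a s \<noteq> i" for s
      proof (rule ccontr)
        assume "support F X s \<inter> Yi \<noteq> {}"
        then obtain z t where z: "z \<in> support F X s" "t \<in> R" "a t = i" "support F X t \<subseteq> Y" "z \<in> support F X t"
          by (auto simp: Yi_def)
        note l = letter[OF Y s(1,2) z(1)] letter[OF Y z(2,4,5)]
        show False
        proof (cases "p Y")
          case None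
          then have "z \<in> H (a s)" "z \<in> H (a t)" using l by auto
          then have "z = \<one>" using factors_Int[OF fact a(1)[OF s(1)] a(1)[OF z(2)]] s(3) z(3) by blast
          then show False using one_notin_X support_subset z(1) by blast
        next
          case (Some q)
          then show False using l s(3) z(3) by (cases q) auto
        qed
      qed
      have "Yi = {} \<or> Y - Yi = {}"
      proof (rule support_partition_split[OF R Y])
        fix s assume s: "s \<in> R" "support F X s \<subseteq> Y"
        show "support F X s \<subseteq> Yi \<or> support F X s \<subseteq> Y - Yi"
        proof (cases "a s = i")
          case True
          then show ?thesis using s by (auto simp: Yi_def)
        next
          case False
          then show ?thesis using disj[OF s] s(2) by blast
        qed
      qed (auto simp: Yi_def)
      moreover have "support F X r \<subseteq> Yi" using r by (auto simp: Yi_def)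
      moreover have "support F X r' \<subseteq> Y - Yi" using disj[OF r'(1,3)] r' i(4) by blast
      ultimately show False using support_nonempty[OF rn[OF r(1)]] support_nonempty[OF rn[OF r'(1)]] by blast
    qed
    then show ?thesis using y(1) PSf by (intro card_inj_on_le[of y]) auto
  qed
  moreover have "card I = card (I - J) + card J"
    using card_Int_Diff[OF finI, of "a ` R"] by (simp add: J_def Diff_Diff_Int)
  moreover have "card (X - Z) + card Z = card X"
    using assms(1) ZX by (simp add: card_Diff_subset finite_subset card_mono)
  moreover have "card (?P - PS) + card PS = card ?P"
    using finP by (simp add: PS_def card_Diff_subset card_mono)
  ultimately show ?thesis using JZ finI by linarith
qed

end

theorem mainTheorem1:
  fixes F :: "('a, 'b) monoid_scheme" and R :: "'a elt_or_class set" and X :: "'a set"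
  assumes "finite_rank_free_group F"
    and "finite R" and "R \<subseteq> elts_and_classes F (carrier F - {\<one>\<^bsub>F\<^esub>})"
    and "free_basis F X"
  shows "algorithm_stops F R X \<and>
    (\<forall>X\<^sub>1. algorithm_outputs F R X X\<^sub>1 \<longrightarrow>
       free_basis F X\<^sub>1 \<and>
       allocating F R (support_partition F X\<^sub>1 R) (generate F) \<and>
       atomic TYPE('j) F R (support_partition F X\<^sub>1 R) (generate F) \<and>
       finite (support_partition F X\<^sub>1 R) \<and>
       (\<forall>(I :: 'i set) H. allocating F R I H \<longrightarrow>
          finite I \<and> card I \<le> card (support_partition F X\<^sub>1 R)))"
proof -
  have gr: "group F" using assms(1) by (simp add: finite_rank_free_group_def)
  obtain X\<^sub>0 where X0: "finite X\<^sub>0" "free_basis F X\<^sub>0" using assms(1) by (auto simp: finite_rank_free_group_def)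
  have out: "free_basis F X\<^sub>1 \<and>
       allocating F R (support_partition F X\<^sub>1 R) (generate F) \<and>
       atomic TYPE('j) F R (support_partition F X\<^sub>1 R) (generate F) \<and>
       finite (support_partition F X\<^sub>1 R) \<and>
       (\<forall>(I :: 'i set) H. allocating F R I H \<longrightarrow>
          finite I \<and> card I \<le> card (support_partition F X\<^sub>1 R))"
    if o: "algorithm_outputs F R X X\<^sub>1" for X\<^sub>1
  proof -
    have b: "free_basis F X\<^sub>1" and red: "reducible_parts F R X\<^sub>1 = {}"
      using o algorithm_reaches_basis[OF gr assms(3,4)] by (auto simp: algorithm_outputs_def)
    interpret based_group F X\<^sub>1 using gr b by (simp add: based_group_def based_group_axioms_def)
    have finX: "finite X\<^sub>1" using finite_basis[OF X0] .
    have finP: "finite (support_partition F X\<^sub>1 R)"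
      using support_partition_finest(1)[OF assms(3)] finX finite_elements by blast
    note al = support_partition_allocating[OF assms(3)]
    \<comment> \<open>The size bound is applied at two index types: to refinements indexed by
      \<open>'j\<close> for atomicity, and below to arbitrary competitors indexed by
      \<open>'i\<close>.\<close>
    have "atomic TYPE('j) F R (support_partition F X\<^sub>1 R) (generate F)"
      by (rule maximal_atomic[OF gr al finP]) (rule factorization_size[OF finX assms(2,3) red])
    then show ?thesis
      using b al finP factorization_size[OF finX assms(2,3) red] by blast
  qed
  show ?thesis using algorithm_stops[OF gr assms(2,3,4)] out by blast
qed

end
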